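(* Let $p \equiv 1 \pmod 8$ and $q \equiv 3 \pmod 4$ be primes with $\left(\frac{p}{q}\right) = +1$, and consider the elliptic curve $E: y^2 = x(x^2 - 4pq^2)$ and its 2-isogenous curve $\hat E: y^2 = x(x^2 + 16pq^2)$. (i) If the curve $N^2 = p M^4 - 4q^2 e^4$ has a rational point $(M,e,N)$ with $(M,e) \neq (0,0)$, then $\left(\frac{2}{p}\right)_4 = \left(\frac{q}{p}\right)_4 = +1$. (ii) $S^{(\phi)}(E/\mathbb{Q}) = W(E/\mathbb{Q})$, i.e. the group $\mathrm{III}(E/\mathbb{Q})[\phi] := S^{(\phi)}(E/\mathbb{Q})/W(E/\mathbb{Q})$ is trivial. (iii) If $\left(\frac{2}{p}\right)_4 = -1$ or $\left(\frac{q}{p}\right)_4 = -1$, then the order of $\mathrm{III}(\hat E/\mathbb{Q})[\psi] := S^{(\psi)}(\hat E/\mathbb{Q})/W(\hat E/\mathbb{Q})$ is divisible by $4$.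
   Context: Quartic residue symbol: for a prime $p \equiv 1 \pmod 8$ and an integer $c$ that is a nonzero quadratic residue mod $p$, $\left(\frac{c}{p}\right)_4 \in \{\pm1\}$ with $\left(\frac{c}{p}\right)_4 \equiv c^{(p-1)/4} \pmod p$. Selmer-type groups: for a nonzero squarefree integer $b_1$ dividing $-4pq^2$, let $\mathcal{T}^{(\psi)}(b_1)$ be the curve $N^2 = b_1 M^4 - (4pq^2/b_1) e^4$; for a nonzero squarefree integer $b_1$ dividing $16pq^2$, let $\mathcal{T}^{(\phi)}(b_1)$ be the curve $N^2 = b_1 M^4 + (16pq^2/b_1) e^4$. A point is nontrivial if $(M,e)\neq(0,0)$. Identify $b_1$ with its class $b_1\mathbb{Q}^{\times 2}$ in $\mathbb{Q}^\times/\mathbb{Q}^{\times 2}$. Then $S^{(\psi)}(\hat E/\mathbb{Q})$ is the subgroup of classes $b_1$ for which $\mathcal{T}^{(\psi)}(b_1)$ has a nontrivial point over $\mathbb{R}$ and over every $\mathbb{Q}_\ell$, and $W(\hat E/\mathbb{Q})$ is the subgroup of those for which $\mathcal{T}^{(\psi)}(b_1)$ has a nontrivial rational point; $S^{(\phi)}(E/\mathbb{Q})$ and $W(E/\mathbb{Q})$ are defined in the same way using the curves $\mathcal{T}^{(\phi)}(b_1)$. *)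

theory Defs
  imports Complex_Main "HOL-Number_Theory.Number_Theory" "HOL-Computational_Algebra.Squarefree"
begin

text \<open>Quartic residue symbol (c/p)_4 in {1,-1}, for p = 1 mod 8 and c a nonzero
  quadratic residue mod p: it is the value congruent to c^((p-1)/4) mod p.\<close>
definition quartic_sym :: "int \<Rightarrow> int \<Rightarrow> int" where
  "quartic_sym c p = (if [c ^ nat ((p - 1) div 4) = 1] (mod p) then 1 else -1)"

definition has_rat_pt :: "int \<Rightarrow> int \<Rightarrow> bool" where
  "has_rat_pt a b \<longleftrightarrow> (\<exists>M e N :: rat. (M, e) \<noteq> (0, 0) \<and>
      N ^ 2 = of_int a * M ^ 4 + of_int b * e ^ 4)"

definition has_real_pt :: "int \<Rightarrow> int \<Rightarrow> bool" where
  "has_real_pt a b \<longleftrightarrow> (\<exists>M e N :: real. (M, e) \<noteq> (0, 0) \<and>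
      N ^ 2 = of_int a * M ^ 4 + of_int b * e ^ 4)"

text \<open>Nontrivial Q_l-point, expressed (by weighted rescaling into Z_l and compactness
  of Z_l) as: for every k there is an integer solution mod l^k with l not dividing
  both M and e.\<close>
definition has_local_pt :: "int \<Rightarrow> int \<Rightarrow> int \<Rightarrow> bool" where
  "has_local_pt l a b \<longleftrightarrow> (\<forall>k::nat. \<exists>M e N :: int. (\<not> l dvd M \<or> \<not> l dvd e) \<and>
      [N ^ 2 = a * M ^ 4 + b * e ^ 4] (mod l ^ k))"

definition everywhere_loc_sol :: "int \<Rightarrow> int \<Rightarrow> bool" where
  "everywhere_loc_sol a b \<longleftrightarrow> has_real_pt a b \<and> (\<forall>l. prime l \<longrightarrow> has_local_pt l a b)"

text \<open>Squarefree integers represent the classes of Q^*/Q^*2 bijectively.\<close>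
definition Selmer_psi :: "int \<Rightarrow> int \<Rightarrow> int set" where
  "Selmer_psi p q = {b1. b1 \<noteq> 0 \<and> squarefree b1 \<and> b1 dvd (-4 * p * q^2) \<and>
      everywhere_loc_sol b1 (-(4 * p * q^2) div b1)}"

definition W_psi :: "int \<Rightarrow> int \<Rightarrow> int set" where
  "W_psi p q = {b1. b1 \<noteq> 0 \<and> squarefree b1 \<and> b1 dvd (-4 * p * q^2) \<and>
      has_rat_pt b1 (-(4 * p * q^2) div b1)}"

definition Selmer_phi :: "int \<Rightarrow> int \<Rightarrow> int set" where
  "Selmer_phi p q = {b1. b1 \<noteq> 0 \<and> squarefree b1 \<and> b1 dvd (16 * p * q^2) \<and>
      everywhere_loc_sol b1 ((16 * p * q^2) div b1)}"

definition W_phi :: "int \<Rightarrow> int \<Rightarrow> int set" where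
  "W_phi p q = {b1. b1 \<noteq> 0 \<and> squarefree b1 \<and> b1 dvd (16 * p * q^2) \<and>
      has_rat_pt b1 ((16 * p * q^2) div b1)}"

end

theory Submission
  imports Defs
begin

text \<open>
  \<^emph>\<open>Part (i).\<close> For $c \in \{2, q\}$ Legendre's theorem gives a primitive solution of
  $x^2 = p y^2 + c z^2$, and reduction modulo $p$ shows that the quartic symbol of $c$ is $(x/p)$.
  A point on $N^2 = p M^4 - 4 q^2 e^4$ turns the product $(x M^2 + N y) (x M^2 - N y)$ into the
  norm form $c (z M^2)^2 + (2 q e^2 y)^2$, so every odd prime not dividing $c$ which divides
  $x M^2 + N y$ to an odd power has $-c$ as a quadratic residue. For a suitable sign of $N$, this
  number is $2 x M^2$ modulo $q$ if $c = q$, and its half is $x$ or $3 x$ modulo $8$ if $c = 2$.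
  Quadratic reciprocity then gives $(x/p) = 1$.

  \<^emph>\<open>Part (ii).\<close> Conditions at $\infty$, $2$ and $q$ cut $S^{(\phi)}$ down to $\{1, p\}$,
  and both classes have obvious rational points.

  \<^emph>\<open>Part (iii).\<close> All $16$ classes lie in $S^{(\psi)}$. The class $-p$ is trivially in $W$,
  and modulo it $W$ is represented by divisors $b$ of $2 q$. If such a $b$ lies in $W$, then
  $b$ is a fourth power modulo $p$ (reduce the curve modulo $p$ and apply reciprocity to the
  prime factors of $N$); moreover $-1$ is not in $W$ by part (i). Hence
  $W / \langle -p \rangle$ has order at most $2$.
\<close>

section \<open>Legendre symbols\<close>

text \<open>The norm form in part (i) controls the parity of prime powers in a product, while
  reciprocity needs the prime factors of a single factor. A prime dividing both
  \<open>x * M^2 + N * y\<close> and \<open>x * M^2 - N * y\<close> escapes the parity argument; for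
  such a prime the curve and the conic together show directly that -c is a square. Replacing N by -N
  exchanges the two factors; divisibility of their product by q, or their sum modulo 4, decides
  which one has a usable residue. Symbols are evaluated prime by prime: a completely multiplicative
  function with values in {-1, 0, 1} is nonnegative at n if it is so at the primes of odd
  multiplicity, and coprimality then excludes 0. W appears only as a set of integers, so the
  products of classes that matter are realized on points: multiplication by -p exchanges the two
  variables of the quartic, and x times -x comes from a line through two points, giving the class -1
  that part (i) excludes.\<close>

lemma mod_4_eq_mod_8: "m mod 4 = (m mod 8) mod 4" for m :: int
  by (simp add: mod_mod_cancel)

lemma mod_8_eq_mod_16: "m mod 8 = (m mod 16) mod 8" for m :: int
  by (simp add: mod_mod_cancel)

lemma mod_8_cases:
  fixes m :: int
  shows "m mod 8 = 0 \<or> m mod 8 = 1 \<or> m mod 8 = 2 \<or> m mod 8 = 3 \<or>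
    m mod 8 = 4 \<or> m mod 8 = 5 \<or> m mod 8 = 6 \<or> m mod 8 = 7"
  using pos_mod_bound[of 8 m] pos_mod_sign[of 8 m] by auto

lemma mod_8_odd_cases:
  fixes m :: int
  assumes "odd m"
  shows "m mod 8 = 1 \<and> m mod 4 = 1 \<or> m mod 8 = 3 \<and> m mod 4 = 3 \<or>
    m mod 8 = 5 \<and> m mod 4 = 1 \<or> m mod 8 = 7 \<and> m mod 4 = 3"
proof -
  have "odd (m mod 8)" using assms by (simp add: dvd_mod_iff)
  then show ?thesis unfolding mod_4_eq_mod_8[of m] using mod_8_cases[of m] by (elim disjE) simp_all
qed

lemma mod_8_eq_1_imp_mod_16:
  fixes m :: int
  assumes "m mod 8 = 1"
  shows "m mod 16 = 1 \<or> m mod 16 = 9"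
proof -
  obtain k where m: "m = 8 * k + 1" using assms mult_div_mod_eq[of 8 m] by metis
  show ?thesis
  proof (cases "even k")
    case True
    then obtain j where "m = 16 * j + 1" using m by (auto elim: evenE)
    then show ?thesis by simp
  next
    case False
    then obtain j where "m = 16 * j + 9" using m by (auto elim: oddE)
    then show ?thesis by simp
  qed
qed

lemma Legendre_cong_power:
  fixes p :: int
  assumes "prime p" "2 < p"
  shows "[Legendre a p = a ^ nat ((p - 1) div 2)] (mod p)"
proof -
  have "prime (nat p)" "2 < nat p" "int (nat p) = p" using assms by auto
  moreover have "(nat p - 1) div 2 = nat ((p - 1) div 2)"
    using assms by linarith
  ultimately show ?thesis using euler_criterion[of "nat p" a] by simp
qed

lemma Legendre_cases: "Legendre a p = 0 \<or> Legendre a p = 1 \<or> Legendre a p = - 1"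
  by (simp add: Legendre_def)

lemma Legendre_eq_0_iff: "Legendre a p = 0 \<longleftrightarrow> p dvd a"
  by (simp add: Legendre_def cong_0_iff)

lemma Legendre_eq_1_iff: "Legendre a p = 1 \<longleftrightarrow> \<not> p dvd a \<and> QuadRes p a"
  by (simp add: Legendre_def cong_0_iff)

lemma Legendre_cong: "[a = b] (mod p) \<Longrightarrow> Legendre a p = Legendre b p"
  by (simp add: Legendre_def QuadRes_def cong_def)

lemma small_cong_imp_eq:
  fixes p :: int
  assumes "2 < p" "[u = v] (mod p)" "u = 0 \<or> u = 1 \<or> u = - 1" "v = 0 \<or> v = 1 \<or> v = - 1"
  shows "u = v"
proof (rule ccontr)
  assume "u \<noteq> v"
  then have "u - v \<noteq> 0" by simp
  moreover have "p dvd (u - v)" using assms by (simp add: cong_iff_dvd_diff)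
  ultimately have "\<bar>p\<bar> \<le> \<bar>u - v\<bar>" by (rule dvd_imp_le_int)
  then show False using assms by auto
qed

lemma Legendre_mult:
  fixes p :: int
  assumes "prime p" "2 < p"
  shows "Legendre (a * b) p = Legendre a p * Legendre b p"
proof (rule small_cong_imp_eq[OF assms(2)])
  have "[Legendre (a * b) p = (a * b) ^ nat ((p - 1) div 2)] (mod p)"
    using assms by (rule Legendre_cong_power)
  moreover have "[Legendre a p * Legendre b p = (a * b) ^ nat ((p - 1) div 2)] (mod p)"
    unfolding power_mult_distrib using assms by (intro cong_mult Legendre_cong_power)
  ultimately show "[Legendre (a * b) p = Legendre a p * Legendre b p] (mod p)"
    by (metis cong_sym cong_trans)
  show "Legendre a p * Legendre b p = 0 \<or> Legendre a p * Legendre b p = 1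
      \<or> Legendre a p * Legendre b p = - 1"
    using Legendre_cases[of a p] Legendre_cases[of b p] by auto
qed (rule Legendre_cases)

lemma Legendre_square: "\<not> p dvd a \<Longrightarrow> prime p \<Longrightarrow> Legendre (a\<^sup>2) p = 1"
  unfolding Legendre_eq_1_iff QuadRes_def by (metis cong_refl prime_dvd_power)

lemma Legendre_minus_one:
  fixes p :: int
  assumes "prime p" "2 < p"
  shows "Legendre (- 1) p = (if p mod 4 = 1 then 1 else - 1)"
proof (rule small_cong_imp_eq[OF assms(2)])
  have "odd p" using assms prime_odd_int by simp
  then have "p mod 4 = 1 \<or> p mod 4 = 3" by presburger
  moreover have "even (nat ((p - 1) div 2))" if "p mod 4 = 1"
    using that assms(2) by (simp add: even_nat_iff) presburger
  moreover have "odd (nat ((p - 1) div 2))" if "p mod 4 = 3"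
    using that assms(2) by (simp add: even_nat_iff) presburger
  ultimately have "(- 1) ^ nat ((p - 1) div 2) = (if p mod 4 = 1 then 1 else - 1 :: int)"
    by (auto simp: uminus_power_if)
  then show "[Legendre (- 1) p = (if p mod 4 = 1 then 1 else - 1)] (mod p)"
    using Legendre_cong_power[OF assms, of "- 1"] by simp
qed (use Legendre_cases[of "- 1" p] in auto)

text \<open>Gauss's lemma: with p = 2 m + 1, the sign is the parity of the number of x in 1..m whose
  double exceeds m, and this number is m - m div 2.\<close>

lemma Legendre_two:
  fixes p :: int
  assumes "prime p" "2 < p"
  shows "Legendre 2 p = (if p mod 8 = 1 \<or> p mod 8 = 7 then 1 else - 1)"
proof -
  have odd: "odd p" using assms prime_odd_int by simp
  then obtain z where z: "p = 2 * z + 1" by (elim oddE)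
  define m where "m = nat z"
  have m: "p = 2 * int m + 1" using z assms(2) by (simp add: m_def)
  interpret GAUSS "nat p" 2
    using assms odd by unfold_locales (auto simp: cong_0_iff dest: zdvd_imp_le)
  have p: "int (nat p) = p" using assms by simp
  have "E = (\<lambda>x. 2 * x) ` {int (m div 2)<..int m}"
  proof -
    have "C = (\<lambda>x. 2 * x) ` {0<..int m}"
      unfolding C_def B_def A_def image_image p
      by (rule image_cong) (auto simp: m ac_simps)
    then have "E = (\<lambda>x. 2 * x) ` {0<..int m} \<inter> {int m<..}"
      unfolding E_def p using m by simp
    also have "\<dots> = (\<lambda>x. 2 * x) ` {int (m div 2)<..int m}"
      by auto
    finally show ?thesis .
  qed
  then have "card E = m - m div 2"
    by (simp add: card_image inj_on_def nat_diff_distrib)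
  then have "Legendre 2 p = (- 1) ^ (m - m div 2)"
    using gauss_lemma p by simp
  moreover have "even (m - m div 2) \<longleftrightarrow> m mod 4 = 0 \<or> m mod 4 = 3"
    by presburger
  moreover have "m mod 4 = 0 \<or> m mod 4 = 3 \<longleftrightarrow> p mod 8 = 1 \<or> p mod 8 = 7"
  proof -
    have "m mod 4 < 4" by simp
    then consider "m mod 4 = 0" | "m mod 4 = 1" | "m mod 4 = 2" | "m mod 4 = 3" by linarith
    moreover have "p = 8 * int (m div 4) + (2 * int (m mod 4) + 1)"
      unfolding m using div_mult_mod_eq[of m 4] by linarith
    ultimately show ?thesis by cases simp_all
  qed
  ultimately show ?thesis by (simp add: uminus_power_if)
qed

lemma Legendre_reciprocity:
  fixes p r :: int
  assumes "prime p" "2 < p" "prime r" "2 < r" "p \<noteq> r"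
  shows "Legendre p r * Legendre r p = (if p mod 4 = 3 \<and> r mod 4 = 3 then - 1 else 1)"
proof -
  have odd: "odd p" "odd r" using assms prime_odd_int by simp_all
  have "Legendre p r * Legendre r p = (- 1) ^ nat ((p - 1) div 2 * ((r - 1) div 2))"
    using assms by (intro Quadratic_Reciprocity_int) auto
  moreover have "even ((p - 1) div 2) \<longleftrightarrow> p mod 4 \<noteq> 3" "even ((r - 1) div 2) \<longleftrightarrow> r mod 4 \<noteq> 3"
    using odd by presburger+
  moreover have "0 \<le> (p - 1) div 2" "0 \<le> (r - 1) div 2" using assms by simp_all
  ultimately show ?thesis
    by (simp add: uminus_power_if even_nat_iff)
qed

lemma Legendre_swap:
  fixes p r :: int
  assumes "prime p" "p mod 4 = 1" "prime r" "2 < r"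
  shows "Legendre r p = Legendre p r"
proof (cases "p = r")
  case False
  have "p \<noteq> 2" using assms by auto
  then have "2 < p" using assms prime_ge_2_int[of p] by simp
  then have "Legendre p r * Legendre r p = 1"
    using Legendre_reciprocity[OF assms(1) _ assms(3,4) False] assms by simp
  then show ?thesis using Legendre_cases[of r p] Legendre_cases[of p r] by auto
qed simp

text \<open>Replacing q by -q, which is 1 modulo 4, absorbs the sign of the reciprocity law for
  every residue of r modulo 4. For r = q both sides are 0.\<close>

lemma Legendre_swap_neg:
  fixes q r :: int
  assumes "prime q" "q mod 4 = 3" "prime r" "2 < r"
  shows "Legendre r q = Legendre (- q) r"
proof (cases "q = r")
  case True
  then show ?thesis by (simp add: Legendre_def cong_0_iff)
next
  case False
  have "q \<noteq> 2" using assms by auto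
  then have "2 < q" using assms prime_ge_2_int[of q] by simp
  have "odd r" using assms prime_odd_int by simp
  then have "r mod 4 = 1 \<or> r mod 4 = 3" by presburger
  moreover have "Legendre q r * Legendre r q = (if q mod 4 = 3 \<and> r mod 4 = 3 then - 1 else 1)"
    using Legendre_reciprocity[OF assms(1) \<open>2 < q\<close> assms(3,4) False] .
  moreover have "Legendre (- q) r = Legendre (- 1) r * Legendre q r"
    using Legendre_mult[OF assms(3,4), of "- 1" q] by simp
  ultimately show ?thesis
    using Legendre_cases[of r q] Legendre_cases[of q r] Legendre_minus_one[OF assms(3,4)] assms(2)
    by auto
qed

lemma QuadRes_divide:
  fixes r :: int
  assumes "prime r" "\<not> r dvd z" "[a * z\<^sup>2 = w\<^sup>2] (mod r)"
  shows "QuadRes r a"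
proof -
  have "coprime z r" using assms by (simp add: prime_imp_coprime coprime_commute)
  then obtain u where u: "[z * u = 1] (mod r)" using cong_solve_coprime_int by blast
  have "[(w * u)\<^sup>2 = w\<^sup>2 * u\<^sup>2] (mod r)" by (simp add: power_mult_distrib)
  also have "[w\<^sup>2 * u\<^sup>2 = (a * z\<^sup>2) * u\<^sup>2] (mod r)"
    by (intro cong_mult cong_refl) (simp add: assms(3) cong_sym)
  also have "(a * z\<^sup>2) * u\<^sup>2 = a * (z * u)\<^sup>2" by (simp add: power_mult_distrib)
  also have "[a * (z * u)\<^sup>2 = a * 1\<^sup>2] (mod r)" using u by (intro cong_mult cong_pow cong_refl)
  finally show ?thesis unfolding QuadRes_def by auto
qed

lemma QuadRes_mult: "QuadRes r a \<Longrightarrow> QuadRes r b \<Longrightarrow> QuadRes r (a * b)"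
  unfolding QuadRes_def by (metis cong_mult power_mult_distrib)

text \<open>Prime squares contribute f(r)^2 >= 0 whatever f(r) is, and removing r^2 keeps the parity
  of all multiplicities. The conclusion is >= 0 because f may vanish at a prime of even
  multiplicity.\<close>

lemma multiplicative_nonneg:
  fixes f :: "int \<Rightarrow> int" and n :: int
  assumes mult: "\<And>a b. f (a * b) = f a * f b" and one: "f 1 = 1" and "n > 0"
    and prime: "\<And>r. prime r \<Longrightarrow> odd (multiplicity r n) \<Longrightarrow> f r \<ge> 0"
  shows "f n \<ge> 0"
  using assms(3,4)
proof (induction "nat n" arbitrary: n rule: less_induct)
  case less
  show ?case
  proof (cases "n = 1")
    case True
    then show ?thesis using one by simp
  next
    case False
    then have "\<not> is_unit n" using less.prems(1) by auto
    then obtain r where r: "prime r" "r dvd n" using less.prems(1) prime_divisor_exists[of n] by auto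
    then obtain m where m: "n = r * m" by (elim dvdE)
    have r2: "r \<ge> 2" using r prime_ge_2_int by blast
    have m0: "m > 0" using less.prems(1) m r2 by (simp add: zero_less_mult_iff)
    have mn: "m < n" using m r2 m0 by simp
    show ?thesis
    proof (cases "r dvd m")
      case True
      then obtain k where k: "m = r * k" by (elim dvdE)
      have k0: "k > 0" using m0 k r2 by (simp add: zero_less_mult_iff)
      have "k < n" using k r2 k0 mn by (smt (verit) mult_le_cancel_right1)
      have "f k \<ge> 0"
      proof (rule less.hyps)
        show "nat k < nat n" using \<open>k < n\<close> k0 by simp
        fix s :: int
        assume s: "prime s" "odd (multiplicity s k)"
        have "multiplicity s n = 2 * multiplicity s r + multiplicity s k"
          using r2 k0 s prime_elem_multiplicity_mult_distrib[OF prime_imp_prime_elem, of s r "r * k"]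
            prime_elem_multiplicity_mult_distrib[OF prime_imp_prime_elem, of s r k] by (simp add: m k)
        then show "f s \<ge> 0" using less.prems(2) s by simp
      qed (rule k0)
      moreover have "f n = (f r)\<^sup>2 * f k" by (simp add: m k mult power2_eq_square)
      ultimately show ?thesis by simp
    next
      case False
      have dist: "multiplicity s n = multiplicity s r + multiplicity s m" if "prime s" for s
        using r2 m0 that prime_elem_multiplicity_mult_distrib[OF prime_imp_prime_elem, of s r m] by (simp add: m)
      have "f m \<ge> 0"
      proof (rule less.hyps)
        show "nat m < nat n" using mn m0 by simp
        fix s :: int
        assume s: "prime s" "odd (multiplicity s m)"
        have "s \<noteq> r" using False s by (auto simp: not_dvd_imp_multiplicity_0)
        then have "multiplicity s r = 0" using s r
          by (simp add: multiplicity_distinct_prime_power prime_multiplicity_other)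
        then show "f s \<ge> 0" using less.prems(2) s dist by simp
      qed (rule m0)
      moreover have "f r \<ge> 0"
        using less.prems(2)[of r] r dist[of r] False r2 by (simp add: not_dvd_imp_multiplicity_0)
      ultimately show ?thesis by (simp add: m mult)
    qed
  qed
qed

section \<open>Legendre's theorem on the conic $x^2 = p y^2 + c z^2$\<close>

text \<open>Thue's pigeonhole argument. The box has more than sqrt(p c) * sqrt c * sqrt p = p c
  points, and p c is the number of pairs of residues, so two points agree and their difference is
  the required triple.\<close>

lemma conic_small_value:
  fixes p c :: int
  assumes "prime p" "prime c" "p \<noteq> c" "QuadRes p c" "QuadRes c p"
  shows "\<exists>x y z. (x, y, z) \<noteq> (0, 0, 0) \<and> x\<^sup>2 < p * c \<and> y\<^sup>2 < c \<and> z\<^sup>2 < p \<and>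
    p * c dvd x\<^sup>2 - p * y\<^sup>2 - c * z\<^sup>2"
proof -
  obtain t where t: "[t\<^sup>2 = c] (mod p)" using assms(4) by (auto simp: QuadRes_def)
  obtain s where s: "[s\<^sup>2 = p] (mod c)" using assms(5) by (auto simp: QuadRes_def)
  have p0: "p > 0" "c > 0" using assms prime_gt_0_int by auto
  define A where "A = \<lfloor>sqrt (p * c)\<rfloor>"
  define B where "B = \<lfloor>sqrt c\<rfloor>"
  define C where "C = \<lfloor>sqrt p\<rfloor>"
  have nn: "A \<ge> 0" "B \<ge> 0" "C \<ge> 0" using p0 by (auto simp: A_def B_def C_def)
  have gt: "sqrt (p * c) < A + 1" "sqrt c < B + 1" "sqrt p < C + 1"
    unfolding A_def B_def C_def by linarith+
  have sq_le: "u\<^sup>2 \<le> n" if "\<bar>u\<bar> \<le> \<lfloor>sqrt n\<rfloor>" "n \<ge> 0" for u n :: int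
  proof -
    have "real_of_int \<bar>u\<bar> \<le> sqrt n" using that(1) by linarith
    then have "(real_of_int \<bar>u\<bar>)\<^sup>2 \<le> (sqrt n)\<^sup>2" by (rule power_mono) simp
    then have "real_of_int (u\<^sup>2) \<le> real_of_int n" using that(2) by simp
    then show ?thesis by linarith
  qed
  have "real_of_int (p * c) = sqrt (p * c) * (sqrt c * sqrt p)"
    using p0 by (simp add: real_sqrt_mult[symmetric] mult.commute)
  also have "\<dots> < real_of_int (A + 1) * (real_of_int (B + 1) * real_of_int (C + 1))"
    using gt p0 nn by (intro mult_strict_mono) (auto intro!: mult_pos_pos)
  finally have big: "p * c < (A + 1) * ((B + 1) * (C + 1))"
    by (metis of_int_less_iff of_int_mult)
  define S where "S = {0..A} \<times> {0..B} \<times> {0..C}"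
  \<comment> \<open>Where x = s y modulo c and x = t z modulo p, the squares s^2 = p and t^2 = c
    make the form vanish modulo both primes.\<close>
  define f where "f = (\<lambda>(x, y, z). ((x - s * y) mod c, (x - t * z) mod p))"
  have "card S = nat ((A + 1) * ((B + 1) * (C + 1)))"
    using nn by (simp add: S_def card_cartesian_product nat_mult_distrib)
  moreover have "card (f ` S) \<le> card ({0..<c} \<times> {0..<p})"
    using p0 by (intro card_mono) (auto simp: f_def)
  moreover have "card ({0..<c} \<times> {0..<p}) = nat (p * c)"
    using p0 by (simp add: card_cartesian_product nat_mult_distrib)
  moreover have "nat (p * c) < nat ((A + 1) * ((B + 1) * (C + 1)))"
    using big p0 by (subst nat_less_eq_zless) simp_all
  ultimately have "card (f ` S) < card S" by linarith
  then have "\<not> inj_on f S" by (rule pigeonhole)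
  then obtain x1 y1 z1 x2 y2 z2 where S: "(x1, y1, z1) \<in> S" "(x2, y2, z2) \<in> S"
    and neq: "(x1, y1, z1) \<noteq> (x2, y2, z2)" and eq: "f (x1, y1, z1) = f (x2, y2, z2)"
    unfolding inj_on_def by (metis prod_cases3)
  define x y z where "x = x1 - x2" and "y = y1 - y2" and "z = z1 - z2"
  have "\<bar>x\<bar> \<le> A" "\<bar>y\<bar> \<le> B" "\<bar>z\<bar> \<le> C" using S by (auto simp: S_def x_def y_def z_def)
  then have le: "x\<^sup>2 \<le> p * c" "y\<^sup>2 \<le> c" "z\<^sup>2 \<le> p"
    using p0 unfolding A_def B_def C_def by (auto intro!: sq_le)
  \<comment> \<open>None of p c, c, p is a square, so the bounds are strict; this is what later
    leaves only two possible values of the form.\<close>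
  have not_square: "u\<^sup>2 \<noteq> r" if "prime r" for u r :: int
  proof
    assume "u\<^sup>2 = r"
    then have "r dvd u" using that by (metis dvd_refl prime_dvd_power)
    then have "r\<^sup>2 dvd r" using \<open>u\<^sup>2 = r\<close> by (metis dvd_power_same)
    then show False using that by (auto simp: power2_eq_square)
  qed
  have "x\<^sup>2 \<noteq> p * c"
  proof
    assume "x\<^sup>2 = p * c"
    then have "p dvd x" using assms(1) by (metis dvd_triv_left prime_dvd_power)
    then have "p\<^sup>2 dvd p * c" using \<open>x\<^sup>2 = p * c\<close> by (metis dvd_power_same)
    then have "p dvd c" using p0 by (simp add: power2_eq_square)
    then show False using assms primes_dvd_imp_eq by blast
  qed
  moreover have "y\<^sup>2 \<noteq> c" "z\<^sup>2 \<noteq> p" using not_square assms by auto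
  moreover have "p * c dvd x\<^sup>2 - p * y\<^sup>2 - c * z\<^sup>2"
  proof (rule divides_mult)
    have "[x = t * z] (mod p)" "[x = s * y] (mod c)"
      using eq by (auto simp: f_def x_def y_def z_def mod_eq_dvd_iff cong_iff_dvd_diff algebra_simps)
    then have "[x\<^sup>2 = (t * z)\<^sup>2] (mod p)" "[x\<^sup>2 = (s * y)\<^sup>2] (mod c)" by (auto intro: cong_pow)
    moreover have "[(t * z)\<^sup>2 = c * z\<^sup>2] (mod p)" "[(s * y)\<^sup>2 = p * y\<^sup>2] (mod c)"
      unfolding power_mult_distrib using s t by (auto intro: cong_mult)
    ultimately have "[x\<^sup>2 = c * z\<^sup>2] (mod p)" "[x\<^sup>2 = p * y\<^sup>2] (mod c)"
      using cong_trans by blast+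
    then have "p dvd (x\<^sup>2 - c * z\<^sup>2) - p * y\<^sup>2" "c dvd (x\<^sup>2 - p * y\<^sup>2) - c * z\<^sup>2"
      unfolding cong_iff_dvd_diff by (auto intro: dvd_diff)
    then show "p dvd x\<^sup>2 - p * y\<^sup>2 - c * z\<^sup>2" "c dvd x\<^sup>2 - p * y\<^sup>2 - c * z\<^sup>2"
      by (simp_all add: algebra_simps)
    show "coprime p c" using assms primes_coprime by blast
  qed
  moreover have "(x, y, z) \<noteq> (0, 0, 0)" using neq by (auto simp: x_def y_def z_def)
  ultimately show ?thesis using le by (metis order_le_less)
qed

text \<open>The small triple gives the form a value p c k with -2 < k < 1. For k = 0 it is a
  solution; for k = -1 a composition identity produces one. Dividing by the gcd makes it
  primitive.\<close>

lemma conic_solution: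
  fixes p c :: int
  assumes "prime p" "prime c" "p \<noteq> c" "QuadRes p c" "QuadRes c p"
  obtains x y z where "x > 0" "x\<^sup>2 = p * y\<^sup>2 + c * z\<^sup>2"
    "\<And>d. d dvd x \<Longrightarrow> d dvd y \<Longrightarrow> d dvd z \<Longrightarrow> is_unit d"
proof -
  have p0: "p > 0" "c > 0" using assms prime_gt_0_int by auto
  obtain x y z where nz: "(x, y, z) \<noteq> (0, 0, 0)"
    and lt: "x\<^sup>2 < p * c" "y\<^sup>2 < c" "z\<^sup>2 < p" and dv: "p * c dvd x\<^sup>2 - p * y\<^sup>2 - c * z\<^sup>2"
    using conic_small_value[OF assms] by blast
  from dv obtain k where k: "x\<^sup>2 - p * y\<^sup>2 - c * z\<^sup>2 = p * c * k" by (elim dvdE)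
  have pos: "p * c > 0" using p0 by simp
  have "p * y\<^sup>2 < p * c" "c * z\<^sup>2 < p * c" using lt p0 by simp_all
  moreover have "p * y\<^sup>2 \<ge> 0" "c * z\<^sup>2 \<ge> 0" "x\<^sup>2 \<ge> 0" using p0 by simp_all
  ultimately have "p * c * k < p * c * 1" "p * c * (- 2) < p * c * k" using k lt by linarith+
  then have "k < 1" "- 2 < k" using pos by (simp_all only: mult_less_cancel_left_pos)
  then have "k = 0 \<or> k = - 1" by linarith
  then have "\<exists>x y z. x \<noteq> 0 \<and> x\<^sup>2 = p * y\<^sup>2 + c * z\<^sup>2"
  proof
    assume "k = 0"
    then have e: "x\<^sup>2 = p * y\<^sup>2 + c * z\<^sup>2" using k by simp
    have "x \<noteq> 0"
    proof
      assume "x = 0"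
      then have "p * y\<^sup>2 + c * z\<^sup>2 = 0" using e by simp
      then have "p * y\<^sup>2 = 0" "c * z\<^sup>2 = 0"
        using \<open>p * y\<^sup>2 \<ge> 0\<close> \<open>c * z\<^sup>2 \<ge> 0\<close> by linarith+
      then show False using p0 nz \<open>x = 0\<close> by simp
    qed
    then show ?thesis using e by blast
  next
    assume "k = - 1"
    then have e: "p * y\<^sup>2 + c * z\<^sup>2 = x\<^sup>2 + p * c" using k by simp
    \<comment> \<open>Multiplicativity of the form: x^2 + p c is a norm, and it equals p y^2 + c z^2
      here, so the product on the right is a perfect square represented by the form.\<close>
    have "p * (y * x + c * z)\<^sup>2 + c * (z * x - p * y)\<^sup>2 = (x\<^sup>2 + p * c) * (p * y\<^sup>2 + c * z\<^sup>2)"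
      by (simp add: power2_eq_square algebra_simps)
    then have "(x\<^sup>2 + p * c)\<^sup>2 = p * (y * x + c * z)\<^sup>2 + c * (z * x - p * y)\<^sup>2"
      unfolding e power2_eq_square[of "x\<^sup>2 + p * c"] by simp
    moreover have "x\<^sup>2 + p * c \<noteq> 0" using pos \<open>x\<^sup>2 \<ge> 0\<close> by linarith
    ultimately show ?thesis by blast
  qed
  then obtain x y z where x: "x \<noteq> 0" and e: "x\<^sup>2 = p * y\<^sup>2 + c * z\<^sup>2" by blast
  define g where "g = gcd x (gcd y z)"
  have g: "g \<noteq> 0" using x by (simp add: g_def)
  obtain x' where x': "x = g * x'" unfolding g_def by (meson dvdE gcd_dvd1)
  obtain y' where y': "y = g * y'" unfolding g_def by (meson dvdE dvd_trans gcd_dvd1 gcd_dvd2)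
  obtain z' where z': "z = g * z'" unfolding g_def by (meson dvdE dvd_trans gcd_dvd1 gcd_dvd2)
  have "g\<^sup>2 * x'\<^sup>2 = g\<^sup>2 * (p * y'\<^sup>2 + c * z'\<^sup>2)"
    using e unfolding x' y' z' by (simp add: power_mult_distrib algebra_simps)
  then have e': "x'\<^sup>2 = p * y'\<^sup>2 + c * z'\<^sup>2" using g by simp
  show ?thesis
  proof (rule that[of "\<bar>x'\<bar>" y' z'])
    show "\<bar>x'\<bar> > 0" using x x' by auto
    show "\<bar>x'\<bar>\<^sup>2 = p * y'\<^sup>2 + c * z'\<^sup>2" using e' by simp
    fix d assume "d dvd \<bar>x'\<bar>" "d dvd y'" "d dvd z'"
    then have "g * d dvd x" "g * d dvd y" "g * d dvd z" by (simp_all add: x' y' z')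
    then have "g * d dvd g" unfolding g_def by simp
    then show "is_unit d" using g by simp
  qed
qed

section \<open>Rational points\<close>

text \<open>M and e have weight 1 and N has weight 2, so scaling by h clears denominators and the
  common factor of M and e. N is then rational with an integral square, hence integral.\<close>

lemma has_rat_pt_coprime:
  assumes "has_rat_pt a b"
  obtains M e N :: int where "coprime M e" "N\<^sup>2 = a * M ^ 4 + b * e ^ 4"
proof -
  obtain M e N :: rat where nz: "(M, e) \<noteq> (0, 0)"
    and eq: "N\<^sup>2 = of_int a * M ^ 4 + of_int b * e ^ 4"
    using assms by (auto simp: has_rat_pt_def)
  obtain m1 m2 where m: "M = of_int m1 / of_int m2" "m2 \<noteq> 0"
    by (metis quotient_of_div quotient_of_denom_pos' less_numeral_extra(3) prod.collapse)
  obtain e1 e2 where e: "e = of_int e1 / of_int e2" "e2 \<noteq> 0"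
    by (metis quotient_of_div quotient_of_denom_pos' less_numeral_extra(3) prod.collapse)
  define u v g where "u = m1 * e2" and "v = e1 * m2" and "g = gcd u v"
  have uv: "(u, v) \<noteq> (0, 0)" using nz m e by (auto simp: u_def v_def)
  then have g: "g \<noteq> 0" by (simp add: g_def)
  obtain m' where m': "u = g * m'" unfolding g_def by (meson dvdE gcd_dvd1)
  obtain e' where e': "v = g * e'" unfolding g_def by (meson dvdE gcd_dvd2)
  have cop: "coprime m' e'"
    using uv m' e' g unfolding g_def
    by (metis gcd_coprime_exists mult.commute gcd_mult_distrib_int coprime_iff_gcd_eq_1
        gcd_mult_left mult_cancel_left mult.right_neutral normalize_gcd)
  have "M * of_int (m2 * e2) = of_int (g * m')" "e * of_int (m2 * e2) = of_int (g * e')"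
    using m e unfolding m'[symmetric] e'[symmetric] by (simp_all add: u_def v_def)
  then have M: "M = of_int m' * (of_int g / of_int (m2 * e2))"
    and E: "e = of_int e' * (of_int g / of_int (m2 * e2))"
    using m(2) e(2) by (simp_all add: field_simps)
  define h :: rat where "h = of_int g / of_int (m2 * e2)"
  have h: "h \<noteq> 0" using g m(2) e(2) by (simp add: h_def)
  have "(N / h\<^sup>2)\<^sup>2 = of_int (a * m' ^ 4 + b * e' ^ 4)"
    using eq h unfolding M E h_def[symmetric] by (simp add: field_simps power_mult_distrib)
  moreover obtain n1 n2 where n: "N / h\<^sup>2 = of_int n1 / of_int n2" "n2 > 0" "coprime n1 n2"
    by (metis quotient_of_div quotient_of_denom_pos' quotient_of_coprime prod.collapse)
  ultimately have "of_int (n1\<^sup>2) = (of_int ((a * m' ^ 4 + b * e' ^ 4) * n2\<^sup>2) :: rat)"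
    by (simp add: field_simps)
  then have n': "n1\<^sup>2 = (a * m' ^ 4 + b * e' ^ 4) * n2\<^sup>2" using of_int_eq_iff by blast
  then have "n2\<^sup>2 dvd n1\<^sup>2" by simp
  then have "n2 dvd n1" by simp
  then have "n2 = 1" using n(2,3) by (metis coprime_absorb_right coprime_commute zdvd1_eq abs_of_pos)
  then show ?thesis using that[OF cop] n' by simp
qed

lemma has_rat_ptI:
  fixes M e N :: int
  assumes "(M, e) \<noteq> (0, 0)" "N\<^sup>2 = a * M ^ 4 + b * e ^ 4"
  shows "has_rat_pt a b"
  unfolding has_rat_pt_def
proof (intro exI conjI)
  show "(of_int M :: rat, of_int e :: rat) \<noteq> (0, 0)" using assms(1) by auto
  show "(of_int N)\<^sup>2 = of_int a * of_int M ^ 4 + of_int b * (of_int e :: rat) ^ 4"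
    using assms(2) by (metis of_int_add of_int_mult of_int_power)
qed

text \<open>The map (M, e, N) -> (h e, M, h N). On the elliptic curve it is translation by (0, 0),
  which multiplies the class a by the class of a b.\<close>

lemma has_rat_pt_swap:
  assumes "has_rat_pt a (b * h\<^sup>2)" "h \<noteq> 0"
  shows "has_rat_pt b (a * h\<^sup>2)"
proof -
  obtain M e N where *: "coprime M e" "N\<^sup>2 = a * M ^ 4 + b * h\<^sup>2 * e ^ 4"
    using has_rat_pt_coprime[OF assms(1)] by blast
  show ?thesis
  proof (rule has_rat_ptI)
    show "(h * e, M) \<noteq> (0, 0)" using * assms(2) by auto
    have "(h * N)\<^sup>2 = h\<^sup>2 * (a * M ^ 4 + b * h\<^sup>2 * e ^ 4)" by (simp only: *(2) power_mult_distrib)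
    then show "(h * N)\<^sup>2 = b * (h * e) ^ 4 + a * h\<^sup>2 * M ^ 4" by (simp add: power_mult_distrib algebra_simps numeral_eq_Suc)
  qed
qed

text \<open>The third intersection point of the curve $Y^2 = X^3 + C X$ with the line $Y = m X + c$
  through two of its points.\<close>

lemma third_point_on_line:
  fixes C X1 Y1 X2 Y2 :: "'a :: field"
  assumes "X1 \<noteq> X2" "Y1\<^sup>2 = X1 ^ 3 + C * X1" "Y2\<^sup>2 = X2 ^ 3 + C * X2"
  defines "m \<equiv> (Y2 - Y1) / (X2 - X1)"
  defines "c \<equiv> Y1 - m * X1"
  defines "X3 \<equiv> m\<^sup>2 - X1 - X2"
  shows "X1 * X2 * X3 = c\<^sup>2" "(m * X3 + c)\<^sup>2 = X3 ^ 3 + C * X3"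
proof -
  have m: "m * (X2 - X1) = Y2 - Y1" using assms(1) by (simp add: m_def)
  have y1: "Y1 = m * X1 + c" by (simp add: c_def)
  have y2: "Y2 = m * X2 + c" using m by (simp add: c_def algebra_simps)
  have f1: "(m * X1 + c)\<^sup>2 = X1 ^ 3 + C * X1" and f2: "(m * X2 + c)\<^sup>2 = X2 ^ 3 + C * X2"
    using assms(2,3) y1 y2 by simp_all
  have "(X1 - X2) * (X1\<^sup>2 + X1 * X2 + X2\<^sup>2 + C - m\<^sup>2 * (X1 + X2) - 2 * m * c)
      = (X1 ^ 3 + C * X1 - (m * X1 + c)\<^sup>2) - (X2 ^ 3 + C * X2 - (m * X2 + c)\<^sup>2)"
    by (simp add: algebra_simps power2_eq_square power3_eq_cube)
  also have "\<dots> = 0" using f1 f2 by simp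
  finally have "(X1 - X2) * (X1\<^sup>2 + X1 * X2 + X2\<^sup>2 + C - m\<^sup>2 * (X1 + X2) - 2 * m * c) = 0" .
  \<comment> \<open>The divided difference of the cubic X^3 + C X - (m X + c)^2 at its roots X1 and
    X2. As \<open>X3\<close> makes the three roots sum to m^2, this is Vieta's relation for the
    coefficient of X.\<close>
  then have q: "X1\<^sup>2 + X1 * X2 + X2\<^sup>2 + C - m\<^sup>2 * (X1 + X2) - 2 * m * c = 0"
    using assms(1) by simp
  show x: "X1 * X2 * X3 = c\<^sup>2"
  proof -
    have "X1 * X2 * X3 - c\<^sup>2 = (X1 ^ 3 + C * X1 - (m * X1 + c)\<^sup>2)
        - X1 * (X1\<^sup>2 + X1 * X2 + X2\<^sup>2 + C - m\<^sup>2 * (X1 + X2) - 2 * m * c)"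
      unfolding X3_def by (simp add: algebra_simps power2_eq_square power3_eq_cube)
    also have "\<dots> = 0" using f1 q by simp
    finally show ?thesis by simp
  qed
  show "(m * X3 + c)\<^sup>2 = X3 ^ 3 + C * X3"
  proof -
    have "X3 ^ 3 + C * X3 - (m * X3 + c)\<^sup>2 = (X1 * X2 * X3 - c\<^sup>2)
        + X3 * (X1\<^sup>2 + X1 * X2 + X2\<^sup>2 + C - m\<^sup>2 * (X1 + X2) - 2 * m * c)"
      unfolding X3_def by (simp add: algebra_simps power2_eq_square power3_eq_cube)
    also have "\<dots> = 0" using x q by simp
    finally show ?thesis by simp
  qed
qed

section \<open>Quartic symbols and values of binary forms\<close>

lemma quartic_sym_eq_1_iff: "quartic_sym c p = 1 \<longleftrightarrow> [c ^ nat ((p - 1) div 4) = 1] (mod p)"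
  by (simp add: quartic_sym_def)

text \<open>Raising x^2 = c z^2 to the power (p - 1) / 4 raises x and z to the power (p - 1) / 2,
  where Euler's criterion applies.\<close>

lemma quartic_power_Legendre:
  fixes p :: int
  assumes "prime p" "p mod 4 = 1" "[x\<^sup>2 = c * z\<^sup>2] (mod p)"
  shows "[c ^ nat ((p - 1) div 4) * Legendre z p = Legendre x p] (mod p)"
proof -
  have p2: "2 < p" using assms prime_ge_2_int[of p] by (cases "p = 2") auto
  define k where "k = nat ((p - 1) div 4)"
  have "p = 4 * ((p - 1) div 4) + 1" using assms(2) by presburger
  then have half: "nat ((p - 1) div 2) = 2 * k" using p2 by (simp add: k_def)
  have "[c ^ k * Legendre z p = c ^ k * z ^ (2 * k)] (mod p)"
    using Legendre_cong_power[OF assms(1) p2, of z] half by (intro cong_mult cong_refl) simp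
  also have "c ^ k * z ^ (2 * k) = (c * z\<^sup>2) ^ k" by (simp add: power_mult_distrib power_mult)
  also have "[(c * z\<^sup>2) ^ k = (x\<^sup>2) ^ k] (mod p)" using assms(3) by (intro cong_pow) (simp add: cong_sym)
  also have "(x\<^sup>2) ^ k = x ^ (2 * k)" by (simp add: power_mult)
  also have "[x ^ (2 * k) = Legendre x p] (mod p)"
    using Legendre_cong_power[OF assms(1) p2, of x] half by (simp add: cong_sym)
  finally show ?thesis by (simp add: k_def)
qed

text \<open>A common factor r of u and v contributes r^2 to the value, so by descent only primitive
  pairs matter.\<close>

lemma even_multiplicity_form:
  fixes r c :: int
  assumes r: "prime r"
    and prim: "\<And>u v. \<not> (r dvd u \<and> r dvd v) \<Longrightarrow> even (multiplicity r (c * u\<^sup>2 + v\<^sup>2))"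
  shows "even (multiplicity r (c * u\<^sup>2 + v\<^sup>2))"
proof (induction "nat (\<bar>u\<bar> + \<bar>v\<bar>)" arbitrary: u v rule: less_induct)
  case less
  show ?case
  proof (cases "r dvd u \<and> r dvd v")
    case True
    then obtain u' v' where uv: "u = r * u'" "v = r * v'" by (auto elim!: dvdE)
    show ?thesis
    proof (cases "c * u'\<^sup>2 + v'\<^sup>2 = 0")
      \<comment> \<open>The value is then 0, and \<open>multiplicity r 0\<close> is 0 by
        convention.\<close>
      case True
      have "c * u\<^sup>2 + v\<^sup>2 = r\<^sup>2 * (c * u'\<^sup>2 + v'\<^sup>2)"
        by (simp add: uv power_mult_distrib algebra_simps)
      then show ?thesis using True by simp
    next
      case False
      have r2: "r \<ge> 2" using r prime_ge_2_int by blast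
      have "\<bar>w\<bar> < \<bar>r * w\<bar>" if "w \<noteq> 0" for w
        using r2 that by (simp add: abs_mult)
      then have "w = 0 \<or> \<bar>w\<bar> < \<bar>r * w\<bar>" for w by blast
      from this[of u'] this[of v'] have "\<bar>u'\<bar> + \<bar>v'\<bar> < \<bar>u\<bar> + \<bar>v\<bar>"
        unfolding uv using False by auto
      then have IH: "even (multiplicity r (c * u'\<^sup>2 + v'\<^sup>2))"
        by (intro less.hyps) linarith
      have "c * u\<^sup>2 + v\<^sup>2 = r\<^sup>2 * (c * u'\<^sup>2 + v'\<^sup>2)"
        by (simp add: uv power_mult_distrib algebra_simps)
      also have "multiplicity r \<dots> = 2 + multiplicity r (c * u'\<^sup>2 + v'\<^sup>2)"
        using r r2 False
          prime_elem_multiplicity_mult_distrib[OF prime_imp_prime_elem, of r "r\<^sup>2" "c * u'\<^sup>2 + v'\<^sup>2"]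
        by (simp add: prime_elem_multiplicity_power_distrib)
      finally show ?thesis using IH by simp
    qed
  qed (rule prim)
qed

text \<open>At a primitive pair r does not divide the value at all, since otherwise -c would be the
  square of v / u modulo r.\<close>

lemma even_multiplicity_inert:
  fixes r c :: int
  assumes r: "prime r" and nq: "\<not> QuadRes r (- c)"
  shows "even (multiplicity r (c * u\<^sup>2 + v\<^sup>2))"
proof (rule even_multiplicity_form[OF r])
  fix u v :: int
  assume uv: "\<not> (r dvd u \<and> r dvd v)"
  have "\<not> r dvd c * u\<^sup>2 + v\<^sup>2"
  proof
    assume d: "r dvd c * u\<^sup>2 + v\<^sup>2"
    have "- c * u\<^sup>2 - v\<^sup>2 = - (c * u\<^sup>2 + v\<^sup>2)" by simp
    then have "r dvd - c * u\<^sup>2 - v\<^sup>2" using d by (simp only: dvd_minus_iff)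
    then have "r dvd u" using QuadRes_divide[OF r, of u "- c" v] nq by (auto simp: cong_iff_dvd_diff)
    then have "r dvd c * u\<^sup>2" by (simp add: power2_eq_square)
    then have "r dvd v\<^sup>2" using d by (simp add: dvd_add_right_iff)
    then show False using uv \<open>r dvd u\<close> r prime_dvd_power by blast
  qed
  then show "even (multiplicity r (c * u\<^sup>2 + v\<^sup>2))" by (simp add: not_dvd_imp_multiplicity_0)
qed

lemma odd_square_mod_8: "odd w \<Longrightarrow> w\<^sup>2 mod 8 = 1" for w :: int
proof -
  assume "odd w"
  then have "w mod 8 = 1 \<or> w mod 8 = 3 \<or> w mod 8 = 5 \<or> w mod 8 = 7" using mod_8_odd_cases by blast
  moreover have "w\<^sup>2 mod 8 = (w mod 8)\<^sup>2 mod 8" by (simp add: power_mod)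
  ultimately show ?thesis by auto
qed

lemma odd_fourth_power_mod_16: "odd w \<Longrightarrow> w ^ 4 mod 16 = 1" for w :: int
proof -
  assume "odd w"
  then have "w\<^sup>2 mod 8 = 1" by (rule odd_square_mod_8)
  then have "w\<^sup>2 mod 16 = 1 \<or> w\<^sup>2 mod 16 = 9" by (rule mod_8_eq_1_imp_mod_16)
  moreover have "w ^ 4 mod 16 = (w\<^sup>2 mod 16)\<^sup>2 mod 16" by (simp add: power_mod flip: power_mult)
  ultimately show ?thesis by auto
qed

text \<open>The analogue at 2, which is inert for -q = 5 modulo 8: a primitive value is odd, or is 3
  + 1 = 4 modulo 8.\<close>

lemma even_multiplicity_two:
  fixes q :: int
  assumes q: "q mod 8 = 3"
  shows "even (multiplicity 2 (q * u\<^sup>2 + v\<^sup>2))"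
proof (rule even_multiplicity_form)
  fix u v :: int
  assume "\<not> (2 dvd u \<and> 2 dvd v)"
  moreover have "odd q" using q by presburger
  ultimately consider "odd (q * u\<^sup>2 + v\<^sup>2)" | "odd u" "odd v" by auto
  then show "even (multiplicity 2 (q * u\<^sup>2 + v\<^sup>2))"
  proof cases
    case 1
    then show ?thesis by (simp add: not_dvd_imp_multiplicity_0)
  next
    case 2
    have "[q * u\<^sup>2 + v\<^sup>2 = 3 * 1 + 1] (mod 8)"
      using q odd_square_mod_8 2 by (intro cong_add cong_mult) (simp_all add: cong_def)
    then have m: "(q * u\<^sup>2 + v\<^sup>2) mod 8 = 4" by (simp add: cong_def)
    have "multiplicity 2 (q * u\<^sup>2 + v\<^sup>2) = 2"
    proof (rule multiplicity_eqI)
      show "2\<^sup>2 dvd q * u\<^sup>2 + v\<^sup>2" using m by simp presburger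
      show "\<not> 2 ^ Suc 2 dvd q * u\<^sup>2 + v\<^sup>2" using m by simp presburger
    qed
    then show ?thesis by simp
  qed
qed simp

section \<open>The curve $N^2 = p M^4 - 4 q^2 e^4$\<close>

locale prime_pair =
  fixes p q :: int
  assumes p: "prime p" and q: "prime q" and p8: "p mod 8 = 1" and q4: "q mod 4 = 3"
    and pq: "Legendre p q = 1"
begin

lemma p4: "p mod 4 = 1" using p8 mod_4_eq_mod_8[of p] by simp

lemma p_gt_2: "p > 2" using p p8 prime_ge_2_int[of p] by (cases "p = 2") auto

lemma q_gt_2: "q > 2" using q q4 prime_ge_2_int[of q] by (cases "q = 2") auto

lemma odd_pq: "odd p" "odd q" using p8 q4 by presburger+

lemma p_ne_q: "p \<noteq> q" using p4 q4 by auto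

lemma not_dvd_pq: "\<not> p dvd q" "\<not> q dvd p" "\<not> p dvd 2" "\<not> q dvd 2"
  using p q p_ne_q p_gt_2 q_gt_2 primes_dvd_imp_eq by (auto dest: zdvd_imp_le)

lemma Legendre_q_p: "Legendre q p = 1"
  using Legendre_swap[OF p p4 q q_gt_2] pq by simp

lemma Legendre_2_p: "Legendre 2 p = 1"
  using Legendre_two[OF p p_gt_2] p8 by simp

lemma Legendre_m1_p: "Legendre (- 1) p = 1"
  using Legendre_minus_one[OF p p_gt_2] p4 by simp

lemma Legendre_minus_p: "Legendre (- a) p = Legendre a p"
  using Legendre_mult[OF p p_gt_2, of "- 1" a] Legendre_m1_p by simp

lemma QuadRes_p: "QuadRes p 2" "QuadRes p q" "QuadRes q p"
  using Legendre_2_p Legendre_q_p pq Legendre_eq_1_iff by auto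

text \<open>As p is 1 modulo 8, reciprocity makes r a residue modulo p whenever p is one modulo r.
  The units, 2 and q are residues modulo p already, which is why they are exempt from the
  assumption.\<close>

lemma Legendre_p_nonzero_eq_1:
  assumes "\<not> p dvd n" "\<And>r. prime r \<Longrightarrow> odd r \<Longrightarrow> r \<noteq> q \<Longrightarrow> r dvd n \<Longrightarrow> QuadRes r p"
  shows "Legendre n p = 1"
proof -
  have n0: "n \<noteq> 0" using assms(1) by auto
  have "Legendre \<bar>n\<bar> p \<ge> 0"
  proof (rule multiplicative_nonneg[where f = "\<lambda>m. Legendre m p"])
    show "Legendre (a * b) p = Legendre a p * Legendre b p" for a b
      by (rule Legendre_mult[OF p p_gt_2])
    show "Legendre 1 p = 1" using Legendre_square[of p 1] p p_gt_2 by simp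
    show "\<bar>n\<bar> > 0" using n0 by simp
    fix r :: int
    assume r: "prime r" "odd (multiplicity r \<bar>n\<bar>)"
    then have rn: "r dvd n" by (metis dvd_abs_iff even_zero not_dvd_imp_multiplicity_0)
    consider "r = 2" | "r = q" | "odd r" "r \<noteq> q" using r(1) by (metis prime_odd_int prime_ge_2_int order_le_less)
    then show "Legendre r p \<ge> 0"
    proof cases
      case 3
      then have "r > 2" using r(1) prime_ge_2_int[of r] by (cases "r = 2") auto
      then have "Legendre r p = Legendre p r" using Legendre_swap[OF p p4 r(1)] by simp
      moreover have "QuadRes r p" using assms(2) r rn 3 by blast
      ultimately show ?thesis by (simp add: Legendre_def)
    qed (simp_all add: Legendre_2_p Legendre_q_p)
  qed
  moreover have "Legendre \<bar>n\<bar> p = Legendre n p" using Legendre_minus_p by (simp add: abs_if)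
  ultimately show ?thesis using Legendre_cases[of n p] assms(1) by (auto simp: Legendre_eq_0_iff)
qed

end

locale torsor_point = prime_pair +
  fixes M e N :: int
  assumes Me: "coprime M e" and eq: "N\<^sup>2 = p * M ^ 4 - 4 * q\<^sup>2 * e ^ 4"
begin

text \<open>If M is even, then e is odd and N = 2 n, so n^2 + (q e^2)^2 is divisible by 4 with an
  odd second square. If e is odd, then N^2 = 1 - 4 modulo 8.\<close>

lemma parity: "odd M" "odd N" "even e"
proof -
  have sq4: "w\<^sup>2 mod 4 = (if even w then 0 else 1)" for w :: int
  proof (cases "even w")
    case True
    then obtain k where "w = 2 * k" by (elim evenE)
    then show ?thesis by (simp add: power_mult_distrib)
  next
    case False
    then show ?thesis using odd_square_mod_8[of w] mod_4_eq_mod_8[of "w\<^sup>2"] by simp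
  qed
  show M: "odd M"
  proof
    assume "even M"
    then obtain m where m: "M = 2 * m" by (elim evenE)
    have "odd e" using Me \<open>even M\<close> by (meson coprime_common_divisor odd_one)
    have "even (N\<^sup>2)" unfolding eq m by simp
    then obtain n where n: "N = 2 * n" by auto
    have "n\<^sup>2 = 4 * (p * m ^ 4) - q\<^sup>2 * e ^ 4"
      using eq unfolding m n by (simp add: power_mult_distrib)
    then have "(n\<^sup>2 + (q * e\<^sup>2)\<^sup>2) mod 4 = 0" by (simp add: power_mult_distrib flip: power_mult)
    then have "(n\<^sup>2 mod 4 + (q * e\<^sup>2)\<^sup>2 mod 4) mod 4 = 0" by (simp add: mod_simps)
    then show False using \<open>odd e\<close> odd_pq sq4[of n] sq4[of "q * e\<^sup>2"] by (auto split: if_splits)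
  qed
  have "odd (N\<^sup>2)" unfolding eq using M odd_pq by simp
  then show N: "odd N" by simp
  show "even e"
  proof (rule ccontr)
    assume "odd e"
    have "p = 8 * (p div 8) + 1" using p8 by presburger
    then obtain k where k: "p = 8 * k + 1" ..
    have "(q * e\<^sup>2)\<^sup>2 = q\<^sup>2 * e ^ 4" by (simp add: power_mult_distrib flip: power_mult)
    then have "N\<^sup>2 = 8 * (k * M ^ 4) + M ^ 4 - 4 * (q * e\<^sup>2)\<^sup>2"
      using eq k by (simp add: distrib_right)
    moreover have "(q * e\<^sup>2)\<^sup>2 mod 8 = 1"
      using \<open>odd e\<close> odd_pq by (intro odd_square_mod_8) auto
    ultimately have "[N\<^sup>2 = 8 * (k * M ^ 4) + 1 - 4 * 1] (mod 8)"
      using odd_fourth_power_mod_16[OF M] mod_8_eq_mod_16[of "M ^ 4"]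
      by (simp only:) (intro cong_diff cong_add cong_mult cong_refl, simp_all add: cong_def)
    then have "N\<^sup>2 mod 8 = (8 * (k * M ^ 4) + - 3) mod 8" by (simp add: cong_def)
    also have "\<dots> = - 3 mod 8" by (rule mod_mult_self4)
    finally show False using odd_square_mod_8[OF N] by simp
  qed
qed

text \<open>If q divides M, it divides N, and division by q^2 gives n^2 = -(2 e^2)^2 modulo q, so -1
  would be a square modulo a prime that is 3 modulo 4.\<close>

lemma q_not_dvd_M: "\<not> q dvd M"
proof
  assume "q dvd M"
  then obtain m where m: "M = q * m" by (elim dvdE)
  have "\<not> q dvd e" using Me \<open>q dvd M\<close> q by (meson coprime_common_divisor not_prime_unit)
  have "N\<^sup>2 = q * (q ^ 3 * p * m ^ 4 - 4 * q * e ^ 4)"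
    unfolding eq m by (simp add: power2_eq_square power3_eq_cube power4_eq_xxxx algebra_simps)
  then have "q dvd N" using q by (metis dvd_triv_left prime_dvd_power)
  then obtain n where n: "N = q * n" by (elim dvdE)
  have "q\<^sup>2 * n\<^sup>2 = q\<^sup>2 * (q\<^sup>2 * (p * m ^ 4) - 4 * e ^ 4)"
    using eq unfolding m n by (simp add: power_mult_distrib algebra_simps power4_eq_xxxx power2_eq_square)
  then have "n\<^sup>2 = q\<^sup>2 * (p * m ^ 4) - 4 * e ^ 4" using q_gt_2 by simp
  moreover have "(2 * e\<^sup>2)\<^sup>2 = 4 * e ^ 4" by (simp add: power_mult_distrib flip: power_mult)
  ultimately have "- 1 * (2 * e\<^sup>2)\<^sup>2 - n\<^sup>2 = q * (- q * (p * m ^ 4))"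
    by (simp add: power2_eq_square)
  then have "[- 1 * (2 * e\<^sup>2)\<^sup>2 = n\<^sup>2] (mod q)" unfolding cong_iff_dvd_diff by simp
  moreover have "\<not> q dvd 2 * e\<^sup>2"
    using \<open>\<not> q dvd e\<close> not_dvd_pq q by (simp add: prime_dvd_mult_iff prime_dvd_power_iff)
  ultimately have "QuadRes q (- 1)" using QuadRes_divide[OF q] by blast
  then have "Legendre (- 1) q = 1 \<or> q dvd - 1" using Legendre_eq_1_iff by blast
  then show False using Legendre_minus_one[OF q q_gt_2] q4 q_gt_2 by (auto dest: zdvd_imp_le)
qed

end

section \<open>A point on the curve combined with a primitive solution of the conic\<close>

locale torsor_conic = torsor_point +
  fixes c x y z :: int
  assumes c: "c = 2 \<or> c = q" and x0: "x > 0" and xyz: "x\<^sup>2 = p * y\<^sup>2 + c * z\<^sup>2"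
    and prim: "\<And>d. d dvd x \<Longrightarrow> d dvd y \<Longrightarrow> d dvd z \<Longrightarrow> is_unit d"
begin

lemma c_prime: "prime c" using c q by auto

lemma c_nonneg: "c > 0" using c_prime prime_gt_0_int by blast

lemma not_dvd_pc: "\<not> p dvd c" "\<not> c dvd p"
  using c not_dvd_pq odd_pq by auto

text \<open>If r divides two of the variables, then r^2 divides the remaining term. Its coefficient
  is 1, p or c, none divisible by a prime square, so r divides the third variable as well.\<close>

lemma dvd_xyz:
  assumes r: "prime r"
  shows "\<not> (r dvd x \<and> r dvd y)" "\<not> (r dvd y \<and> r dvd z)" "\<not> (r dvd x \<and> r dvd z)"
proof -
  have nu: "\<not> is_unit r" using r not_prime_unit by blast
  have sq: "s dvd w" if "prime s" "s\<^sup>2 dvd k * w\<^sup>2" "prime k" "s = k \<or> \<not> s dvd k" for s k w :: int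
  proof (cases "s = k")
    case True
    then have "s * s dvd s * w\<^sup>2" using that(2) by (simp add: power2_eq_square)
    then have "s dvd w\<^sup>2" using that(1) by (metis dvd_mult_cancel_left not_prime_0)
    then show ?thesis using that(1) prime_dvd_power by blast
  next
    case False
    have "s dvd k * w\<^sup>2" using that(2) by (metis dvd_trans dvd_triv_left power2_eq_square)
    then show ?thesis using that(1,4) False by (metis prime_dvd_mult_iff prime_dvd_power)
  qed
  have rc: "r = k \<or> \<not> r dvd k" if "prime k" for k using r that primes_dvd_imp_eq by blast
  have sq_dvd: "r\<^sup>2 dvd w\<^sup>2" "r\<^sup>2 dvd k * w\<^sup>2" if "r dvd w" for k w
    using that by (simp_all add: dvd_power_same)
  show 1: "\<not> (r dvd x \<and> r dvd y)"
  proof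
    assume a: "r dvd x \<and> r dvd y"
    have "c * z\<^sup>2 = x\<^sup>2 - p * y\<^sup>2" using xyz by simp
    then have "r\<^sup>2 dvd c * z\<^sup>2" using a sq_dvd by (metis dvd_diff)
    then have "r dvd z" using sq[OF r _ c_prime rc[OF c_prime]] by blast
    then show False using prim a nu by blast
  qed
  show 2: "\<not> (r dvd x \<and> r dvd z)"
  proof
    assume a: "r dvd x \<and> r dvd z"
    have "p * y\<^sup>2 = x\<^sup>2 - c * z\<^sup>2" using xyz by simp
    then have "r\<^sup>2 dvd p * y\<^sup>2" using a sq_dvd by (metis dvd_diff)
    then have "r dvd y" using sq[OF r _ p rc[OF p]] by blast
    then show False using 1 a by blast
  qed
  show "\<not> (r dvd y \<and> r dvd z)"
  proof
    assume a: "r dvd y \<and> r dvd z"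
    then have "r\<^sup>2 dvd x\<^sup>2" unfolding xyz using sq_dvd by (metis dvd_add)
    then show False using 1 a by simp
  qed
qed

lemma p_not_dvd: "\<not> p dvd x" "\<not> p dvd z"
proof -
  show x: "\<not> p dvd x"
  proof
    assume "p dvd x"
    then have "p dvd x\<^sup>2" by (simp add: power2_eq_square)
    then have "p dvd c * z\<^sup>2" unfolding xyz by (simp add: dvd_add_right_iff)
    then have "p dvd z" using p not_dvd_pc by (metis prime_dvd_mult_iff prime_dvd_power)
    then show False using \<open>p dvd x\<close> dvd_xyz[OF p] by blast
  qed
  show "\<not> p dvd z"
  proof
    assume "p dvd z"
    then have "p dvd x\<^sup>2" unfolding xyz by (simp add: power2_eq_square)
    then show False using x p prime_dvd_power by blast
  qed
qed

lemma c_not_dvd_x: "\<not> c dvd x"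
proof
  assume "c dvd x"
  then have "c dvd x\<^sup>2" by (simp add: power2_eq_square)
  then have "c dvd p * y\<^sup>2" unfolding xyz by (simp add: dvd_add_left_iff)
  then have "c dvd y" using c_prime not_dvd_pc by (metis prime_dvd_mult_iff prime_dvd_power)
  then show False using \<open>c dvd x\<close> dvd_xyz[OF c_prime] by blast
qed

text \<open>Modulo an odd prime dividing z the conic reads x^2 = p y^2, so p is a square
  there.\<close>

lemma Legendre_z: "Legendre z p = 1"
proof (rule Legendre_p_nonzero_eq_1)
  show "\<not> p dvd z" by (rule p_not_dvd)
  fix r :: int
  assume r: "prime r" "odd r" "r \<noteq> q" "r dvd z"
  then have "\<not> r dvd y" using dvd_xyz by blast
  moreover have "p * y\<^sup>2 - x\<^sup>2 = - (c * z\<^sup>2)" unfolding xyz by simp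
  then have "[p * y\<^sup>2 = x\<^sup>2] (mod r)"
    using r(4) by (simp only: cong_iff_dvd_diff dvd_minus_iff) (simp add: power2_eq_square)
  ultimately show "QuadRes r p" using QuadRes_divide r(1) by blast
qed

lemma quartic_c: "[c ^ nat ((p - 1) div 4) = Legendre x p] (mod p)"
  using quartic_power_Legendre[OF p p4, of x c z] Legendre_z
  by (simp add: xyz cong_iff_dvd_diff)

text \<open>Modulo r the conic reads p y^2 = -c z^2, so -p c is a nonzero square.\<close>

lemma Legendre_p_c_dvd_x:
  assumes r: "prime r" "odd r" "r dvd x"
  shows "Legendre p r * Legendre (- c) r = 1"
proof -
  have r2: "r > 2" using r prime_ge_2_int[of r] by (cases "r = 2") auto
  have nz: "\<not> r dvd z" using dvd_xyz r by blast
  have "r dvd x\<^sup>2" using r by (simp add: power2_eq_square)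
  then have "r dvd - p * x\<^sup>2" by simp
  moreover have "(p * - c) * z\<^sup>2 - (p * y)\<^sup>2 = - p * x\<^sup>2"
    unfolding xyz by (simp add: algebra_simps power2_eq_square)
  ultimately have "r dvd (p * - c) * z\<^sup>2 - (p * y)\<^sup>2" by simp
  then have "QuadRes r (p * - c)" using QuadRes_divide[OF r(1) nz] by (simp add: cong_iff_dvd_diff)
  moreover have "\<not> r dvd p * - c"
  proof
    assume "r dvd p * - c"
    then have "r dvd p \<or> r dvd c" using r(1) by (simp add: prime_dvd_mult_iff)
    then have "r = p \<or> r = c" using r p c_prime primes_dvd_imp_eq by blast
    then show False using r p_not_dvd c_not_dvd_x by blast
  qed
  ultimately have "Legendre (p * - c) r = 1" by (simp add: Legendre_eq_1_iff)
  then show ?thesis using Legendre_mult[OF r(1) r2, of p "- c"] by simp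
qed

lemma norm_eq: "(x * M\<^sup>2 + N * y) * (x * M\<^sup>2 - N * y) = c * (z * M\<^sup>2)\<^sup>2 + (2 * q * e\<^sup>2 * y)\<^sup>2"
proof -
  have "(x * M\<^sup>2 + N * y) * (x * M\<^sup>2 - N * y) = x\<^sup>2 * M ^ 4 - N\<^sup>2 * y\<^sup>2"
    by (simp add: algebra_simps power2_eq_square power4_eq_xxxx)
  also have "\<dots> = c * (z * M\<^sup>2)\<^sup>2 + (2 * q * e\<^sup>2 * y)\<^sup>2"
    unfolding xyz eq by (simp add: algebra_simps power2_eq_square power4_eq_xxxx)
  finally show ?thesis .
qed

text \<open>Their product is a positive value of the norm form and their sum 2 x M^2 is positive.
  Positivity lets the symbols be evaluated from prime factors alone, without a sign.\<close>

lemma factors_pos: "x * M\<^sup>2 + N * y > 0" "x * M\<^sup>2 - N * y > 0"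
proof -
  have M0: "M \<noteq> 0" using parity by auto
  have "z \<noteq> 0" using p_not_dvd by auto
  then have "c * (z * M\<^sup>2)\<^sup>2 > 0" using M0 c_nonneg by simp
  then have pos: "(x * M\<^sup>2 + N * y) * (x * M\<^sup>2 - N * y) > 0"
    unfolding norm_eq by (smt (verit) zero_le_power2)
  moreover have "x * M\<^sup>2 > 0" using x0 M0 by simp
  ultimately show "x * M\<^sup>2 + N * y > 0" "x * M\<^sup>2 - N * y > 0"
    by (smt (verit) zero_less_mult_iff)+
qed

text \<open>As r is odd, it divides x M^2 and N y. Primitivity excludes x with y, and the curve
  excludes M with N, which leaves the pairs (x, N) and (M, y).\<close>

lemma QuadRes_common_factor:
  assumes r: "prime r" "odd r" "r \<noteq> c"
    and d: "r dvd x * M\<^sup>2 + N * y" "r dvd x * M\<^sup>2 - N * y"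
  shows "QuadRes r (- c)"
proof -
  have r2: "\<not> r dvd 2" using r(1,2) primes_dvd_imp_eq[of r 2] by auto
  have rc: "\<not> r dvd c" using r(1,3) c_prime primes_dvd_imp_eq by blast
  have "r dvd 2 * (x * M\<^sup>2)" "r dvd 2 * (N * y)"
    using dvd_add[OF d] dvd_diff[OF d] by (simp_all add: algebra_simps)
  then have xM: "r dvd x \<or> r dvd M" and Ny: "r dvd N \<or> r dvd y"
    using r(1) r2 by (metis prime_dvd_mult_iff prime_dvd_power)+
  have four: "(2 * q * e\<^sup>2)\<^sup>2 = 4 * q\<^sup>2 * e ^ 4"
    by (simp add: power_mult_distrib flip: power_mult)
  have qe: "\<not> r dvd 2 * q * e\<^sup>2" if "r dvd M"
  proof
    assume "r dvd 2 * q * e\<^sup>2"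
    then have "r dvd q \<or> r dvd e" using r(1) r2 by (metis prime_dvd_mult_iff prime_dvd_power)
    moreover have "\<not> r dvd e" using Me that r(1) by (meson coprime_common_divisor not_prime_unit)
    moreover have "\<not> r dvd q" using q_not_dvd_M that q r(1) primes_dvd_imp_eq by blast
    ultimately show False by blast
  qed
  have MN: "\<not> (r dvd M \<and> r dvd N)"
  proof
    assume a: "r dvd M \<and> r dvd N"
    have "(2 * q * e\<^sup>2)\<^sup>2 = p * M ^ 4 - N\<^sup>2" unfolding four using eq by simp
    also have "r dvd \<dots>" using a by (simp add: power2_eq_square power4_eq_xxxx)
    finally show False using qe a r(1) prime_dvd_power by blast
  qed
  consider "r dvd x" "r dvd N" | "r dvd M" "r dvd y" using xM Ny MN dvd_xyz[OF r(1)] by blast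
  then show ?thesis
  \<comment> \<open>For (x, N) the curve makes p a square and the conic reads -c z^2 = p y^2. For
    (M, y) the curve makes -1 a square and the conic makes c one.\<close>
  proof cases
    case 1
    have rM: "\<not> r dvd M\<^sup>2" using MN 1 r(1) prime_dvd_power by blast
    have "p * (M\<^sup>2)\<^sup>2 - (2 * q * e\<^sup>2)\<^sup>2 = N\<^sup>2" unfolding four eq by (simp flip: power_mult)
    then have "[p * (M\<^sup>2)\<^sup>2 = (2 * q * e\<^sup>2)\<^sup>2] (mod r)"
      using 1 by (simp add: cong_iff_dvd_diff power2_eq_square)
    then have "QuadRes r p" using QuadRes_divide[OF r(1) rM] by blast
    then obtain s where s: "[s\<^sup>2 = p] (mod r)" by (auto simp: QuadRes_def)
    have "\<not> r dvd z" using dvd_xyz[OF r(1)] 1 by blast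
    have "- c * z\<^sup>2 - p * y\<^sup>2 = - (x\<^sup>2)" unfolding xyz by simp
    then have "[- c * z\<^sup>2 = p * y\<^sup>2] (mod r)"
      using 1 by (simp only: cong_iff_dvd_diff dvd_minus_iff) (simp add: power2_eq_square)
    also have "[p * y\<^sup>2 = s\<^sup>2 * y\<^sup>2] (mod r)" using s by (intro cong_mult) (simp_all add: cong_sym)
    finally have "[- c * z\<^sup>2 = (s * y)\<^sup>2] (mod r)" by (simp add: power_mult_distrib)
    then show ?thesis using QuadRes_divide[OF r(1) \<open>\<not> r dvd z\<close>] by blast
  next
    case 2
    have "- 1 * (2 * q * e\<^sup>2)\<^sup>2 - N\<^sup>2 = - (p * M ^ 4)" unfolding four eq by simp
    then have "[- 1 * (2 * q * e\<^sup>2)\<^sup>2 = N\<^sup>2] (mod r)"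
      using 2 by (simp only: cong_iff_dvd_diff dvd_minus_iff) (simp add: power4_eq_xxxx)
    then have 1: "QuadRes r (- 1)" using QuadRes_divide[OF r(1) qe] 2 by blast
    have "\<not> r dvd z" using dvd_xyz[OF r(1)] 2 by blast
    moreover have "[c * z\<^sup>2 = x\<^sup>2] (mod r)"
      unfolding xyz using 2 by (simp add: cong_iff_dvd_diff power2_eq_square)
    ultimately have "QuadRes r c" using QuadRes_divide[OF r(1)] by blast
    then show ?thesis using QuadRes_mult[OF 1] by simp
  qed
qed

text \<open>If -c is not a square modulo r, then r divides at most one of the two factors, so that
  factor inherits the even multiplicity of the norm value.\<close>

lemma odd_multiplicity_factor:
  assumes r: "prime r" "odd r" "r \<noteq> c" "odd (multiplicity r (x * M\<^sup>2 + N * y))"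
  shows "QuadRes r (- c)"
proof (rule ccontr)
  assume nq: "\<not> QuadRes r (- c)"
  let ?n = "x * M\<^sup>2 + N * y" and ?n' = "x * M\<^sup>2 - N * y"
  have "r dvd ?n" using r(4) by (metis even_zero not_dvd_imp_multiplicity_0)
  then have "\<not> r dvd ?n'" using QuadRes_common_factor[OF r(1-3)] nq by blast
  then have "multiplicity r ?n' = 0" by (rule not_dvd_imp_multiplicity_0)
  moreover have "multiplicity r (?n * ?n') = multiplicity r ?n + multiplicity r ?n'"
    using factors_pos r(1)
    by (intro prime_elem_multiplicity_mult_distrib) auto
  moreover have "even (multiplicity r (?n * ?n'))"
    unfolding norm_eq by (rule even_multiplicity_inert[OF r(1) nq])
  ultimately show False using r(4) by simp
qed

end

lemma odd_prime_gt_2: "prime r \<Longrightarrow> odd r \<Longrightarrow> r > 2" for r :: int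
  using prime_ge_2_int[of r] by (cases "r = 2") auto

lemma prime_odd_or_two: "prime r \<Longrightarrow> odd r \<or> r = 2" for r :: int
  using primes_dvd_imp_eq[of 2 r] by auto

lemma odd_multiplicity_imp_dvd: "odd (multiplicity r n) \<Longrightarrow> r dvd n" for n r :: int
  by (metis even_zero not_dvd_imp_multiplicity_0)

section \<open>The symbol of x for c = q\<close>

context torsor_conic
begin

text \<open>For an odd prime r dividing x, reciprocity turns (r/p) (r/q) into (p/r) (-q/r) = 1. It
  is stated for divisors w so that it also applies to half of x when (2/q) = -1.\<close>

lemma Legendre_p_eq_q:
  assumes cq: "c = q" and w: "w > 0" "w dvd x" "even w \<Longrightarrow> Legendre 2 q = 1"
  shows "Legendre w p = Legendre w q"
proof -
  have "Legendre w p * Legendre w q \<ge> 0"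
  proof (rule multiplicative_nonneg[where f = "\<lambda>m. Legendre m p * Legendre m q", OF _ _ w(1)])
    show "Legendre (a * b) p * Legendre (a * b) q
        = Legendre a p * Legendre a q * (Legendre b p * Legendre b q)" for a b
      using Legendre_mult[OF p p_gt_2] Legendre_mult[OF q q_gt_2] by simp
    show "Legendre 1 p * Legendre 1 q = 1"
      using Legendre_square[of p 1] Legendre_square[of q 1] p q p_gt_2 q_gt_2 by simp
    fix r :: int
    assume r: "prime r" "odd (multiplicity r w)"
    then have rw: "r dvd w" by (intro odd_multiplicity_imp_dvd)
    show "Legendre r p * Legendre r q \<ge> 0"
    proof (cases "r = 2")
      case True
      then show ?thesis using rw w(3) Legendre_2_p by simp
    next
      case False
      then have "odd r" using r(1) prime_odd_or_two by blast
      then have r2: "r > 2" using r(1) by (rule odd_prime_gt_2[rotated])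
      have "Legendre p r * Legendre (- q) r = 1"
        using Legendre_p_c_dvd_x[OF r(1) \<open>odd r\<close>] rw w(2) cq by (metis dvd_trans)
      then show ?thesis
        using Legendre_swap[OF p p4 r(1) r2] Legendre_swap_neg[OF q q4 r(1) r2] by simp
    qed
  qed
  moreover have "\<not> p dvd w" "\<not> q dvd w" using w(2) p_not_dvd c_not_dvd_x cq dvd_trans by blast+
  ultimately show ?thesis using Legendre_cases[of w p] Legendre_cases[of w q]
    by (auto simp: Legendre_eq_0_iff)
qed

text \<open>Here w is the factor \<open>x * M^2 + N * y\<close> or its half. An odd prime r of odd
  multiplicity in it satisfies (r/q) = (-q/r) = 1; the prime 2 is the only obstruction.\<close>

lemma Legendre_q_part:
  assumes cq: "c = q" and w: "w > 0" "\<not> q dvd w"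
    and mult: "\<And>r. prime r \<Longrightarrow> odd r \<Longrightarrow> multiplicity r w = multiplicity r (x * M\<^sup>2 + N * y)"
    and two: "odd (multiplicity 2 w) \<Longrightarrow> Legendre 2 q = 1"
  shows "Legendre w q = 1"
proof -
  have "Legendre w q \<ge> 0"
  proof (rule multiplicative_nonneg[where f = "\<lambda>m. Legendre m q", OF _ _ w(1)])
    show "Legendre (a * b) q = Legendre a q * Legendre b q" for a b
      by (rule Legendre_mult[OF q q_gt_2])
    show "Legendre 1 q = 1" using Legendre_square[of q 1] q q_gt_2 by simp
    fix r :: int
    assume r: "prime r" "odd (multiplicity r w)"
    consider "r = 2" | "odd r" using r(1) prime_odd_or_two by blast
    then show "Legendre r q \<ge> 0"
    proof cases
      case 1
      then show ?thesis using two r by simp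
    next
      case 2
      then have r2: "r > 2" using r(1) by (rule odd_prime_gt_2[rotated])
      have "r \<noteq> q" using odd_multiplicity_imp_dvd[OF r(2)] w(2) by auto
      then have "QuadRes r (- q)" using odd_multiplicity_factor[OF r(1) 2] mult[OF r(1) 2] r(2) cq by simp
      then show ?thesis using Legendre_swap_neg[OF q q4 r(1) r2] by (simp add: Legendre_def)
    qed
  qed
  then show ?thesis using Legendre_cases[of w q] w(2) by (auto simp: Legendre_eq_0_iff)
qed

lemma Legendre_x_q:
  assumes cq: "c = q" and sgn: "q dvd x * M\<^sup>2 - N * y"
  shows "Legendre x p = 1"
proof -
  let ?n = "x * M\<^sup>2 + N * y"
  have qx: "\<not> q dvd x" using c_not_dvd_x cq by simp
  have nq: "\<not> q dvd 2 * x * M\<^sup>2"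
    using qx q q_not_dvd_M not_dvd_pq by (metis prime_dvd_mult_iff prime_dvd_power)
  have n_cong: "[?n = 2 * x * M\<^sup>2] (mod q)"
    using sgn by (simp add: cong_iff_dvd_diff) (metis dvd_diff_commute)
  then have qn: "\<not> q dvd ?n" using nq cong_dvd_iff by blast
  have Ln: "Legendre ?n q = Legendre 2 q * Legendre x q"
    using Legendre_cong[OF n_cong] Legendre_mult[OF q q_gt_2] Legendre_square[OF q_not_dvd_M q] by simp
  have q8: "q mod 8 = 3 \<or> q mod 8 = 7" using mod_8_odd_cases[OF odd_pq(2)] q4 by auto
  then have L2q: "Legendre 2 q = (if q mod 8 = 7 then 1 else - 1)"
    using Legendre_two[OF q q_gt_2] by auto
  have oddx_oddy: "odd y" if "odd x"
  proof
    assume "even y"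
    moreover have "odd (p * y\<^sup>2 + c * z\<^sup>2)" using that unfolding xyz[symmetric] by simp
    ultimately have "odd z" by auto
    have "p * y\<^sup>2 mod 4 = 0" using \<open>even y\<close> by (auto elim!: evenE simp: power_mult_distrib)
    moreover have "q * z\<^sup>2 mod 4 = 3"
    proof -
      have "[q * z\<^sup>2 = 3 * 1] (mod 4)"
        using q4 odd_square_mod_8[OF \<open>odd z\<close>] mod_4_eq_mod_8[of "z\<^sup>2"]
        by (intro cong_mult) (simp_all add: cong_def)
      then show ?thesis by (simp add: cong_def)
    qed
    moreover have "x\<^sup>2 mod 4 = 1" using odd_square_mod_8[OF that] mod_4_eq_mod_8[of "x\<^sup>2"] by simp
    moreover have "x\<^sup>2 mod 4 = (p * y\<^sup>2 mod 4 + q * z\<^sup>2 mod 4) mod 4"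
      unfolding xyz cq by (simp only: mod_add_eq)
    ultimately show False by simp
  qed
  \<comment> \<open>By \<open>Ln\<close> it remains to relate (n/q) to (x/q) in spite of (2/q). For
    q = 7 modulo 8 this symbol is 1. Otherwise it is -1: for odd x the factor 2 is removed from n,
    for even x it is removed from x.\<close>
  from q8 consider "q mod 8 = 7" | "q mod 8 = 3" "odd x" | "q mod 8 = 3" "even x" by blast
  then show ?thesis
  proof cases
    case 1
    then have "Legendre ?n q = 1"
      using Legendre_q_part[OF cq factors_pos(1) qn] L2q by simp
    then have "Legendre x q = 1" using Ln L2q 1 by simp
    then show ?thesis using Legendre_p_eq_q[OF cq x0] L2q 1 by simp
  next
    case 2
    have "even ?n" using 2 oddx_oddy parity by simp
    then obtain m where m: "?n = 2 * m" by (elim evenE)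
    have m0: "m > 0" using factors_pos(1) unfolding m by simp
    have "Legendre ?n q = Legendre 2 q * Legendre m q" unfolding m by (rule Legendre_mult[OF q q_gt_2])
    then have Lm: "Legendre m q = Legendre x q" using Ln L2q by (simp split: if_splits)
    have mult: "multiplicity r ?n = multiplicity r 2 + multiplicity r m" if "prime r" for r
      unfolding m using that m0
      by (intro prime_elem_multiplicity_mult_distrib) auto
    have one: "multiplicity 2 w = 1" if "w mod 4 = 2" for w :: int
    proof (rule multiplicity_eqI)
      show "2 ^ 1 dvd w" using that by simp presburger
      show "\<not> 2 ^ Suc 1 dvd w" using that by simp presburger
    qed
    \<comment> \<open>The factors sum to 2 x M^2 = 2 modulo 4, so one of them has 2-multiplicity 1.
      The product has even 2-multiplicity, so n has odd and m even 2-multiplicity.\<close>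
    have "even (multiplicity 2 (?n * (x * M\<^sup>2 - N * y)))"
      unfolding norm_eq cq by (rule even_multiplicity_two[OF 2(1)])
    moreover have "multiplicity 2 (?n * (x * M\<^sup>2 - N * y))
        = multiplicity 2 ?n + multiplicity 2 (x * M\<^sup>2 - N * y)"
      using factors_pos by (intro prime_elem_multiplicity_mult_distrib) auto
    moreover have "?n mod 4 = 2 \<or> (x * M\<^sup>2 - N * y) mod 4 = 2"
    proof -
      have "a mod 4 = 2 \<or> b mod 4 = 2" if "even a" "a + b = 2 * k" "odd k" for a b k :: int
        using that by presburger
      moreover have "?n + (x * M\<^sup>2 - N * y) = 2 * (x * M\<^sup>2)" by simp
      moreover have "odd (x * M\<^sup>2)" using 2 parity by simp
      ultimately show ?thesis using \<open>even ?n\<close> by blast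
    qed
    ultimately have "odd (multiplicity 2 ?n)"
      using one[of ?n] one[of "x * M\<^sup>2 - N * y"] by auto
    then have "even (multiplicity 2 m)" using mult[of 2] by simp
    moreover have "\<not> q dvd m" using qn unfolding m by (metis dvd_mult)
    moreover have "multiplicity r m = multiplicity r ?n" if "prime r" "odd r" for r
    proof -
      have "\<not> r dvd 2" using that primes_dvd_imp_eq[of r 2] by auto
      then show ?thesis using mult[OF that(1)] by (simp add: not_dvd_imp_multiplicity_0)
    qed
    ultimately have "Legendre m q = 1" using Legendre_q_part[OF cq m0] by blast
    then show ?thesis using Legendre_p_eq_q[OF cq x0] 2 Lm by simp
  next
    case 3
    have yz: "odd y" "odd z" using dvd_xyz[of 2] 3 by auto
    obtain w where w: "x = 2 * w" using 3 by (elim evenE)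
    have w0: "w > 0" using x0 w by simp
    \<comment> \<open>With y and z odd, x^2 is 4 modulo 8, so half of x is odd and
      \<open>Legendre_p_eq_q\<close> applies to it.\<close>
    have "[x\<^sup>2 = 1 * 1 + 3 * 1] (mod 8)"
      unfolding xyz cq using p8 3 odd_square_mod_8[OF yz(1)] odd_square_mod_8[OF yz(2)]
      by (intro cong_add cong_mult) (simp_all add: cong_def)
    then have "(4 * w\<^sup>2) mod 8 = 4" unfolding w by (simp add: cong_def power_mult_distrib)
    moreover have "odd k" if "(4 * k) mod 8 = 4" for k :: int using that by presburger
    ultimately have "odd (w\<^sup>2)" by blast
    then have "odd w" by simp
    have "odd ?n" using yz parity 3 by simp
    then have "Legendre ?n q = 1"
      using Legendre_q_part[OF cq factors_pos(1) qn] by (simp add: not_dvd_imp_multiplicity_0)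
    moreover have "Legendre x q = Legendre 2 q * Legendre w q" "Legendre x p = Legendre 2 p * Legendre w p"
      unfolding w by (simp_all add: Legendre_mult p p_gt_2 q q_gt_2)
    ultimately have "Legendre w q = 1" using Ln L2q 3 by simp
    then show ?thesis
      using Legendre_p_eq_q[OF cq w0] \<open>odd w\<close> \<open>Legendre x p = _\<close> Legendre_2_p w by simp
  qed
qed

end

text \<open>The Jacobi symbol of $-2$ modulo $m$, extended by $0$ to even $m$.\<close>

definition chi_m2 :: "int \<Rightarrow> int" where
  "chi_m2 m = (if even m then 0 else if m mod 8 = 1 \<or> m mod 8 = 3 then 1 else - 1)"

lemma chi_m2_mod: "chi_m2 m = chi_m2 (m mod 8)"
proof -
  have "even m \<longleftrightarrow> even (m mod 8)" by presburger
  then show ?thesis by (simp add: chi_m2_def)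
qed

lemma chi_m2_mult: "chi_m2 (a * b) = chi_m2 a * chi_m2 b"
proof -
  have "chi_m2 (a * b) = chi_m2 ((a * b) mod 8)" by (rule chi_m2_mod)
  also have "(a * b) mod 8 = ((a mod 8) * (b mod 8)) mod 8" by (simp add: mod_mult_eq)
  also have "chi_m2 \<dots> = chi_m2 ((a mod 8) * (b mod 8))" by (rule chi_m2_mod[symmetric])
  also have "\<dots> = chi_m2 (a mod 8) * chi_m2 (b mod 8)"
    using mod_8_cases[of a] mod_8_cases[of b] by (elim disjE) (simp_all add: chi_m2_def)
  finally show ?thesis using chi_m2_mod[of a] chi_m2_mod[of b] by simp
qed

lemma Legendre_m2: "prime r \<Longrightarrow> r > 2 \<Longrightarrow> Legendre (- 2) r = chi_m2 r" for r :: int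
proof -
  assume r: "prime r" "r > 2"
  have "odd r" using r prime_odd_int by blast
  then consider "r mod 8 = 1" "r mod 4 = 1" | "r mod 8 = 3" "r mod 4 = 3"
    | "r mod 8 = 5" "r mod 4 = 1" | "r mod 8 = 7" "r mod 4 = 3"
    using mod_8_odd_cases[of r] by blast
  moreover have "Legendre (- 2) r = Legendre (- 1) r * Legendre 2 r"
    using Legendre_mult[OF r, of "- 1" 2] by simp
  ultimately show ?thesis
    using Legendre_minus_one[OF r] Legendre_two[OF r] \<open>odd r\<close>
    by cases (simp_all add: chi_m2_def)
qed

section \<open>The symbol of x for c = 2\<close>

context torsor_conic
begin

text \<open>The character of -2 takes the place of (./q): it is 1 on w, half of the chosen factor,
  it agrees on w and x, and on each prime of odd multiplicity in x it equals (r/p).\<close>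

lemma Legendre_x_2:
  assumes c2: "c = 2" and sgn: "(x * M\<^sup>2 + N * y) mod 4 = 2"
  shows "Legendre x p = 1"
proof -
  let ?n = "x * M\<^sup>2 + N * y"
  have x: "odd x" using c_not_dvd_x c2 by simp
  have y: "odd y"
  proof
    assume "even y"
    moreover have "odd (p * y\<^sup>2 + 2 * z\<^sup>2)" using x unfolding xyz[unfolded c2, symmetric] by simp
    ultimately show False by auto
  qed
  have "2 * z\<^sup>2 = x\<^sup>2 - p * y\<^sup>2" using xyz c2 by simp
  also have "[\<dots> = 1 - 1 * 1] (mod 8)"
    using p8 odd_square_mod_8[OF x] odd_square_mod_8[OF y]
    by (intro cong_diff cong_mult) (simp_all add: cong_def)
  finally have "[2 * z\<^sup>2 = 0] (mod 8)" by simp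
  then have "8 dvd 2 * z\<^sup>2" by (simp add: cong_0_iff)
  then have "2 * 4 dvd 2 * z\<^sup>2" by simp
  then have "4 dvd z\<^sup>2" by (subst (asm) dvd_times_left_cancel_iff) simp_all
  then have "even (z\<^sup>2)" by (rule dvd_trans[rotated]) simp
  then have "even z" by simp
  then obtain z' where z': "z = 2 * z'" by (elim evenE)
  obtain e' where e': "e = 2 * e'" using parity by (elim evenE)
  have "even k" "odd (k div 2)" if "k mod 4 = 2" for k :: int using that by presburger+
  from this[OF sgn] have n2: "even ?n" "odd (?n div 2)" .
  from n2(1) obtain w where w: "?n = 2 * w" by (elim evenE)
  have w0: "w > 0" using factors_pos(1) unfolding w by simp
  have wodd: "odd w" using n2(2) unfolding w by simp
  have "chi_m2 w \<ge> 0"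
  proof (rule multiplicative_nonneg[where f = chi_m2, OF chi_m2_mult _ w0])
    show "chi_m2 1 = 1" by (simp add: chi_m2_def)
    fix r :: int
    assume r: "prime r" "odd (multiplicity r w)"
    have "r dvd w" using r(2) by (rule odd_multiplicity_imp_dvd)
    then have ro: "odd r" using wodd dvd_trans by blast
    then have r2: "r > 2" using odd_prime_gt_2 r by blast
    have "multiplicity r ?n = multiplicity r 2 + multiplicity r w"
      unfolding w using r w0 by (intro prime_elem_multiplicity_mult_distrib) auto
    moreover have "\<not> r dvd 2" using r2 by (auto dest: zdvd_imp_le)
    ultimately have "odd (multiplicity r ?n)" using r by (simp add: not_dvd_imp_multiplicity_0)
    then have "QuadRes r (- 2)" using odd_multiplicity_factor[OF r(1) ro] r2 c2 by simp
    then show "chi_m2 r \<ge> 0" using Legendre_m2[OF r(1) r2] by (simp add: Legendre_def split: if_splits)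
  qed
  then have chi_w: "chi_m2 w = 1" using wodd by (simp add: chi_m2_def split: if_splits)
  have "Legendre x p * chi_m2 x \<ge> 0"
  proof (rule multiplicative_nonneg[where f = "\<lambda>m. Legendre m p * chi_m2 m", OF _ _ x0])
    show "Legendre (a * b) p * chi_m2 (a * b)
        = Legendre a p * chi_m2 a * (Legendre b p * chi_m2 b)" for a b
      using Legendre_mult[OF p p_gt_2] chi_m2_mult by simp
    show "Legendre 1 p * chi_m2 1 = 1"
      using Legendre_square[of p 1] p p_gt_2 by (simp add: chi_m2_def)
    fix r :: int
    assume r: "prime r" "odd (multiplicity r x)"
    have rx: "r dvd x" using r(2) by (rule odd_multiplicity_imp_dvd)
    then have ro: "odd r" using x dvd_trans by blast
    then have r2: "r > 2" using odd_prime_gt_2 r by blast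
    have "Legendre p r * Legendre (- 2) r = 1"
      using Legendre_p_c_dvd_x[OF r(1) ro rx] c2 by simp
    then show "Legendre r p * chi_m2 r \<ge> 0"
      using Legendre_swap[OF p p4 r(1) r2] Legendre_m2[OF r(1) r2] by simp
  qed
  \<comment> \<open>With the other factor equal to 4 t one has x M^2 = w + 2 t, and w t is a square
    modulo 8, hence 0, 4 or 1. So t is 0, 4 or w modulo 8, x is w or 3 w, and
    \<open>chi_m2 3 = 1\<close>.\<close>
  moreover have "chi_m2 x = chi_m2 w"
  proof -
    let ?n' = "x * M\<^sup>2 - N * y"
    have "2 * (w * ?n') = ?n * ?n'" unfolding w by simp
    also have "\<dots> = 2 * (4 * (z'\<^sup>2 * M ^ 4) + 32 * (q * e'\<^sup>2 * y)\<^sup>2)"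
      unfolding norm_eq c2 z' e' by (simp add: power_mult_distrib flip: power_mult)
    finally have wn': "w * ?n' = 4 * (z'\<^sup>2 * M ^ 4 + 8 * (q * e'\<^sup>2 * y)\<^sup>2)" by simp
    then have "4 dvd w * ?n'" by simp
    moreover have "coprime 4 w" using wodd coprime_power_left_iff[of 2 2 w] by simp
    ultimately have "4 dvd ?n'" by (simp add: coprime_dvd_mult_right_iff)
    then obtain t where t: "?n' = 4 * t" by (elim dvdE)
    have "2 * (x * M\<^sup>2) = ?n + ?n'" by simp
    then have xw: "x * M\<^sup>2 = w + 2 * t" unfolding w t by simp
    have "w * t = z'\<^sup>2 * M ^ 4 + 8 * (q * e'\<^sup>2 * y)\<^sup>2" using wn' unfolding t by simp
    moreover have "[z'\<^sup>2 * M ^ 4 + 8 * (q * e'\<^sup>2 * y)\<^sup>2 = z'\<^sup>2 * 1 + 0] (mod 8)"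
    proof (intro cong_add cong_mult cong_refl)
      have "M ^ 4 mod 16 = 1" using odd_fourth_power_mod_16 parity by blast
      then show "[M ^ 4 = 1] (mod 8)" using mod_8_eq_mod_16[of "M ^ 4"] by (simp add: cong_def)
    qed (simp add: cong_def)
    ultimately have "[w * t = z'\<^sup>2] (mod 8)" by simp
    moreover have "z'\<^sup>2 mod 8 = 0 \<or> z'\<^sup>2 mod 8 = 4 \<or> z'\<^sup>2 mod 8 = 1"
    proof (cases "even z'")
      case True
      then obtain k where "z' = 2 * k" by (elim evenE)
      then have k: "z'\<^sup>2 = 4 * k\<^sup>2" by (simp add: power_mult_distrib)
      have "(4 * j) mod 8 = 0 \<or> (4 * j) mod 8 = 4" for j :: int
      proof (cases "even j")
        case True
        then show ?thesis by (auto elim: evenE)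
      next
        case False
        then obtain i where "4 * j = 8 * i + 4" by (auto elim: oddE)
        then show ?thesis by simp
      qed
      from this[of "k\<^sup>2"] show ?thesis unfolding k by blast
    next
      case False
      then show ?thesis using odd_square_mod_8 by blast
    qed
    ultimately have wt: "((w mod 8) * (t mod 8)) mod 8 \<in> {0, 4, 1}"
      by (auto simp: cong_def mod_mult_eq)
    have "[x * 1 = x * M\<^sup>2] (mod 8)"
      using odd_square_mod_8[of M] parity by (intro cong_mult cong_refl) (simp add: cong_def)
    also have "[x * M\<^sup>2 = w mod 8 + 2 * (t mod 8)] (mod 8)"
      unfolding xw by (intro cong_add cong_mult) (simp_all add: cong_def)
    finally have "x mod 8 = (w mod 8 + 2 * (t mod 8)) mod 8"
      by (simp only: cong_def mult_1_right)
    then have xm: "chi_m2 x = chi_m2 ((w mod 8 + 2 * (t mod 8)) mod 8)"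
      using chi_m2_mod[of x] by (simp only:)
    have "w mod 8 = 1 \<or> w mod 8 = 3 \<or> w mod 8 = 5 \<or> w mod 8 = 7" using mod_8_odd_cases[OF wodd] by blast
    then have "chi_m2 ((w mod 8 + 2 * (t mod 8)) mod 8) = chi_m2 (w mod 8)"
      using mod_8_cases[of t] wt by (elim disjE) (simp_all add: chi_m2_def)
    then show ?thesis using xm chi_m2_mod[of w] by (simp only:)
  qed
  ultimately show ?thesis using chi_w Legendre_cases[of x p] p_not_dvd(1) by (auto simp: Legendre_eq_0_iff)
qed

end

lemma (in torsor_point) torsor_point_uminus: "torsor_point p q M e (- N)"
  by unfold_locales (simp_all add: Me eq)

lemma (in torsor_point) quartic_q: "quartic_sym q p = 1"
proof -
  obtain x y z where xyz: "x > 0" "x\<^sup>2 = p * y\<^sup>2 + q * z\<^sup>2"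
    "\<And>d. d dvd x \<Longrightarrow> d dvd y \<Longrightarrow> d dvd z \<Longrightarrow> is_unit d"
    using conic_solution[OF p q p_ne_q QuadRes_p(2,3)] by blast
  interpret P: torsor_conic p q M e N q x y z by unfold_locales (use xyz in auto)
  interpret m: torsor_point p q M e "- N" by (rule torsor_point_uminus)
  interpret m: torsor_conic p q M e "- N" q x y z by unfold_locales (use xyz in auto)
  \<comment> \<open>Hence q divides one of the two factors, and the matching sign of N satisfies the
    sign condition of \<open>Legendre_x_q\<close>.\<close>
  have "q dvd (x * M\<^sup>2 + N * y) * (x * M\<^sup>2 - N * y)"
    unfolding P.norm_eq by (simp add: power2_eq_square)
  then have "Legendre x p = 1"
    using P.Legendre_x_q m.Legendre_x_q q by (auto simp: prime_dvd_mult_iff)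
  then show ?thesis using P.quartic_c quartic_sym_eq_1_iff by simp
qed

lemma (in torsor_point) quartic_2: "quartic_sym 2 p = 1"
proof -
  have "[1\<^sup>2 = p] (mod 2)" using odd_pq by (simp add: cong_iff_dvd_diff)
  then have "QuadRes 2 p" unfolding QuadRes_def by blast
  moreover have "p \<noteq> 2" using p_gt_2 by simp
  ultimately obtain x y z where xyz: "x > 0" "x\<^sup>2 = p * y\<^sup>2 + 2 * z\<^sup>2"
    "\<And>d. d dvd x \<Longrightarrow> d dvd y \<Longrightarrow> d dvd z \<Longrightarrow> is_unit d"
    using conic_solution[OF p _ _ QuadRes_p(1)] by auto
  interpret P: torsor_conic p q M e N 2 x y z by unfold_locales (use xyz in auto)
  interpret m: torsor_point p q M e "- N" by (rule torsor_point_uminus)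
  interpret m: torsor_conic p q M e "- N" 2 x y z by unfold_locales (use xyz in auto)
  have x: "odd x" using P.c_not_dvd_x by simp
  have "odd (p * y\<^sup>2 + 2 * z\<^sup>2)" using x unfolding xyz(2)[symmetric] by simp
  then have y: "odd y" by auto
  have "a mod 4 = 2 \<or> b mod 4 = 2" if "even a" "a + b = 2 * k" "odd k" for a b k :: int
    using that by presburger
  moreover have "(x * M\<^sup>2 + N * y) + (x * M\<^sup>2 - N * y) = 2 * (x * M\<^sup>2)" by simp
  moreover have "odd (x * M\<^sup>2)" "even (x * M\<^sup>2 + N * y)" using x y parity by simp_all
  ultimately have "(x * M\<^sup>2 + N * y) mod 4 = 2 \<or> (x * M\<^sup>2 - N * y) mod 4 = 2" by blast
  then have "Legendre x p = 1"
    using P.Legendre_x_2 m.Legendre_x_2 by auto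
  then show ?thesis using P.quartic_c quartic_sym_eq_1_iff by simp
qed

lemma (in prime_pair) quartic_of_rational_point:
  assumes "has_rat_pt p (- (4 * q\<^sup>2))"
  shows "quartic_sym 2 p = 1 \<and> quartic_sym q p = 1"
proof -
  obtain M e N where "coprime M e" "N\<^sup>2 = p * M ^ 4 + - (4 * q\<^sup>2) * e ^ 4"
    using has_rat_pt_coprime[OF assms] by blast
  then interpret torsor_point p q M e N by unfold_locales auto
  show ?thesis using quartic_2 quartic_q by simp
qed

section \<open>Local solubility\<close>

text \<open>The lifted root stays in the class of x, so that a second lifting can start from x in
  \<open>hensel_fourth_root\<close>.\<close>

lemma hensel_sqrt:
  fixes l :: int
  assumes l: "prime l" "odd l" and x: "\<not> l dvd x" "[x\<^sup>2 = c] (mod l)"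
  shows "\<exists>y. [y = x] (mod l) \<and> [y\<^sup>2 = c] (mod l ^ Suc k)"
proof (induction k)
  case 0
  show ?case using x by (intro exI[of _ x]) simp
next
  case (Suc k)
  then obtain y where y: "[y = x] (mod l)" "[y\<^sup>2 = c] (mod l ^ Suc k)" by blast
  then obtain d where d: "y\<^sup>2 - c = l ^ Suc k * d" unfolding cong_iff_dvd_diff by (elim dvdE)
  have "\<not> l dvd y" using y(1) x(1) cong_dvd_iff by blast
  moreover have "\<not> l dvd 2" using l primes_dvd_imp_eq[of l 2] by auto
  ultimately have "\<not> l dvd 2 * y" using l(1) by (simp add: prime_dvd_mult_iff)
  then have "coprime (2 * y) l" using prime_imp_coprime[OF l(1)] coprime_commute by blast
  then obtain u where u: "[2 * y * u = 1] (mod l)" using cong_solve_coprime_int by blast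
  define h where "h = l ^ Suc k"
  define s where "s = - d * u"
  have "l dvd 2 * y * u - 1" using u by (simp add: cong_iff_dvd_diff)
  then have "l dvd - d * (2 * y * u - 1)" by (rule dvd_mult)
  moreover have "- d * (2 * y * u - 1) = d + 2 * y * s" by (simp add: s_def algebra_simps)
  ultimately have "l dvd d + 2 * y * s" by (simp only:)
  then have 1: "l ^ Suc (Suc k) dvd h * (d + 2 * y * s)"
    unfolding h_def power_Suc2[of l "Suc k"] by (intro mult_dvd_mono dvd_refl)
  have "l ^ Suc (Suc k) dvd h * h" unfolding h_def power_add[symmetric] by (rule le_imp_power_dvd) simp
  then have 2: "l ^ Suc (Suc k) dvd h * h * s\<^sup>2" by (rule dvd_mult2)
  have "(y + h * s)\<^sup>2 - c = (y\<^sup>2 - c) + 2 * y * h * s + h * h * s\<^sup>2"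
    by (simp add: power2_eq_square algebra_simps)
  also have "\<dots> = h * (d + 2 * y * s) + h * h * s\<^sup>2"
    unfolding d h_def[symmetric] by (simp add: algebra_simps)
  finally have "l ^ Suc (Suc k) dvd (y + h * s)\<^sup>2 - c" using 1 2 by simp
  moreover have "[y + h * s = x] (mod l)"
    using cong_add[OF y(1), of "h * s" 0] by (simp add: h_def cong_0_iff)
  ultimately show ?case unfolding cong_iff_dvd_diff by blast
qed

lemma sqrt_mod_prime_power:
  fixes l :: int
  assumes "prime l" "odd l" "\<not> l dvd c" "QuadRes l c"
  shows "\<exists>y. [y\<^sup>2 = c] (mod l ^ Suc k)"
proof -
  obtain x where x: "[x\<^sup>2 = c] (mod l)" using assms(4) by (auto simp: QuadRes_def)
  then have "\<not> l dvd x" using assms(3) by (metis cong_dvd_iff dvd_mult2 power2_eq_square)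
  then show ?thesis using hensel_sqrt[OF assms(1,2) _ x] by blast
qed

lemma square_cong: "[a = b] (mod m) \<Longrightarrow> [b\<^sup>2 = c] (mod m) \<Longrightarrow> [a\<^sup>2 = c] (mod m)" for a b c m :: int
  by (rule cong_trans[OF cong_pow])

lemma fourth_power_eq_square: "y ^ 4 = (y\<^sup>2)\<^sup>2" for y :: "'a :: monoid_mult"
  by (simp flip: power_mult)

lemma hensel_fourth_root:
  fixes l :: int
  assumes l: "prime l" "odd l" and x: "\<not> l dvd x" "[x ^ 4 = c] (mod l)"
  shows "\<exists>y. [y ^ 4 = c] (mod l ^ Suc k)"
proof -
  have "\<not> l dvd x\<^sup>2" using l x prime_dvd_power by blast
  then obtain s where s: "[s = x\<^sup>2] (mod l)" "[s\<^sup>2 = c] (mod l ^ Suc k)"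
    using hensel_sqrt[OF l, of "x\<^sup>2" c k] x(2) unfolding fourth_power_eq_square by blast
  obtain y where "[y\<^sup>2 = s] (mod l ^ Suc k)"
    using hensel_sqrt[OF l x(1), of s k] s(1) cong_sym by blast
  then have "[(y\<^sup>2)\<^sup>2 = c] (mod l ^ Suc k)" using s(2) by (rule square_cong)
  then show ?thesis unfolding fourth_power_eq_square by blast
qed

text \<open>As -1 is a non-residue, one of the two square roots s and -s of c is itself a
  residue.\<close>

lemma fourth_root_3_mod_4:
  fixes q :: int
  assumes q: "prime q" "q mod 4 = 3" and c: "\<not> q dvd c" "QuadRes q c"
  shows "\<exists>y. [y ^ 4 = c] (mod q ^ Suc k)"
proof -
  have "odd q" using q(2) by presburger
  have q2: "q > 2" using q(1) \<open>odd q\<close> by (rule odd_prime_gt_2)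
  obtain s where s: "[s\<^sup>2 = c] (mod q ^ Suc k)"
    using sqrt_mod_prime_power[OF q(1) \<open>odd q\<close> c] by blast
  then have "[s\<^sup>2 = c] (mod q)" by (rule cong_dvd_modulus) simp
  then have sq: "\<not> q dvd s" using c(1) by (metis cong_dvd_iff dvd_mult2 power2_eq_square)
  have "Legendre (- s) q = - Legendre s q"
    using Legendre_mult[OF q(1) q2, of "- 1" s] Legendre_minus_one[OF q(1) q2] q(2) by simp
  then have "Legendre s q = 1 \<or> Legendre (- s) q = 1"
    using Legendre_cases[of s q] sq by (auto simp: Legendre_eq_0_iff)
  then have "\<exists>t. t\<^sup>2 = s\<^sup>2 \<and> Legendre t q = 1"
    by (elim disjE) (rule exI[of _ s], simp, rule exI[of _ "- s"], simp)
  then obtain t where t: "t\<^sup>2 = s\<^sup>2" "Legendre t q = 1" by blast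
  obtain y where "[y\<^sup>2 = t] (mod q ^ Suc k)"
    using sqrt_mod_prime_power[OF q(1) \<open>odd q\<close>, of t] t(2) by (auto simp: Legendre_eq_1_iff)
  then have "[(y\<^sup>2)\<^sup>2 = c] (mod q ^ Suc k)" using s unfolding t(1)[symmetric] by (rule square_cong)
  then show ?thesis unfolding fourth_power_eq_square by blast
qed

lemma sqrt_mod_two_power:
  fixes c :: int
  assumes "c mod 8 = 1"
  shows "\<exists>y. odd y \<and> [y\<^sup>2 = c] (mod 2 ^ (k + 3))"
proof (induction k)
  case 0
  show ?case using assms by (intro exI[of _ 1]) (simp add: cong_def)
next
  case (Suc k)
  then obtain y where y: "odd y" "[y\<^sup>2 = c] (mod 2 ^ (k + 3))" by blast
  then obtain d where d: "y\<^sup>2 - c = 2 ^ (k + 3) * d" unfolding cong_iff_dvd_diff by (elim dvdE)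
  \<comment> \<open>Half the current modulus: the linear term 2 y h d then corrects the error in
    exactly the next binary digit.\<close>
  define h :: int where "h = 2 ^ (k + 2)"
  have h: "2 ^ (k + 3) = 2 * h" "2 ^ (Suc k + 3) = 4 * h" by (simp_all add: h_def power_add)
  have "(y + h * d)\<^sup>2 - c = (y\<^sup>2 - c) + 2 * y * h * d + h * h * d\<^sup>2"
    by (simp add: power2_eq_square algebra_simps)
  also have "\<dots> = 2 * h * (d * (1 + y)) + h * h * d\<^sup>2"
    unfolding d h by (simp add: algebra_simps)
  finally have e: "(y + h * d)\<^sup>2 - c = 2 * h * (d * (1 + y)) + h * h * d\<^sup>2" .
  have "2 * h * 2 dvd 2 * h * (d * (1 + y))" using y(1) by (intro mult_dvd_mono) auto
  moreover have "h * 4 dvd h * (h * d\<^sup>2)" by (intro mult_dvd_mono dvd_mult2) (auto simp: h_def)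
  ultimately have "4 * h dvd (y + h * d)\<^sup>2 - c" unfolding e by (intro dvd_add) (simp_all add: algebra_simps)
  then have "[(y + h * d)\<^sup>2 = c] (mod 2 ^ (Suc k + 3))" unfolding h cong_iff_dvd_diff .
  moreover have "odd (y + h * d)" using y(1) by (simp add: h_def)
  ultimately show ?case by blast
qed

text \<open>A square root s of c satisfies s^2 = 1 modulo 16, which forces s to be 1 or -1 modulo 8;
  up to sign it is therefore a 2-adic square.\<close>

lemma fourth_root_mod_two_power:
  fixes c :: int
  assumes "c mod 16 = 1"
  shows "\<exists>y. odd y \<and> [y ^ 4 = c] (mod 2 ^ k)"
proof -
  have "c mod 8 = 1" using assms mod_8_eq_mod_16[of c] by simp
  then obtain s where s: "odd s" "[s\<^sup>2 = c] (mod 2 ^ (Suc k + 3))" using sqrt_mod_two_power by blast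
  have "[s\<^sup>2 = c] (mod 16)" by (rule cong_dvd_modulus[OF s(2)]) (simp add: power_add)
  then have s16: "s\<^sup>2 mod 16 = 1" using assms by (simp add: cong_def)
  have "s mod 8 = 1 \<or> s mod 8 = 7"
  proof (rule ccontr)
    assume "\<not> ?thesis"
    then have "s mod 8 = 3 \<or> s mod 8 = 5" using mod_8_odd_cases[OF s(1)] by blast
    moreover have "s = 8 * (s div 8) + s mod 8" by simp
    ultimately obtain j where "s = 8 * j + 3 \<or> s = 8 * j + 5" by metis
    then have "s\<^sup>2 = 16 * (4 * j\<^sup>2 + 3 * j) + 9 \<or> s\<^sup>2 = 16 * (4 * j\<^sup>2 + 5 * j + 1) + 9"
      by (auto simp: power2_eq_square algebra_simps)
    then obtain i where "s\<^sup>2 = 16 * i + 9" by blast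
    then have "s\<^sup>2 mod 16 = 9" by simp
    then show False using s16 by simp
  qed
  then have "s mod 8 = 1 \<or> (- s) mod 8 = 1" by presburger
  then have "\<exists>t. t\<^sup>2 = s\<^sup>2 \<and> t mod 8 = 1"
    by (elim disjE) (rule exI[of _ s], simp, rule exI[of _ "- s"], simp)
  then obtain t where t: "t\<^sup>2 = s\<^sup>2" "t mod 8 = 1" by blast
  obtain y where y: "odd y" "[y\<^sup>2 = t] (mod 2 ^ (k + 3))" using sqrt_mod_two_power[OF t(2)] by blast
  have "[y\<^sup>2 = t] (mod 2 ^ k)" by (rule cong_dvd_modulus[OF y(2)]) (simp add: power_add)
  moreover have "[t\<^sup>2 = c] (mod 2 ^ k)" unfolding t(1) by (rule cong_dvd_modulus[OF s(2)]) (simp add: power_add)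
  ultimately have "[(y\<^sup>2)\<^sup>2 = c] (mod 2 ^ k)" by (rule square_cong)
  then show ?thesis using y(1) unfolding fourth_power_eq_square by blast
qed

lemma has_local_ptI:
  assumes "\<And>k. \<exists>M e N. (\<not> l dvd M \<or> \<not> l dvd e) \<and> [N\<^sup>2 = a * M ^ 4 + b * e ^ 4] (mod l ^ Suc k)"
  shows "has_local_pt l a b"
  unfolding has_local_pt_def
proof
  fix k
  obtain M e N where "\<not> l dvd M \<or> \<not> l dvd e" "[N\<^sup>2 = a * M ^ 4 + b * e ^ 4] (mod l ^ Suc k)"
    using assms by blast
  moreover from this(2) have "[N\<^sup>2 = a * M ^ 4 + b * e ^ 4] (mod l ^ k)" by (rule cong_dvd_modulus) simp
  ultimately show "\<exists>M e N. (\<not> l dvd M \<or> \<not> l dvd e) \<and> [N\<^sup>2 = a * M ^ 4 + b * e ^ 4] (mod l ^ k)"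
    by blast
qed

text \<open>If $a x^4 + b$ is a non-residue for every $x$ and $\kappa^2 = a b$, then $b (a x^4 + b) =
  \kappa^2 x^4 + b^2$ is a nonzero square $w^2$ for every $x$, and $w - \kappa x^2$ determines
  both $w$ and $x^2$, because $(w - \kappa x^2) (w + \kappa x^2) = b^2$. As the value $b$ is not
  attained for $x \neq 0$, this injects a set of size $l - 1$ into one of size $l - 2$.\<close>

lemma quartic_point_mod_prime:
  fixes l a b :: int
  assumes l: "prime l" "odd l" and ab: "\<not> l dvd a" "\<not> l dvd b"
  shows "\<exists>M e N. (\<not> l dvd M \<or> \<not> l dvd e) \<and> [N\<^sup>2 = a * M ^ 4 + b * e ^ 4] (mod l)"
proof (rule ccontr)
  assume neg: "\<not> ?thesis"
  have l2: "l > 2" using l by (rule odd_prime_gt_2)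
  have unit: "\<not> l dvd 1" using l2 by (auto dest: zdvd_imp_le)
  have two: "\<not> l dvd 2" using l2 by (auto dest: zdvd_imp_le)
  have "\<not> QuadRes l a"
  proof
    assume "QuadRes l a"
    then obtain N where "[N\<^sup>2 = a * 1 ^ 4 + b * 0 ^ 4] (mod l)" by (auto simp: QuadRes_def)
    then show False using neg unit by blast
  qed
  then have La: "Legendre a l = - 1" using ab by (simp add: Legendre_def cong_0_iff)
  have nb: "\<not> QuadRes l (a * M ^ 4 + b)" for M
  proof
    assume "QuadRes l (a * M ^ 4 + b)"
    then obtain N where "[N\<^sup>2 = a * M ^ 4 + b * 1 ^ 4] (mod l)" by (auto simp: QuadRes_def)
    then show False using neg unit by blast
  qed
  have QR0: "QuadRes l v" if "l dvd v" for v
    unfolding QuadRes_def using that by (intro exI[of _ 0]) (simp add: cong_def dvd_eq_mod_eq_0)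
  have Lf: "Legendre (a * M ^ 4 + b) l = - 1" for M
    using nb[of M] QR0 by (auto simp: Legendre_def cong_0_iff)
  have Lb: "Legendre b l = - 1" using Lf[of 0] by simp
  have "Legendre (a * b) l = 1" using Legendre_mult[OF l(1) l2] La Lb by simp
  then obtain \<kappa> where \<kappa>: "[\<kappa>\<^sup>2 = a * b] (mod l)" by (auto simp: Legendre_eq_1_iff QuadRes_def)
  have \<kappa>0: "\<not> l dvd \<kappa>"
    using \<kappa> ab l(1) by (metis cong_dvd_iff dvd_mult2 power2_eq_square prime_dvd_mult_iff)
  have "\<exists>w. [w\<^sup>2 = b * (a * i ^ 4 + b)] (mod l) \<and> \<not> l dvd w" for i
  proof -
    have "Legendre (b * (a * i ^ 4 + b)) l = 1" using Legendre_mult[OF l(1) l2] Lf Lb by simp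
    then obtain w where "[w\<^sup>2 = b * (a * i ^ 4 + b)] (mod l)" "\<not> l dvd b * (a * i ^ 4 + b)"
      by (auto simp: Legendre_eq_1_iff QuadRes_def)
    then show ?thesis by (metis cong_dvd_iff dvd_mult2 power2_eq_square)
  qed
  then obtain w where w: "[(w i)\<^sup>2 = b * (a * i ^ 4 + b)] (mod l)" "\<not> l dvd w i" for i by metis
  \<comment> \<open>Only i^2 and i^4 enter, so i runs over nonzero residues up to sign; the second
    component is the sign of the root \<open>w i\<close>. This gives l - 1 pairs, whose g-values
    avoid 0 and b.\<close>
  define D where "D = {1..(l - 1) div 2} \<times> {1, - 1 :: int}"
  define g where "g = (\<lambda>(i, \<epsilon>). \<epsilon> * w i - \<kappa> * i\<^sup>2)"
  define h where "h = (\<lambda>(i, \<epsilon>). \<epsilon> * w i + \<kappa> * i\<^sup>2)"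
  have gh: "[g d * h d = b\<^sup>2] (mod l)" if "d \<in> D" for d
  proof -
    obtain i \<epsilon> where d: "d = (i, \<epsilon>)" "\<epsilon> * \<epsilon> = 1" using \<open>d \<in> D\<close> by (auto simp: D_def)
    have "g d * h d = \<epsilon> * \<epsilon> * (w i)\<^sup>2 - \<kappa>\<^sup>2 * i ^ 4"
      by (simp add: g_def h_def d(1) algebra_simps power2_eq_square power4_eq_xxxx)
    also have "[\<dots> = 1 * (b * (a * i ^ 4 + b)) - a * b * i ^ 4] (mod l)"
      unfolding d(2) using w(1) \<kappa> by (intro cong_diff cong_mult cong_refl)
    also have "1 * (b * (a * i ^ 4 + b)) - a * b * i ^ 4 = b\<^sup>2" by (simp add: algebra_simps power2_eq_square)
    finally show ?thesis .
  qed
  have b2: "\<not> l dvd b\<^sup>2" using ab l(1) prime_dvd_power by blast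
  have g0: "\<not> l dvd g d" if "d \<in> D" for d
    using gh[OF that] b2 by (metis cong_dvd_iff dvd_mult2)
  have not_dvd_small: "\<not> l dvd i" if "0 < i" "i < l" for i using that by (auto dest: zdvd_imp_le)
  have inD: "0 < i" "2 * i < l" if "(i, \<epsilon>) \<in> D" for i \<epsilon> using that l2 by (auto simp: D_def)
  have g_b: "\<not> [g d = b] (mod l)" if d: "d \<in> D" for d
  proof
    assume gb: "[g d = b] (mod l)"
    obtain i \<epsilon> where i: "d = (i, \<epsilon>)" by (cases d)
    have "[b * h d = b * b] (mod l)"
      using cong_mult[OF gb cong_refl, of "h d"] gh[OF d] by (metis cong_sym cong_trans power2_eq_square)
    then have "[h d = b] (mod l)"
      using ab(2) l(1) by (metis cong_mult_lcancel coprime_commute prime_imp_coprime)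
    then have "[h d - g d = b - b] (mod l)" using gb by (intro cong_diff)
    then have "l dvd 2 * \<kappa> * i\<^sup>2" by (simp add: cong_0_iff g_def h_def i mult.assoc)
    then have "l dvd i" using l(1) \<kappa>0 two by (metis prime_dvd_mult_iff prime_dvd_power)
    then show False using not_dvd_small inD[of i \<epsilon>] d i by auto
  qed
  have "inj_on (\<lambda>d. g d mod l) D"
  proof (rule inj_onI)
    fix d d' assume d: "d \<in> D" "d' \<in> D" and eq: "g d mod l = g d' mod l"
    obtain i \<epsilon> where i: "d = (i, \<epsilon>)" by (cases d)
    obtain i' \<epsilon>' where i': "d' = (i', \<epsilon>')" by (cases d')
    have cg: "[g d = g d'] (mod l)" using eq by (simp add: cong_def)
    then have "[g d * h d' = g d' * h d'] (mod l)" by (intro cong_mult cong_refl)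
    then have "[g d * h d = g d * h d'] (mod l)" using gh d by (meson cong_sym cong_trans)
    then have ch: "[h d = h d'] (mod l)"
      using g0[OF d(1)] l(1) by (metis cong_mult_lcancel coprime_commute prime_imp_coprime)
    have "[h d - g d = h d' - g d'] (mod l)" using ch cg by (rule cong_diff)
    then have "l dvd 2 * \<kappa> * i\<^sup>2 - 2 * \<kappa> * i'\<^sup>2"
      by (simp add: cong_iff_dvd_diff g_def h_def i i' mult.assoc)
    also have "2 * \<kappa> * i\<^sup>2 - 2 * \<kappa> * i'\<^sup>2 = 2 * \<kappa> * ((i - i') * (i + i'))"
      by (simp add: algebra_simps power2_eq_square)
    finally have "l dvd i - i' \<or> l dvd i + i'"
      using l(1) \<kappa>0 two by (simp add: prime_dvd_mult_iff)
    moreover have "\<not> l dvd i + i'" using inD[of i \<epsilon>] inD[of i' \<epsilon>'] d i i' by (intro not_dvd_small) auto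
    ultimately have "l dvd i - i'" by blast
    moreover have "\<bar>i - i'\<bar> < l" using inD[of i \<epsilon>] inD[of i' \<epsilon>'] d i i' by auto
    ultimately have ii: "i = i'" using dvd_imp_le_int[of "i - i'" l] by auto
    have "\<epsilon> = \<epsilon>'"
    proof (rule ccontr)
      assume "\<epsilon> \<noteq> \<epsilon>'"
      then have e: "\<epsilon>' = - \<epsilon>" "\<epsilon> = 1 \<or> \<epsilon> = - 1" using d i i' by (auto simp: D_def)
      have "l dvd g d - g d'" using cg by (simp add: cong_iff_dvd_diff)
      then have "l dvd 2 * \<epsilon> * w i" unfolding g_def i i' ii e(1) by (simp add: mult.assoc)
      then have "l dvd 2 * w i" using e(2) by auto
      then show False using w(2) two l(1) by (simp add: prime_dvd_mult_iff)
    qed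
    then show "d = d'" using ii i i' by simp
  qed
  then have "card D = card ((\<lambda>d. g d mod l) ` D)" by (simp add: card_image)
  also have "\<dots> \<le> card ({0..<l} - {0, b mod l})"
  proof (rule card_mono)
    show "(\<lambda>d. g d mod l) ` D \<subseteq> {0..<l} - {0, b mod l}"
      using g0 g_b l2 by (auto simp: dvd_eq_mod_eq_0 cong_def)
  qed simp
  also have "\<dots> = nat (l - 2)"
  proof -
    have "b mod l \<noteq> 0" using ab(2) by (simp add: dvd_eq_mod_eq_0)
    then show ?thesis using l2 by (subst card_Diff_subset) (auto simp: nat_diff_distrib)
  qed
  finally have "card D \<le> nat (l - 2)" .
  moreover have "card D = nat (l - 1)"
  proof -
    obtain j where "l = 2 * j + 1" using l(2) by (elim oddE)
    then show ?thesis by (simp add: D_def card_cartesian_product nat_mult_distrib)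
  qed
  ultimately show False using l2 by simp
qed

text \<open>A point modulo l lifts through N if l does not divide N. Otherwise M and e are units,
  and M is lifted so that N becomes 0.\<close>

lemma has_local_pt_good_prime:
  assumes l: "prime l" "odd l" and ab: "\<not> l dvd a" "\<not> l dvd b"
  shows "has_local_pt l a b"
proof (rule has_local_ptI)
  fix k
  obtain M e N where Me: "\<not> l dvd M \<or> \<not> l dvd e" and N: "[N\<^sup>2 = a * M ^ 4 + b * e ^ 4] (mod l)"
    using quartic_point_mod_prime[OF l ab] by blast
  show "\<exists>M e N. (\<not> l dvd M \<or> \<not> l dvd e) \<and> [N\<^sup>2 = a * M ^ 4 + b * e ^ 4] (mod l ^ Suc k)"
  proof (cases "l dvd N")
    case False
    then show ?thesis using hensel_sqrt[OF l False N] Me by blast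
  next
    case True
    then have "l dvd N\<^sup>2" by (simp add: power2_eq_square)
    then have v: "l dvd a * M ^ 4 + b * e ^ 4" using N cong_dvd_iff by blast
    have e: "\<not> l dvd e"
    proof
      assume "l dvd e"
      then have "l dvd b * e ^ 4" by (simp add: power4_eq_xxxx)
      then have "l dvd a * M ^ 4" using v by (simp add: dvd_add_left_iff)
      then show False using \<open>l dvd e\<close> Me ab l(1) by (metis prime_dvd_mult_iff prime_dvd_power)
    qed
    have M: "\<not> l dvd M"
    proof
      assume "l dvd M"
      then have "l dvd a * M ^ 4" by (simp add: power4_eq_xxxx)
      then have "l dvd b * e ^ 4" using v by (simp add: dvd_add_right_iff)
      then show False using e ab l(1) by (metis prime_dvd_mult_iff prime_dvd_power)
    qed
    \<comment> \<open>Multiplying by a^3 solves for a M in place of M and so avoids inverting a; the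
      lifted point is (y, a e) with N = 0.\<close>
    have "(a * M) ^ 4 - - (b * a ^ 3 * e ^ 4) = a ^ 3 * (a * M ^ 4 + b * e ^ 4)"
      by (simp add: algebra_simps power4_eq_xxxx power3_eq_cube)
    then have "[(a * M) ^ 4 = - (b * a ^ 3 * e ^ 4)] (mod l)" unfolding cong_iff_dvd_diff using v by simp
    moreover have "\<not> l dvd a * M" using M ab l(1) by (simp add: prime_dvd_mult_iff)
    ultimately obtain y where y: "[y ^ 4 = - (b * a ^ 3 * e ^ 4)] (mod l ^ Suc k)"
      using hensel_fourth_root[OF l] by blast
    have "[a * y ^ 4 + b * (a * e) ^ 4 = a * - (b * a ^ 3 * e ^ 4) + b * (a * e) ^ 4] (mod l ^ Suc k)"
      using y by (intro cong_add cong_mult cong_refl)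
    also have "a * - (b * a ^ 3 * e ^ 4) + b * (a * e) ^ 4 = 0\<^sup>2"
      by (simp add: algebra_simps power4_eq_xxxx power3_eq_cube)
    finally have "[0\<^sup>2 = a * y ^ 4 + b * (a * e) ^ 4] (mod l ^ Suc k)" by (rule cong_sym)
    moreover have "\<not> l dvd a * e" using e ab l(1) by (simp add: prime_dvd_mult_iff)
    ultimately show ?thesis by blast
  qed
qed

text \<open>If one coefficient is an l-adic square, the points with (M, e) = (1, 0) or (0, 1)
  suffice.\<close>

lemma has_local_pt_square_coeff:
  assumes l: "prime l" "odd l" and a: "\<not> l dvd a" "QuadRes l a"
  shows "has_local_pt l a b" "has_local_pt l b (a * h\<^sup>2)"
proof -
  have unit: "\<not> l dvd 1" using l not_prime_unit by blast
  show "has_local_pt l a b"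
  proof (rule has_local_ptI)
    fix k
    obtain y where "[y\<^sup>2 = a] (mod l ^ Suc k)" using sqrt_mod_prime_power[OF l a] by blast
    then have "[y\<^sup>2 = a * 1 ^ 4 + b * 0 ^ 4] (mod l ^ Suc k)" by simp
    then show "\<exists>M e N. (\<not> l dvd M \<or> \<not> l dvd e) \<and> [N\<^sup>2 = a * M ^ 4 + b * e ^ 4] (mod l ^ Suc k)"
      using unit by blast
  qed
  show "has_local_pt l b (a * h\<^sup>2)"
  proof (rule has_local_ptI)
    fix k
    obtain y where "[y\<^sup>2 = a] (mod l ^ Suc k)" using sqrt_mod_prime_power[OF l a] by blast
    then have "[(y * h)\<^sup>2 = a * h\<^sup>2] (mod l ^ Suc k)"
      unfolding power_mult_distrib by (intro cong_mult cong_refl)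
    then have "[(y * h)\<^sup>2 = b * 0 ^ 4 + a * h\<^sup>2 * 1 ^ 4] (mod l ^ Suc k)" by simp
    then show "\<exists>M e N. (\<not> l dvd M \<or> \<not> l dvd e) \<and> [N\<^sup>2 = b * M ^ 4 + a * h\<^sup>2 * e ^ 4] (mod l ^ Suc k)"
      using unit by blast
  qed
qed

lemma has_rat_pt_imp_everywhere_loc_sol:
  assumes "has_rat_pt a b"
  shows "everywhere_loc_sol a b"
proof -
  obtain M e N where *: "coprime M e" "N\<^sup>2 = a * M ^ 4 + b * e ^ 4"
    using has_rat_pt_coprime[OF assms] by blast
  have "has_real_pt a b"
    unfolding has_real_pt_def
  proof (intro exI conjI)
    show "(real_of_int M, real_of_int e) \<noteq> (0, 0)" using *(1) by auto
    show "(real_of_int N)\<^sup>2 = of_int a * of_int M ^ 4 + of_int b * of_int e ^ 4"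
      using *(2) by (metis of_int_add of_int_mult of_int_power)
  qed
  moreover have "has_local_pt l a b" if "prime l" for l
  proof -
    have "\<not> l dvd M \<or> \<not> l dvd e" using *(1) that by (meson coprime_common_divisor not_prime_unit)
    moreover have "[N\<^sup>2 = a * M ^ 4 + b * e ^ 4] (mod l ^ k)" for k by (simp add: *(2))
    ultimately show ?thesis unfolding has_local_pt_def by blast
  qed
  ultimately show ?thesis by (simp add: everywhere_loc_sol_def)
qed

lemma squarefree_dvd_power_imp_dvd:
  fixes b m :: int
  assumes "squarefree b" "b dvd m ^ n"
  shows "b dvd m"
proof (cases "m = 0")
  case False
  have b0: "b \<noteq> 0" using assms(1) by auto
  show ?thesis
  proof (rule multiplicity_le_imp_dvd[OF b0])
    fix r :: int
    assume r: "prime r"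
    show "multiplicity r b \<le> multiplicity r m"
    proof (cases "r dvd b")
      case True
      then have "r dvd m ^ n" using assms(2) dvd_trans by blast
      then have "r dvd m" using r prime_dvd_power by blast
      then have "multiplicity r m \<ge> 1" using r False by (metis One_nat_def Suc_leI multiplicity_gt_zero_iff not_prime_unit)
      moreover have "multiplicity r b \<le> 1"
        using assms(1) b0 r squarefree_factorial_semiring'' by blast
      ultimately show ?thesis by simp
    qed (simp add: not_dvd_imp_multiplicity_0)
  qed
qed simp

lemma has_local_pt_2I:
  assumes "odd M \<or> odd e" "a * M ^ 4 + b * e ^ 4 = h\<^sup>2 * u" "u mod 8 = 1"
  shows "has_local_pt 2 a b"
proof (rule has_local_ptI)
  fix k
  obtain y where "[y\<^sup>2 = u] (mod 2 ^ (k + 3))" using sqrt_mod_two_power[OF assms(3)] by blast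
  then have "[y\<^sup>2 = u] (mod 2 ^ Suc k)" by (rule cong_dvd_modulus) (simp add: power_add)
  then have "[h\<^sup>2 * y\<^sup>2 = h\<^sup>2 * u] (mod 2 ^ Suc k)" by (intro cong_mult cong_refl)
  then have "[(h * y)\<^sup>2 = a * M ^ 4 + b * e ^ 4] (mod 2 ^ Suc k)"
    by (simp add: assms(2) power_mult_distrib)
  then show "\<exists>M e N. (odd M \<or> odd e) \<and> [N\<^sup>2 = a * M ^ 4 + b * e ^ 4] (mod 2 ^ Suc k)"
    using assms(1) by blast
qed

lemma mod_8_mult_eq_7:
  fixes b \<gamma> :: int
  assumes "(b * \<gamma>) mod 8 = 7"
  shows "b mod 8 = 1 \<and> \<gamma> mod 8 = 7 \<or> b mod 8 = 7 \<and> \<gamma> mod 8 = 1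
    \<or> b mod 8 = 3 \<and> \<gamma> mod 8 = 5 \<or> b mod 8 = 5 \<and> \<gamma> mod 8 = 3"
proof -
  have "((b mod 8) * (\<gamma> mod 8)) mod 8 = 7" using assms by (simp add: mod_mult_eq)
  then show ?thesis
    using mod_8_cases[of b] mod_8_cases[of \<gamma>] by (elim disjE) simp_all
qed

context prime_pair
begin

section \<open>The group $S^{(\phi)}$\<close>

text \<open>If q divides b, both coefficients are q times a unit. Modulo q^2 this forces \<beta> M^4
  + \<gamma> e^4 = 0 modulo q with \<beta> \<gamma> = 16 p, which would make the non-residue -p a
  square unless q divides both e and M.\<close>

lemma phi_not_dvd_q:
  assumes b: "squarefree b" "b * c = 16 * p * q\<^sup>2" and loc: "has_local_pt q b c"
  shows "\<not> q dvd b"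
proof
  assume "q dvd b"
  then obtain \<beta> where \<beta>: "b = q * \<beta>" by (elim dvdE)
  have q\<beta>: "\<not> q dvd \<beta>"
  proof
    assume "q dvd \<beta>"
    then have "q\<^sup>2 dvd b" by (simp add: \<beta> power2_eq_square)
    then show False using squarefreeD[OF b(1)] q not_prime_unit by blast
  qed
  have "q * (\<beta> * c) = q * (16 * p * q)" using b(2) by (simp add: \<beta> power2_eq_square mult_ac)
  then have \<beta>c: "\<beta> * c = 16 * p * q" using q_gt_2 by (subst (asm) mult_left_cancel) simp_all
  then have "q dvd \<beta> * c" by simp
  then have "q dvd c" using q q\<beta> by (simp add: prime_dvd_mult_iff)
  then obtain \<gamma> where \<gamma>: "c = q * \<gamma>" by (elim dvdE)
  have "q * (\<beta> * \<gamma>) = q * (16 * p)" using \<beta>c by (simp add: \<gamma> mult_ac)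
  then have \<beta>\<gamma>: "\<beta> * \<gamma> = 16 * p" using q_gt_2 by (subst (asm) mult_left_cancel) simp_all
  obtain M e N where Me: "\<not> q dvd M \<or> \<not> q dvd e" and N: "[N\<^sup>2 = b * M ^ 4 + c * e ^ 4] (mod q\<^sup>2)"
    using loc unfolding has_local_pt_def by blast
  have N': "q\<^sup>2 dvd N\<^sup>2 - q * (\<beta> * M ^ 4 + \<gamma> * e ^ 4)"
    using N by (simp add: cong_iff_dvd_diff \<beta> \<gamma> algebra_simps)
  then have "q dvd N\<^sup>2 - q * (\<beta> * M ^ 4 + \<gamma> * e ^ 4)"
    by (rule dvd_trans[rotated]) (simp add: power2_eq_square)
  then have "q dvd N\<^sup>2" by (simp add: dvd_diff_left_iff)
  then have "q dvd N" using q prime_dvd_power by blast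
  then have "q\<^sup>2 dvd N\<^sup>2" by simp
  then have "q\<^sup>2 dvd q * (\<beta> * M ^ 4 + \<gamma> * e ^ 4)" using N' by (simp add: dvd_diff_right_iff)
  then have "q dvd \<beta> * M ^ 4 + \<gamma> * e ^ 4"
    using q_gt_2 by (simp add: power2_eq_square)
  then have v: "q dvd - \<beta> * (\<beta> * M ^ 4 + \<gamma> * e ^ 4)" by (rule dvd_mult)
  have "- p * (4 * e\<^sup>2)\<^sup>2 - (\<beta> * M\<^sup>2)\<^sup>2 = - (\<beta> * \<beta> * M ^ 4 + 16 * p * e ^ 4)"
    by (simp add: power2_eq_square power4_eq_xxxx)
  also have "\<dots> = - \<beta> * (\<beta> * M ^ 4 + \<gamma> * e ^ 4)" unfolding \<beta>\<gamma>[symmetric] by (simp add: algebra_simps)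
  finally have cg: "[- p * (4 * e\<^sup>2)\<^sup>2 = (\<beta> * M\<^sup>2)\<^sup>2] (mod q)"
    using v unfolding cong_iff_dvd_diff by (simp only:)
  have "q dvd e"
  proof (rule ccontr)
    assume "\<not> q dvd e"
    then have "\<not> q dvd 2 * 2 * e\<^sup>2" using not_dvd_pq q by (metis prime_dvd_mult_iff prime_dvd_power)
    then have "\<not> q dvd 4 * e\<^sup>2" by simp
    then have "QuadRes q (- p)" using QuadRes_divide[OF q _ cg] by blast
    moreover have "\<not> q dvd - p" using not_dvd_pq by simp
    ultimately have "Legendre (- p) q = 1" by (simp add: Legendre_eq_1_iff)
    then show False
      using Legendre_mult[OF q q_gt_2, of "- 1" p] Legendre_minus_one[OF q q_gt_2] pq q4 by simp
  qed
  then have "q dvd - p * (4 * e\<^sup>2)\<^sup>2" by (simp add: power2_eq_square)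
  then have "q dvd (\<beta> * M\<^sup>2)\<^sup>2" using cg cong_dvd_iff by blast
  then have "q dvd M" using q q\<beta> by (metis prime_dvd_mult_iff prime_dvd_power)
  then show False using Me \<open>q dvd e\<close> by blast
qed

text \<open>If b is even, the two terms have 2-adic valuations 1 and 3 modulo 4, so their sum has
  odd valuation and is no square. As M or e is odd, that valuation is at most 3 and modulus 32
  detects it.\<close>

lemma phi_odd:
  assumes b: "squarefree b" "b * c = 16 * p * q\<^sup>2" and loc: "has_local_pt 2 b c"
  shows "odd b"
proof
  assume "even b"
  then obtain \<beta> where \<beta>: "b = 2 * \<beta>" by (elim evenE)
  have \<beta>o: "odd \<beta>"
  proof
    assume "even \<beta>"
    then obtain j where "\<beta> = 2 * j" by (elim evenE)
    then have "2\<^sup>2 dvd b" by (simp add: \<beta>)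
    then have "is_unit (2 :: int)" using squarefreeD[OF b(1)] by blast
    then show False by simp
  qed
  have \<beta>c: "\<beta> * c = 8 * (p * q\<^sup>2)" using b(2) by (simp add: \<beta>)
  then have "8 dvd \<beta> * c" by simp
  moreover have "coprime 8 \<beta>" using \<beta>o coprime_power_left_iff[of 2 3 \<beta>] by simp
  ultimately have "8 dvd c" by (simp add: coprime_dvd_mult_right_iff)
  then obtain \<gamma> where \<gamma>: "c = 8 * \<gamma>" by (elim dvdE)
  have "\<beta> * \<gamma> = p * q\<^sup>2" using \<beta>c by (simp add: \<gamma>)
  moreover have "odd (p * q\<^sup>2)" using odd_pq by simp
  ultimately have \<gamma>o: "odd \<gamma>" by (metis even_mult_iff)
  obtain M e N where Me: "odd M \<or> odd e" and N: "[N\<^sup>2 = b * M ^ 4 + c * e ^ 4] (mod 2 ^ 5)"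
    using loc unfolding has_local_pt_def by blast
  then have N: "32 dvd N\<^sup>2 - (2 * \<beta> * M ^ 4 + 8 * \<gamma> * e ^ 4)"
    by (simp add: cong_iff_dvd_diff \<beta> \<gamma>)
  then have "even (N\<^sup>2 - (2 * \<beta> * M ^ 4 + 8 * \<gamma> * e ^ 4))"
    by (rule dvd_trans[rotated]) simp
  then have "even N" by simp
  then obtain n where n: "N = 2 * n" by (elim evenE)
  have "2 * 16 dvd 2 * (2 * n\<^sup>2 - \<beta> * M ^ 4 - 4 * \<gamma> * e ^ 4)"
    using N by (simp add: n power_mult_distrib algebra_simps)
  then have 16: "16 dvd 2 * n\<^sup>2 - \<beta> * M ^ 4 - 4 * \<gamma> * e ^ 4"
    by (subst (asm) dvd_times_left_cancel_iff) simp_all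
  then have "even (2 * n\<^sup>2 - \<beta> * M ^ 4 - 4 * \<gamma> * e ^ 4)" by (rule dvd_trans[rotated]) simp
  then have "even M" using \<beta>o by simp
  then obtain m where m: "M = 2 * m" by (elim evenE)
  have "2 * 8 dvd 2 * (n\<^sup>2 - 2 * \<gamma> * e ^ 4 - 8 * (\<beta> * m ^ 4))"
    using 16 by (simp add: m power_mult_distrib algebra_simps)
  then have "8 dvd n\<^sup>2 - 2 * \<gamma> * e ^ 4 - 8 * (\<beta> * m ^ 4)"
    by (subst (asm) dvd_times_left_cancel_iff) simp_all
  then have 8: "8 dvd n\<^sup>2 - 2 * \<gamma> * e ^ 4" by (simp add: dvd_diff_left_iff)
  then have "even (n\<^sup>2 - 2 * \<gamma> * e ^ 4)" by (rule dvd_trans[rotated]) simp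
  then have "even n" by simp
  then obtain j where j: "n = 2 * j" by (elim evenE)
  have "2 * 4 dvd 2 * (2 * j\<^sup>2 - \<gamma> * e ^ 4)" using 8 by (simp add: j power_mult_distrib algebra_simps)
  then have "4 dvd 2 * j\<^sup>2 - \<gamma> * e ^ 4" by (subst (asm) dvd_times_left_cancel_iff) simp_all
  then have "even (2 * j\<^sup>2 - \<gamma> * e ^ 4)" by (rule dvd_trans[rotated]) simp
  then have "even e" using \<gamma>o by simp
  then show False using Me \<open>even M\<close> by blast
qed

lemma Selmer_phi_eq_W_phi: "Selmer_phi p q = W_phi p q"
proof (intro equalityI subsetI)
  fix b assume "b \<in> W_phi p q"
  then show "b \<in> Selmer_phi p q"
    by (auto simp: W_phi_def Selmer_phi_def intro: has_rat_pt_imp_everywhere_loc_sol)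
next
  fix b assume "b \<in> Selmer_phi p q"
  then have b: "b \<noteq> 0" "squarefree b" "b dvd 16 * p * q\<^sup>2"
    and els: "everywhere_loc_sol b (16 * p * q\<^sup>2 div b)" by (auto simp: Selmer_phi_def)
  define c where "c = 16 * p * q\<^sup>2 div b"
  have bc: "b * c = 16 * p * q\<^sup>2" using b(3) by (simp add: c_def)
  have loc: "has_local_pt 2 b c" "has_local_pt q b c" and real: "has_real_pt b c"
    using els q by (auto simp: everywhere_loc_sol_def c_def)
  have bpos: "b > 0"
  proof (rule ccontr)
    assume "\<not> b > 0"
    then have neg: "b < 0" using b(1) by simp
    have "16 * p * q\<^sup>2 > 0" using p_gt_2 q_gt_2 by simp
    then have "b * c > 0" using bc by simp
    then have "c < 0" using neg by (simp add: zero_less_mult_iff)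
    obtain M e N :: real where nz: "(M, e) \<noteq> (0, 0)" and eq: "N\<^sup>2 = b * M ^ 4 + c * e ^ 4"
      using real by (auto simp: has_real_pt_def)
    have "b * M ^ 4 \<le> 0" "c * e ^ 4 \<le> 0" using neg \<open>c < 0\<close> by (simp_all add: mult_nonpos_nonneg)
    moreover have "b * M ^ 4 < 0 \<or> c * e ^ 4 < 0"
      using nz neg \<open>c < 0\<close> by (auto simp: mult_less_0_iff)
    ultimately have "N\<^sup>2 < 0" unfolding eq by linarith
    then show False by (simp add: not_less)
  qed
  have "coprime b 2" using phi_odd[OF b(2) bc loc(1)] by simp
  then have "coprime b 16" using coprime_power_right_iff[of b 2 4] by simp
  moreover have "coprime b q"
    using phi_not_dvd_q[OF b(2) bc loc(2)] q prime_imp_coprime coprime_commute by blast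
  then have "coprime b (q\<^sup>2)" by simp
  ultimately have "b dvd p"
    using b(3) by (simp add: coprime_dvd_mult_left_iff coprime_dvd_mult_right_iff)
  then have "b = 1 \<or> b = p" using p bpos by (auto simp: prime_int_iff)
  then have "has_rat_pt b (16 * p * q\<^sup>2 div b)"
  proof
    assume "b = 1"
    then show ?thesis by (intro has_rat_ptI[of 1 0 1]) simp_all
  next
    assume "b = p"
    have "16 * p * q\<^sup>2 div p = 16 * q\<^sup>2" using p_gt_2 by (simp add: mult.commute)
    then show ?thesis using \<open>b = p\<close>
      by (intro has_rat_ptI[of 0 1 "4 * q"]) (simp_all add: power_mult_distrib)
  qed
  then show "b \<in> W_phi p q" using b by (simp add: W_phi_def)
qed

section \<open>The group $S^{(\psi)}$\<close>

lemma pq2_mod_8: "(p * q\<^sup>2) mod 8 = 1"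
proof -
  have "[p * q\<^sup>2 = 1 * 1] (mod 8)"
    using p8 odd_square_mod_8[OF odd_pq(2)] by (intro cong_mult) (simp_all add: cong_def)
  then show ?thesis by (simp add: cong_def)
qed

lemma psi_local_2:
  assumes b: "b dvd 2 * p * q" and bc: "b * c = - (4 * p * q\<^sup>2)"
  shows "has_local_pt 2 b c"
proof (cases "odd b")
  case True
  have "coprime 4 b" using True coprime_power_left_iff[of 2 2 b] by simp
  moreover have "b * c = 4 * - (p * q\<^sup>2)" using bc by simp
  then have "4 dvd b * c" by (metis dvd_triv_left)
  ultimately have "4 dvd c" by (simp add: coprime_dvd_mult_right_iff)
  then obtain \<gamma> where \<gamma>: "c = 4 * \<gamma>" by (elim dvdE)
  have "4 * (b * \<gamma>) = b * c" by (simp add: \<gamma>)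
  also have "\<dots> = 4 * - (p * q\<^sup>2)" unfolding bc by simp
  finally have b\<gamma>: "b * \<gamma> = - (p * q\<^sup>2)" by (subst (asm) mult_left_cancel) simp_all
  have "(- k) mod 8 = 7" if "k mod 8 = 1" for k :: int using that by presburger
  from this[OF pq2_mod_8] have "(b * \<gamma>) mod 8 = 7" unfolding b\<gamma> .
  from mod_8_mult_eq_7[OF this] consider "b mod 8 = 1" | "\<gamma> mod 8 = 1" | "b mod 8 = 3" "\<gamma> mod 8 = 5" | "b mod 8 = 5" "\<gamma> mod 8 = 3"
    by blast
  then show ?thesis
  proof cases
    case 1
    then show ?thesis by (intro has_local_pt_2I[of 1 0 b c 1 b]) simp_all
  next
    case 2
    then show ?thesis by (intro has_local_pt_2I[of 0 1 b c 2 \<gamma>]) (simp_all add: \<gamma>)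
  next
    \<comment> \<open>In the last two cases neither coefficient gives a square. The point (2, 1) has
      value 4 (4 b + \<gamma>) and (1, 1) has value b + 4 \<gamma>; both cofactors are 17 = 1 modulo
      8.\<close>
    case 3
    then have "[4 * b + \<gamma> = 4 * 3 + 5] (mod 8)"
      by (intro cong_add cong_mult) (simp_all add: cong_def)
    then have "(4 * b + \<gamma>) mod 8 = 1" by (simp add: cong_def)
    then show ?thesis by (intro has_local_pt_2I[of 2 1 b c 2 "4 * b + \<gamma>"]) (simp_all add: \<gamma>)
  next
    case 4
    then have "[b + 4 * \<gamma> = 5 + 4 * 3] (mod 8)"
      by (intro cong_add cong_mult) (simp_all add: cong_def)
    then have "(b + 4 * \<gamma>) mod 8 = 1" by (simp add: cong_def)
    then show ?thesis by (intro has_local_pt_2I[of 1 1 b c 1 "b + 4 * \<gamma>"]) (simp_all add: \<gamma>)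
  qed
next
  case False
  then have "even b" by simp
  then obtain \<beta> where \<beta>: "b = 2 * \<beta>" by (elim evenE)
  have "2 * \<beta> dvd 2 * (p * q)" using b unfolding \<beta> mult.assoc .
  then have "\<beta> dvd p * q" by (subst (asm) dvd_times_left_cancel_iff) simp_all
  moreover have "odd (p * q)" using odd_pq by simp
  ultimately have \<beta>o: "odd \<beta>" using dvd_trans[of 2 \<beta> "p * q"] by blast
  have "2 * (\<beta> * c) = b * c" by (simp add: \<beta>)
  also have "\<dots> = 2 * (2 * - (p * q\<^sup>2))" unfolding bc by simp
  finally have \<beta>c: "\<beta> * c = 2 * - (p * q\<^sup>2)" by (subst (asm) mult_left_cancel) simp_all
  then have "even (\<beta> * c)" by (metis dvd_triv_left)
  then have "even c" using \<beta>o by simp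
  then obtain \<gamma> where \<gamma>: "c = 2 * \<gamma>" by (elim evenE)
  define D where "D = p * q\<^sup>2"
  have "2 * (\<beta> * \<gamma>) = 2 * - D" using \<beta>c unfolding \<gamma> D_def by (simp only: mult.left_commute)
  then have \<beta>\<gamma>: "\<beta> * \<gamma> = - D" by (subst (asm) mult_left_cancel) simp_all
  have "D mod 8 = 1" unfolding D_def by (rule pq2_mod_8)
  then have D16: "D mod 16 = 1 \<or> D mod 16 = 9" by (rule mod_8_eq_1_imp_mod_16)
  have "\<beta>\<^sup>2 mod 8 = 1" using \<beta>o by (rule odd_square_mod_8)
  then have \<beta>16: "\<beta>\<^sup>2 mod 16 = 1 \<or> \<beta>\<^sup>2 mod 16 = 9" by (rule mod_8_eq_1_imp_mod_16)
  have D\<beta>: "(D * \<beta>\<^sup>2) mod 16 = (if D mod 16 = \<beta>\<^sup>2 mod 16 then 1 else 9)"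
  proof -
    have "(D * \<beta>\<^sup>2) mod 16 = ((D mod 16) * (\<beta>\<^sup>2 mod 16)) mod 16" by (simp only: mod_mult_eq)
    then show ?thesis using D16 \<beta>16 by (elim disjE) (simp_all only:, simp_all)
  qed
  have 8: "(8 * \<beta>) mod 16 = 8" using \<beta>o by presburger
  have val: "b * v + c * \<beta> ^ 4 = 2 * \<beta> * (v - D * \<beta>\<^sup>2)" for v
  proof -
    have "b * v + c * \<beta> ^ 4 = 2 * \<beta> * (v + (\<beta> * \<gamma>) * \<beta>\<^sup>2)"
      by (simp add: \<beta> \<gamma> algebra_simps power2_eq_square power4_eq_xxxx)
    then show ?thesis by (simp add: \<beta>\<gamma>)
  qed
  \<comment> \<open>With e = \<beta> and N = 4 \<beta> t the equation becomes M^4 = D \<beta>^2 + 8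
    \<beta> t^2. Since D \<beta>^2 is 1 or 9 modulo 16, one of t = 0, 1 makes the right side 1
    modulo 16, a 2-adic fourth power.\<close>
  define t :: int where "t = (if D mod 16 = \<beta>\<^sup>2 mod 16 then 0 else 1)"
  have "(D * \<beta>\<^sup>2 + 8 * \<beta> * t\<^sup>2) mod 16 = 1"
  proof (cases "D mod 16 = \<beta>\<^sup>2 mod 16")
    case True
    then show ?thesis using D\<beta> by (simp add: t_def)
  next
    case False
    then have "[D * \<beta>\<^sup>2 + 8 * \<beta> = 9 + 8] (mod 16)"
      using D\<beta> 8 by (intro cong_add) (simp_all add: cong_def)
    then show ?thesis using False by (simp add: t_def cong_def)
  qed
  show ?thesis
  proof (rule has_local_ptI)
    fix k
    obtain y where y: "odd y" "[y ^ 4 = D * \<beta>\<^sup>2 + 8 * \<beta> * t\<^sup>2] (mod 2 ^ Suc k)"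
      using fourth_root_mod_two_power[OF \<open>(D * \<beta>\<^sup>2 + 8 * \<beta> * t\<^sup>2) mod 16 = 1\<close>] by blast
    then have "[b * y ^ 4 + c * \<beta> ^ 4 = b * (D * \<beta>\<^sup>2 + 8 * \<beta> * t\<^sup>2) + c * \<beta> ^ 4] (mod 2 ^ Suc k)"
      by (intro cong_add cong_mult cong_refl)
    also have "b * (D * \<beta>\<^sup>2 + 8 * \<beta> * t\<^sup>2) + c * \<beta> ^ 4 = (4 * \<beta> * t)\<^sup>2"
      unfolding val by (simp add: power2_eq_square)
    finally have "[(4 * \<beta> * t)\<^sup>2 = b * y ^ 4 + c * \<beta> ^ 4] (mod 2 ^ Suc k)" by (rule cong_sym)
    then show "\<exists>M e N. (odd M \<or> odd e) \<and> [N\<^sup>2 = b * M ^ 4 + c * e ^ 4] (mod 2 ^ Suc k)"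
      using y(1) by blast
  qed
qed

lemma prime_dvd_4pq2:
  assumes "prime r" "r dvd 4 * p * q\<^sup>2"
  shows "r = 2 \<or> r = p \<or> r = q"
proof -
  have "r dvd 2 * 2 * p * q\<^sup>2" using assms(2) by simp
  then have "r dvd 2 \<or> r dvd p \<or> r dvd q" using assms(1) by (metis prime_dvd_mult_iff prime_dvd_power)
  then show ?thesis using assms(1) p q primes_dvd_imp_eq two_is_prime by blast
qed

text \<open>All of -1, 2 and q are squares modulo p, so whichever coefficient is prime to p is a
  p-adic square.\<close>

lemma psi_local_p:
  assumes b: "b dvd 2 * p * q" and bc: "b * c = - (4 * p * q\<^sup>2)"
  shows "has_local_pt p b c"
proof -
  have *: "QuadRes p d" if "d dvd 4 * p * q\<^sup>2" "\<not> p dvd d" for d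
  proof -
    have "Legendre d p = 1"
    proof (rule Legendre_p_nonzero_eq_1[OF that(2)])
      fix r :: int
      assume "prime r" "odd r" "r \<noteq> q" "r dvd d"
      then have False using prime_dvd_4pq2 that dvd_trans by (metis dvd_refl)
      then show "QuadRes r p" ..
    qed
    then show ?thesis by (simp add: Legendre_eq_1_iff)
  qed
  have dvd: "b dvd 4 * p * q\<^sup>2" "c dvd 4 * p * q\<^sup>2"
    using bc by (metis dvd_minus_iff dvd_triv_left, metis dvd_minus_iff dvd_triv_right)
  show ?thesis
  proof (cases "p dvd b")
    case False
    then show ?thesis using has_local_pt_square_coeff(1)[OF p odd_pq(1)] * dvd by blast
  next
    case True
    then obtain \<beta> where \<beta>: "b = p * \<beta>" by (elim dvdE)
    have "p * (\<beta> * c) = p * - (4 * q\<^sup>2)" using bc by (simp add: \<beta>)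
    then have "\<beta> * c = - (2 * 2 * q\<^sup>2)" using p_gt_2 by (subst (asm) mult_left_cancel) simp_all
    then have "c dvd 2 * 2 * q\<^sup>2" by (metis dvd_minus_iff dvd_triv_right)
    moreover have "\<not> p dvd 2 * 2 * q\<^sup>2" using p not_dvd_pq by (metis prime_dvd_mult_iff prime_dvd_power)
    ultimately have "\<not> p dvd c" using dvd_trans by blast
    then have "has_local_pt p b (c * 1\<^sup>2)"
      using has_local_pt_square_coeff(2)[OF p odd_pq(1)] * dvd by blast
    then show ?thesis by simp
  qed
qed

text \<open>If q does not divide b, then c = q^2 \<gamma> and b \<gamma> = -4 p is a non-residue, so
  b or \<gamma> is a residue. If q divides b, there is a point with N = 0.\<close>

lemma psi_local_q:
  assumes b: "b dvd 2 * p * q" and bc: "b * c = - (4 * p * q\<^sup>2)"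
  shows "has_local_pt q b c"
proof (cases "q dvd b")
  case False
  have "q\<^sup>2 dvd b * c" unfolding bc by simp
  moreover have "coprime q b" using False q prime_imp_coprime by blast
  then have "coprime (q\<^sup>2) b" by simp
  ultimately have "q\<^sup>2 dvd c" by (simp add: coprime_dvd_mult_right_iff)
  then obtain \<gamma> where \<gamma>: "c = q\<^sup>2 * \<gamma>" by (elim dvdE)
  have "q\<^sup>2 * (b * \<gamma>) = q\<^sup>2 * - (4 * p)" using bc by (simp add: \<gamma> algebra_simps)
  then have b\<gamma>: "b * \<gamma> = - 1 * (2\<^sup>2 * p)" using q_gt_2 by (subst (asm) mult_left_cancel) simp_all
  have "Legendre b q * Legendre \<gamma> q = Legendre (- 1) q * (Legendre (2\<^sup>2) q * Legendre p q)"
    using Legendre_mult[OF q q_gt_2] b\<gamma> by metis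
  also have "\<dots> = - 1"
    using Legendre_minus_one[OF q q_gt_2] q4 Legendre_square[OF not_dvd_pq(4) q] pq by simp
  finally have "Legendre b q = 1 \<or> Legendre \<gamma> q = 1"
    using Legendre_cases[of b q] Legendre_cases[of \<gamma> q] by auto
  then show ?thesis
  proof
    assume "Legendre b q = 1"
    then show ?thesis using has_local_pt_square_coeff(1)[OF q odd_pq(2)] by (simp add: Legendre_eq_1_iff)
  next
    assume "Legendre \<gamma> q = 1"
    then have "has_local_pt q b (\<gamma> * q\<^sup>2)"
      using has_local_pt_square_coeff(2)[OF q odd_pq(2)] by (simp add: Legendre_eq_1_iff)
    then show ?thesis by (simp add: \<gamma> mult.commute)
  qed
next
  case True
  then obtain \<beta> where \<beta>: "b = q * \<beta>" by (elim dvdE)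
  have "q * \<beta> dvd q * (2 * p)" using b by (simp add: \<beta> mult.commute mult.left_commute)
  then have "\<beta> dvd 2 * p" using q_gt_2 by simp
  moreover have "\<not> q dvd 2 * p" using q not_dvd_pq by (simp add: prime_dvd_mult_iff)
  ultimately have q\<beta>: "\<not> q dvd \<beta>" using dvd_trans by blast
  have "q * (\<beta> * c) = q * (q * - (4 * p))" using bc by (simp add: \<beta> power2_eq_square mult_ac)
  then have \<beta>c: "\<beta> * c = q * - (4 * p)" using q_gt_2 by (subst (asm) mult_left_cancel) simp_all
  then have "q dvd \<beta> * c" by (metis dvd_triv_left)
  then have "q dvd c" using q q\<beta> by (simp add: prime_dvd_mult_iff)
  then obtain \<gamma> where \<gamma>: "c = q * \<gamma>" by (elim dvdE)
  have "q * (\<beta> * \<gamma>) = q * - (4 * p)" using \<beta>c by (simp add: \<gamma> algebra_simps)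
  then have \<beta>\<gamma>: "\<beta> * \<gamma> = - (4 * p)" using q_gt_2 by (subst (asm) mult_left_cancel) simp_all
  \<comment> \<open>With e = \<beta> and \<beta> \<gamma> = -4 p, the equation with N = 0 is M^4 = p
    (2 \<beta>)^2. Its right side is a square modulo q, hence a q-adic fourth power.\<close>
  have QR: "QuadRes q (p * (2 * \<beta>)\<^sup>2)"
  proof (rule QuadRes_mult)
    show "QuadRes q p" by (rule QuadRes_p)
    show "QuadRes q ((2 * \<beta>)\<^sup>2)" unfolding QuadRes_def using cong_refl by blast
  qed
  have nd: "\<not> q dvd p * (2 * \<beta>)\<^sup>2"
    using q not_dvd_pq q\<beta> by (metis prime_dvd_mult_iff prime_dvd_power)
  show ?thesis
  proof (rule has_local_ptI)
    fix k
    obtain y where "[y ^ 4 = p * (2 * \<beta>)\<^sup>2] (mod q ^ Suc k)"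
      using fourth_root_3_mod_4[OF q q4 nd QR] by blast
    then have "[b * y ^ 4 + c * \<beta> ^ 4 = b * (p * (2 * \<beta>)\<^sup>2) + c * \<beta> ^ 4] (mod q ^ Suc k)"
      by (intro cong_add cong_mult cong_refl)
    also have "b * (p * (2 * \<beta>)\<^sup>2) + c * \<beta> ^ 4 = q * \<beta> ^ 3 * (4 * p + \<beta> * \<gamma>)"
      by (simp add: \<beta> \<gamma> algebra_simps power2_eq_square power3_eq_cube power4_eq_xxxx)
    also have "\<dots> = 0\<^sup>2" by (simp add: \<beta>\<gamma>)
    finally have "[0\<^sup>2 = b * y ^ 4 + c * \<beta> ^ 4] (mod q ^ Suc k)" by (rule cong_sym)
    then show "\<exists>M e N. (\<not> q dvd M \<or> \<not> q dvd e) \<and> [N\<^sup>2 = b * M ^ 4 + c * e ^ 4] (mod q ^ Suc k)"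
      using q\<beta> by blast
  qed
qed

lemma psi_everywhere_loc_sol:
  assumes b: "b dvd 2 * p * q" and bc: "b * c = - (4 * p * q\<^sup>2)"
  shows "everywhere_loc_sol b c"
  unfolding everywhere_loc_sol_def
proof (intro conjI allI impI)
  have "4 * p * q\<^sup>2 > 0" using p_gt_2 q_gt_2 by simp
  then have "b * c < 0" using bc by simp
  then consider "b > 0" | "c > 0" by (auto simp: mult_less_0_iff)
  then show "has_real_pt b c"
  proof cases
    case 1
    then show ?thesis unfolding has_real_pt_def
      by (intro exI[of _ 1] exI[of _ 0] exI[of _ "sqrt b"]) simp
  next
    case 2
    then show ?thesis unfolding has_real_pt_def
      by (intro exI[of _ 0] exI[of _ 1] exI[of _ "sqrt c"]) simp
  qed
  fix l :: int
  assume l: "prime l"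
  show "has_local_pt l b c"
  proof (cases "l dvd 4 * p * q\<^sup>2")
    case True
    then show ?thesis using prime_dvd_4pq2[OF l] psi_local_2 psi_local_p psi_local_q assms by blast
  next
    case False
    then have "\<not> l dvd b * c" unfolding bc by simp
    then have "\<not> l dvd b" "\<not> l dvd c" by auto
    moreover have "odd l" using False prime_odd_or_two[OF l] by auto
    ultimately show ?thesis using has_local_pt_good_prime[OF l] by blast
  qed
qed

lemma dvd_4pq2: "b dvd 2 * p * q \<Longrightarrow> b dvd - 4 * p * q\<^sup>2"
proof -
  assume "b dvd 2 * p * q"
  then have "b dvd 2 * p * q * (- 2 * q)" by (rule dvd_mult2)
  moreover have "2 * p * q * (- 2 * q) = - 4 * p * q\<^sup>2" by (simp add: power2_eq_square)
  ultimately show ?thesis by (simp only:)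
qed

lemma squarefree_dvd_iff:
  "b \<noteq> 0 \<and> squarefree b \<and> b dvd - 4 * p * q\<^sup>2 \<longleftrightarrow> b dvd 2 * p * q"
proof (intro iffI conjI)
  assume b: "b \<noteq> 0 \<and> squarefree b \<and> b dvd - 4 * p * q\<^sup>2"
  then have "b dvd - 4 * p * q\<^sup>2 * - p" using dvd_mult2 by blast
  also have "- 4 * p * q\<^sup>2 * - p = (2 * p * q)\<^sup>2" by (simp add: power2_eq_square)
  finally show "b dvd 2 * p * q" using b squarefree_dvd_power_imp_dvd by blast
next
  assume b: "b dvd 2 * p * q"
  show "b \<noteq> 0" using b p_gt_2 q_gt_2 by auto
  show "b dvd - 4 * p * q\<^sup>2" using b by (rule dvd_4pq2)
  have "squarefree (2 * p * q)"
  proof (intro squarefree_mult_coprime)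
    show "coprime (2 * p) q" using not_dvd_pq p q p_ne_q odd_pq
      by (metis coprime_mult_left_iff coprime_left_2_iff_odd primes_coprime)
    show "coprime 2 p" using odd_pq by simp
  qed (use p q in \<open>simp_all add: squarefree_prime\<close>)
  then show "squarefree b" using b squarefree_mono by blast
qed

lemma Selmer_psi_eq: "Selmer_psi p q = {b. b dvd 2 * p * q}"
proof -
  have "everywhere_loc_sol b (- (4 * p * q\<^sup>2) div b)" if b: "b dvd 2 * p * q" for b
  proof (rule psi_everywhere_loc_sol[OF b])
    have "b dvd - (4 * p * q\<^sup>2)" using dvd_4pq2[OF b] by simp
    then show "b * (- (4 * p * q\<^sup>2) div b) = - (4 * p * q\<^sup>2)" by simp
  qed
  then show ?thesis unfolding Selmer_psi_def using squarefree_dvd_iff by blast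
qed

lemma W_psi_eq: "W_psi p q = {b. b dvd 2 * p * q \<and> has_rat_pt b (- (4 * p * q\<^sup>2) div b)}"
  unfolding W_psi_def using squarefree_dvd_iff by blast

section \<open>Counting classes\<close>

definition W0 :: "int set" where
  "W0 = {b. b dvd 2 * q \<and> has_rat_pt b (- (4 * p * q\<^sup>2) div b)}"

lemma divisors_2q: "{b. b dvd 2 * q} = {1, - 1, 2, - 2, q, - q, 2 * q, - (2 * q)}"
proof (intro equalityI subsetI)
  fix b assume "b \<in> {b. b dvd 2 * q}"
  then obtain u v where b: "b = u * v" "u dvd 2" "v dvd q" using division_decomp[of b 2 q] by blast
  have u: "u = 1 \<or> u = - 1 \<or> u = 2 \<or> u = - 2"
  proof -
    have "\<bar>u\<bar> \<le> 2" using b(2) dvd_imp_le_int[of 2 u] by simp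
    moreover have "u \<noteq> 0" using b(2) by auto
    ultimately show ?thesis by auto
  qed
  have "\<bar>v\<bar> = 1 \<or> \<bar>v\<bar> = q" using q b(3) by (auto simp: prime_int_iff)
  then have v: "v = 1 \<or> v = - 1 \<or> v = q \<or> v = - q" by auto
  show "b \<in> {1, - 1, 2, - 2, q, - q, 2 * q, - (2 * q)}" using u v unfolding b(1) by (elim disjE) simp_all
qed auto

lemma divisors_2pq: "{b. b dvd 2 * p * q} = {b. b dvd 2 * q} \<union> (\<lambda>b. - p * b) ` {b. b dvd 2 * q}"
proof (intro equalityI subsetI)
  fix b assume "b \<in> {b. b dvd 2 * p * q}"
  then have b: "b dvd p * (2 * q)" by (simp add: mult_ac)
  show "b \<in> {b. b dvd 2 * q} \<union> (\<lambda>b. - p * b) ` {b. b dvd 2 * q}"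
  proof (cases "p dvd b")
    case False
    then have "coprime b p" using p prime_imp_coprime coprime_commute by blast
    then have "b dvd 2 * q" using b by (simp add: coprime_dvd_mult_right_iff)
    then show ?thesis by simp
  next
    case True
    then obtain \<beta> where \<beta>: "b = p * \<beta>" by (elim dvdE)
    have "\<beta> dvd 2 * q" using b p_gt_2 unfolding \<beta> by simp
    then have "- \<beta> dvd 2 * q" by simp
    moreover have "b = - p * - \<beta>" by (simp add: \<beta>)
    ultimately show ?thesis by blast
  qed
next
  fix b assume "b \<in> {b. b dvd 2 * q} \<union> (\<lambda>b. - p * b) ` {b. b dvd 2 * q}"
  then obtain \<beta> where "\<beta> dvd 2 * q" "b = \<beta> \<or> b = - p * \<beta>" by blast
  then have "b dvd p * (2 * q)" by auto
  then show "b \<in> {b. b dvd 2 * p * q}" by (simp add: mult_ac)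
qed

lemma p_not_dvd_divisor: "b dvd 2 * q \<Longrightarrow> \<not> p dvd b"
proof
  assume "b dvd 2 * q" "p dvd b"
  then have "p dvd 2 * q" using dvd_trans by blast
  then show False using p not_dvd_pq by (simp add: prime_dvd_mult_iff)
qed

lemma card_union_twist:
  assumes "A \<subseteq> {b. b dvd 2 * q}"
  shows "card (A \<union> (\<lambda>b. - p * b) ` A) = 2 * card A"
proof -
  have "finite {b. b dvd 2 * q}" unfolding divisors_2q by simp
  then have fin: "finite A" using assms finite_subset by blast
  have "A \<inter> (\<lambda>b. - p * b) ` A = {}" using assms p_not_dvd_divisor by fastforce
  then have "card (A \<union> (\<lambda>b. - p * b) ` A) = card A + card ((\<lambda>b. - p * b) ` A)"
    using fin by (intro card_Un_disjoint) auto
  also have "card ((\<lambda>b. - p * b) ` A) = card A"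
    using p_gt_2 by (intro card_image) (auto simp: inj_on_def)
  finally show ?thesis by simp
qed

lemma card_Selmer_psi: "card (Selmer_psi p q) = 16"
proof -
  have "card {b. b dvd 2 * q} = 8"
  proof -
    have "q \<noteq> 4" using q4 by auto
    then show ?thesis unfolding divisors_2q using q_gt_2 by simp
  qed
  then show ?thesis unfolding Selmer_psi_eq divisors_2pq card_union_twist[OF subset_refl] by simp
qed

text \<open>Writing -4 p q^2 = -p (b h)^2 brings the curves of b and -p b into the shape that
  \<open>has_rat_pt_swap\<close> exchanges.\<close>

lemma cofactor:
  assumes "b dvd 2 * q"
  obtains h where "h \<noteq> 0" "b * h = 2 * q" "- (4 * p * q\<^sup>2) div b = - p * b * h\<^sup>2"
    "- (4 * p * q\<^sup>2) div (- p * b) = b * h\<^sup>2"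
proof -
  obtain h where h: "2 * q = b * h" using assms by (elim dvdE)
  have b0: "b \<noteq> 0" "h \<noteq> 0" using h q_gt_2 by auto
  have "- (4 * p * q\<^sup>2) = - p * (2 * q)\<^sup>2" by (simp add: power2_eq_square)
  also have "\<dots> = b * (- p * b * h\<^sup>2)" unfolding h by (simp add: power2_eq_square)
  finally have e: "- (4 * p * q\<^sup>2) = b * (- p * b * h\<^sup>2)" .
  also have "\<dots> = (- p * b) * (b * h\<^sup>2)" by simp
  finally have e': "- (4 * p * q\<^sup>2) = (- p * b) * (b * h\<^sup>2)" .
  have "- (4 * p * q\<^sup>2) div b = - p * b * h\<^sup>2"
    unfolding e using b0(1) by (rule nonzero_mult_div_cancel_left)
  moreover have "- (4 * p * q\<^sup>2) div (- p * b) = b * h\<^sup>2"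
    unfolding e' using b0 p_gt_2 by (intro nonzero_mult_div_cancel_left) auto
  ultimately show ?thesis using that[OF b0(2) h[symmetric]] by blast
qed

lemma W_psi_twist: "W_psi p q = W0 \<union> (\<lambda>b. - p * b) ` W0"
proof -
  have iff: "has_rat_pt (- p * b) (- (4 * p * q\<^sup>2) div (- p * b)) \<longleftrightarrow>
      has_rat_pt b (- (4 * p * q\<^sup>2) div b)" if b: "b dvd 2 * q" for b
  proof -
    obtain h where h: "h \<noteq> 0" "- (4 * p * q\<^sup>2) div b = - p * b * h\<^sup>2"
      "- (4 * p * q\<^sup>2) div (- p * b) = b * h\<^sup>2"
      using cofactor[OF b] by blast
    show ?thesis unfolding h(2,3) using has_rat_pt_swap[OF _ h(1)] by blast
  qed
  have "b \<in> W_psi p q \<longleftrightarrow> b \<in> W0 \<union> (\<lambda>b. - p * b) ` W0" for b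
  proof -
    have "b \<in> W_psi p q \<longleftrightarrow> b \<in> {b. b dvd 2 * q} \<union> (\<lambda>b. - p * b) ` {b. b dvd 2 * q}
        \<and> has_rat_pt b (- (4 * p * q\<^sup>2) div b)"
      unfolding W_psi_eq divisors_2pq[symmetric] by simp
    also have "\<dots> \<longleftrightarrow> b \<in> W0 \<union> (\<lambda>b. - p * b) ` W0"
      unfolding W0_def using iff by blast
    finally show ?thesis .
  qed
  then show ?thesis by blast
qed

lemma card_W_psi: "card (W_psi p q) = 2 * card W0"
  unfolding W_psi_twist by (rule card_union_twist) (auto simp: W0_def)

section \<open>Bounding the rational classes modulo the class of -p\<close>

lemma one_in_W0: "1 \<in> W0"
  unfolding W0_def by (auto intro!: has_rat_ptI[of 1 0 1])

text \<open>Multiplying the class -1 by -p leads to the class p, whose curve is the one in part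
  (i).\<close>

lemma minus_one_not_in_W0:
  assumes "\<not> (quartic_sym 2 p = 1 \<and> quartic_sym q p = 1)"
  shows "- 1 \<notin> W0"
proof
  assume "- 1 \<in> W0"
  then have "has_rat_pt (- 1) (- (4 * p * q\<^sup>2) div - 1)" by (simp only: W0_def mem_Collect_eq)
  moreover have "- (4 * p * q\<^sup>2) div - 1 = p * (2 * q)\<^sup>2" by (simp add: power2_eq_square)
  ultimately have "has_rat_pt (- 1) (p * (2 * q)\<^sup>2)" by (simp only:)
  then have "has_rat_pt p (- 1 * (2 * q)\<^sup>2)" by (rule has_rat_pt_swap) (use q_gt_2 in simp)
  moreover have "- 1 * (2 * q)\<^sup>2 = - (4 * q\<^sup>2)" by (simp add: power_mult_distrib)
  ultimately have "has_rat_pt p (- (4 * q\<^sup>2))" by (simp only:)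
  then show False using quartic_of_rational_point assms by blast
qed

lemma W0_imp_quartic:
  assumes "b \<in> W0"
  shows "[b ^ nat ((p - 1) div 4) = 1] (mod p)"
proof -
  have b: "b dvd 2 * q" and rat: "has_rat_pt b (- (4 * p * q\<^sup>2) div b)" using assms by (auto simp: W0_def)
  obtain h where h: "b * h = 2 * q" "- (4 * p * q\<^sup>2) div b = - p * b * h\<^sup>2"
    using cofactor[OF b] by blast
  obtain M e N where Me: "coprime M e" and eq: "N\<^sup>2 = b * M ^ 4 + - p * b * h\<^sup>2 * e ^ 4"
    using has_rat_pt_coprime[OF rat[unfolded h(2)]] by blast
  have "h dvd 2 * q" using h(1) by (metis dvd_triv_right)
  then have pb: "\<not> p dvd b" "\<not> p dvd h" using b p_not_dvd_divisor by blast+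
  have pM: "\<not> p dvd M"
  proof
    assume "p dvd M"
    then obtain m where m: "M = p * m" by (elim dvdE)
    have "p dvd N\<^sup>2" unfolding eq m by (simp add: power4_eq_xxxx)
    then have "p dvd N" using p prime_dvd_power by blast
    then obtain n where n: "N = p * n" by (elim dvdE)
    have "b * h\<^sup>2 * e ^ 4 * p = p * p * (b * p * p * m ^ 4 - n\<^sup>2)"
      using eq unfolding m n by (simp add: power2_eq_square power4_eq_xxxx algebra_simps)
    then have "p * (b * h\<^sup>2 * e ^ 4) = p * (p * (b * p * p * m ^ 4 - n\<^sup>2))" by (simp only: mult_ac)
    then have "b * h\<^sup>2 * e ^ 4 = p * (b * p * p * m ^ 4 - n\<^sup>2)"
      using p_gt_2 by (subst (asm) mult_left_cancel) simp_all
    then have "p dvd b * h\<^sup>2 * e ^ 4" by simp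
    then have "p dvd e" using p pb by (metis prime_dvd_mult_iff prime_dvd_power)
    then show False using Me \<open>p dvd M\<close> p by (meson coprime_common_divisor not_prime_unit)
  qed
  have diff: "N\<^sup>2 - b * (M\<^sup>2)\<^sup>2 = p * (- b * h\<^sup>2 * e ^ 4)"
    unfolding eq fourth_power_eq_square[symmetric] by simp
  then have cg: "[N\<^sup>2 = b * (M\<^sup>2)\<^sup>2] (mod p)" unfolding cong_iff_dvd_diff by simp
  have pN: "\<not> p dvd N"
  proof
    assume "p dvd N"
    then have "p dvd N\<^sup>2" by (simp add: power2_eq_square)
    then have "p dvd b * (M\<^sup>2)\<^sup>2" using cg cong_dvd_iff by blast
    then show False using p pb pM by (metis prime_dvd_mult_iff prime_dvd_power)
  qed
  have "Legendre N p = 1"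
  proof (rule Legendre_p_nonzero_eq_1[OF pN])
    fix r :: int
    assume r: "prime r" "odd r" "r \<noteq> q" "r dvd N"
    have r2q: "\<not> r dvd 2 * q"
      using r q primes_dvd_imp_eq[of r 2] primes_dvd_imp_eq[of r q] by (auto simp: prime_dvd_mult_iff)
    then have rbh: "\<not> r dvd b" "\<not> r dvd h" unfolding h(1)[symmetric] by auto
    have rN: "r dvd N\<^sup>2" using r by (simp add: power2_eq_square)
    have re: "\<not> r dvd e"
    proof
      assume "r dvd e"
      then have "r dvd - p * b * h\<^sup>2 * e ^ 4" by (simp add: power4_eq_xxxx)
      then have "r dvd b * M ^ 4" using rN unfolding eq by (simp only: dvd_add_left_iff)
      then have "r dvd M" using r(1) rbh by (metis prime_dvd_mult_iff prime_dvd_power)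
      then show False using Me \<open>r dvd e\<close> r(1) by (meson coprime_common_divisor not_prime_unit)
    qed
    \<comment> \<open>Multiplying the curve equation by -b makes one term a square and the other p
      times a square; modulo r the left factor N^2 vanishes.\<close>
    have "p * (b * h * e\<^sup>2)\<^sup>2 - (b * M\<^sup>2)\<^sup>2 = - b * (b * M ^ 4 + - p * b * h\<^sup>2 * e ^ 4)"
      by (simp add: power2_eq_square power4_eq_xxxx algebra_simps)
    also have "\<dots> = - b * N\<^sup>2" unfolding eq ..
    finally have "[p * (b * h * e\<^sup>2)\<^sup>2 = (b * M\<^sup>2)\<^sup>2] (mod r)"
      using rN unfolding cong_iff_dvd_diff by (simp only: dvd_mult)
    moreover have "\<not> r dvd b * h * e\<^sup>2" using r(1) rbh re by (metis prime_dvd_mult_iff prime_dvd_power)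
    ultimately show "QuadRes r p" using QuadRes_divide r(1) by blast
  qed
  moreover have "Legendre (M\<^sup>2) p = 1" by (rule Legendre_square[OF pM p])
  ultimately show ?thesis using quartic_power_Legendre[OF p p4 cg] by simp
qed

text \<open>If both $x$ and $-x$ were classes of points $(X_1, Y_1)$ and $(X_2, Y_2)$ of
  $Y^2 = X^3 - 4 p q^2 X$, the third point on the line through them would have class $-1$.\<close>

lemma not_both_in_W0:
  assumes m1: "- 1 \<notin> W0" and x: "x = 2 \<or> x = q \<or> x = 2 * q"
  shows "\<not> (x \<in> W0 \<and> - x \<in> W0)"
proof
  assume W: "x \<in> W0 \<and> - x \<in> W0"
  have x0: "x > 0" using x q_gt_2 by auto
  have xnsq: "n\<^sup>2 \<noteq> x" for n :: int
  proof
    assume n: "n\<^sup>2 = x"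
    have "x dvd 2 * p * q" using x by auto
    then have "squarefree x" using squarefree_dvd_iff by blast
    then have "is_unit n" using squarefreeD[of x n] n by simp
    then have "x = 1" using n by (auto simp: zdvd1_eq abs_if split: if_splits)
    then show False using x q_gt_2 by auto
  qed
  obtain h where h: "h \<noteq> 0" "x * h = 2 * q" "- (4 * p * q\<^sup>2) div x = - p * x * h\<^sup>2"
    using cofactor[of x] W unfolding W0_def by (metis mem_Collect_eq)
  have c2: "- (4 * p * q\<^sup>2) div - x = p * x * h\<^sup>2"
  proof -
    have "- (4 * p * q\<^sup>2) = - (p * (x * h)\<^sup>2)" unfolding h(2) by (simp add: power_mult_distrib)
    also have "\<dots> = (- x) * (p * x * h\<^sup>2)" by (simp add: power2_eq_square mult_ac)
    finally show ?thesis using x0 by (simp only:) (rule nonzero_mult_div_cancel_left, simp)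
  qed
  have r1: "has_rat_pt x (- p * x * h\<^sup>2)" and r2: "has_rat_pt (- x) (p * x * h\<^sup>2)"
    using W h(3) c2 unfolding W0_def by simp_all
  obtain M1 e1 N1 where 1: "coprime M1 e1" "N1\<^sup>2 = x * M1 ^ 4 + - p * x * h\<^sup>2 * e1 ^ 4"
    using has_rat_pt_coprime[OF r1] by blast
  obtain M2 e2 N2 where 2: "coprime M2 e2" "N2\<^sup>2 = - x * M2 ^ 4 + p * x * h\<^sup>2 * e2 ^ 4"
    using has_rat_pt_coprime[OF r2] by blast
  have pxh: "p * x * h\<^sup>2 > 0" using p_gt_2 x0 h(1) by simp
  \<comment> \<open>Points with e = 0 or M = 0 map to infinity or to (0, 0). They are excluded by
    sign, by x not being a square, or by the odd power of p in p x h^2.\<close>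
  have e1: "e1 \<noteq> 0"
  proof
    assume "e1 = 0"
    then have "M1 ^ 4 = 1" using 1(1) by (auto simp: power4_eq_xxxx zdvd1_eq abs_if split: if_splits)
    then have "N1\<^sup>2 = x" using 1(2) \<open>e1 = 0\<close> by simp
    then show False using xnsq by blast
  qed
  have M1: "M1 \<noteq> 0"
  proof
    assume "M1 = 0"
    then have "N1\<^sup>2 = - (p * x * h\<^sup>2 * e1 ^ 4)" using 1(2) by simp
    moreover have "p * x * h\<^sup>2 * e1 ^ 4 > 0" using pxh e1 by simp
    ultimately show False by (smt (verit) zero_le_power2)
  qed
  have e2: "e2 \<noteq> 0"
  proof
    assume "e2 = 0"
    then have "M2 \<noteq> 0" using 2(1) by auto
    then have "x * M2 ^ 4 > 0" using x0 by simp
    moreover have "N2\<^sup>2 = - (x * M2 ^ 4)" using 2(2) \<open>e2 = 0\<close> by simp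
    ultimately show False by (smt (verit) zero_le_power2)
  qed
  have M2: "M2 \<noteq> 0"
  proof
    assume "M2 = 0"
    then have "e2 ^ 4 = 1" using 2(1) by (auto simp: power4_eq_xxxx zdvd1_eq abs_if split: if_splits)
    then have N2: "N2\<^sup>2 = p * (x * h\<^sup>2)" using 2(2) \<open>M2 = 0\<close> by simp
    then have "p dvd N2" using p by (metis dvd_triv_left prime_dvd_power)
    then obtain n where "N2 = p * n" by (elim dvdE)
    then have "p * (p * n\<^sup>2) = p * (x * h\<^sup>2)" using N2 by (simp add: power2_eq_square mult_ac)
    then have "p * n\<^sup>2 = x * h\<^sup>2" using p_gt_2 by (subst (asm) mult_left_cancel) simp_all
    then have "p dvd x * h\<^sup>2" by (metis dvd_triv_left)
    then have "p dvd x \<or> p dvd h" using p by (metis prime_dvd_mult_iff prime_dvd_power)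
    then have "p dvd 2 * q" using h(2) by (metis dvd_mult2 dvd_mult)
    then show False using p not_dvd_pq by (simp add: prime_dvd_mult_iff)
  qed
  define C :: rat where "C = - of_int (p * (x * h)\<^sup>2)"
  define a1 n1 a2 n2 :: rat where "a1 = of_int M1 / of_int e1" and "n1 = of_int N1 / (of_int e1)\<^sup>2"
    and "a2 = of_int M2 / of_int e2" and "n2 = of_int N2 / (of_int e2)\<^sup>2"
  have n1: "n1\<^sup>2 = of_int x * a1 ^ 4 + C / of_int x"
  proof -
    have "(of_int N1 :: rat)\<^sup>2 = of_int x * of_int M1 ^ 4 - of_int p * of_int x * (of_int h)\<^sup>2 * of_int e1 ^ 4"
      using arg_cong[OF 1(2), of "of_int :: int \<Rightarrow> rat"] by simp
    then show ?thesis using e1 x0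
      by (simp add: n1_def a1_def C_def field_simps power2_eq_square power4_eq_xxxx)
  qed
  have n2: "n2\<^sup>2 = - of_int x * a2 ^ 4 - C / of_int x"
  proof -
    have "(of_int N2 :: rat)\<^sup>2 = - of_int x * of_int M2 ^ 4 + of_int p * of_int x * (of_int h)\<^sup>2 * of_int e2 ^ 4"
      using arg_cong[OF 2(2), of "of_int :: int \<Rightarrow> rat"] by simp
    then show ?thesis using e2 x0
      by (simp add: n2_def a2_def C_def field_simps power2_eq_square power4_eq_xxxx)
  qed
  have a0: "a1 \<noteq> 0" "a2 \<noteq> 0" using M1 M2 e1 e2 by (simp_all add: a1_def a2_def)
  \<comment> \<open>The covering map (a, n) -> (x a^2, x a n) onto the elliptic curve with C = -4 p
    q^2. The opposite signs of X1 and X2 guarantee distinct abscissas.\<close>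
  define X1 Y1 X2 Y2 where "X1 = of_int x * a1\<^sup>2" and "Y1 = of_int x * a1 * n1"
    and "X2 = - of_int x * a2\<^sup>2" and "Y2 = - of_int x * a2 * n2"
  have rx: "(of_int x :: rat) > 0" using x0 by simp
  have Xs: "X1 > 0" "X2 < 0" using rx a0 by (simp_all add: X1_def X2_def)
  have E1: "Y1\<^sup>2 = X1 ^ 3 + C * X1"
  proof -
    have "Y1\<^sup>2 = (of_int x)\<^sup>2 * a1\<^sup>2 * n1\<^sup>2" by (simp add: Y1_def power_mult_distrib)
    also have "\<dots> = X1 ^ 3 + C * X1" unfolding n1 X1_def using rx
      by (simp add: field_simps power2_eq_square power3_eq_cube power4_eq_xxxx)
    finally show ?thesis .
  qed
  have E2: "Y2\<^sup>2 = X2 ^ 3 + C * X2"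
  proof -
    have "Y2\<^sup>2 = (of_int x)\<^sup>2 * a2\<^sup>2 * n2\<^sup>2" by (simp add: Y2_def power_mult_distrib)
    also have "\<dots> = X2 ^ 3 + C * X2" unfolding n2 X2_def using rx
      by (simp add: field_simps power2_eq_square power3_eq_cube power4_eq_xxxx)
    finally show ?thesis .
  qed
  have "X1 \<noteq> X2" using Xs by simp
  define m where "m = (Y2 - Y1) / (X2 - X1)"
  define c where "c = Y1 - m * X1"
  define X3 where "X3 = m\<^sup>2 - X1 - X2"
  have L: "X1 * X2 * X3 = c\<^sup>2" "(m * X3 + c)\<^sup>2 = X3 ^ 3 + C * X3"
    using third_point_on_line[OF \<open>X1 \<noteq> X2\<close> E1 E2] by (simp_all add: m_def c_def X3_def)
  \<comment> \<open>If c = 0, the line passes through (0, 0) and X1 X2 = C. Since X1 X2 is minus a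
    square, p would be a rational square.\<close>
  have c0: "c \<noteq> 0"
  proof
    assume "c = 0"
    then have "X3 = 0" using L(1) Xs by simp
    then have "m\<^sup>2 = X1 + X2" by (simp add: X3_def)
    moreover have "Y1 = m * X1" using \<open>c = 0\<close> by (simp add: c_def)
    ultimately have "(X1 + X2) * X1\<^sup>2 = X1 ^ 3 + C * X1" using E1 by (simp add: power_mult_distrib)
    then have "X1 * (X1 * X2) = X1 * C" by (simp add: power2_eq_square power3_eq_cube algebra_simps)
    then have "X1 * X2 = C" using Xs by simp
    then have "(of_int x * a1 * a2)\<^sup>2 = (of_int (p * (x * h)\<^sup>2) :: rat)"
      by (simp add: X1_def X2_def C_def power2_eq_square mult_ac)
    then have "(of_int M1 * of_int M2)\<^sup>2 = (of_int (p * (h * e1 * e2)\<^sup>2) :: rat)"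
      using e1 e2 x0 by (simp add: a1_def a2_def field_simps power2_eq_square)
    then have "of_int ((M1 * M2)\<^sup>2) = (of_int (p * (h * e1 * e2)\<^sup>2) :: rat)" by simp
    then have sq: "(M1 * M2)\<^sup>2 = p * (h * e1 * e2)\<^sup>2" by (simp only: of_int_eq_iff)
    have "multiplicity p ((M1 * M2)\<^sup>2) = 2 * multiplicity p (M1 * M2)"
      using p M1 M2 by (intro prime_elem_multiplicity_power_distrib) auto
    moreover have "multiplicity p ((h * e1 * e2)\<^sup>2) = 2 * multiplicity p (h * e1 * e2)"
      using p h(1) e1 e2 by (intro prime_elem_multiplicity_power_distrib) auto
    then have "multiplicity p (p * (h * e1 * e2)\<^sup>2) = 1 + 2 * multiplicity p (h * e1 * e2)"
      using p p_gt_2 h(1) e1 e2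
        prime_elem_multiplicity_mult_distrib[OF prime_imp_prime_elem, of p p "(h * e1 * e2)\<^sup>2"]
      by simp
    ultimately have "2 * multiplicity p (M1 * M2) = 1 + 2 * multiplicity p (h * e1 * e2)"
      using sq by (simp only:)
    then show False by presburger
  qed
  \<comment> \<open>From X1 X2 X3 = c^2 and X1 X2 = -(x a1 a2)^2 it follows that X3 = -g^2; dividing
    the equation of the third point by g^2 gives the quartic of the class -1.\<close>
  define g where "g = c / (of_int x * a1 * a2)"
  have g0: "g \<noteq> 0" using c0 a0 rx by (simp add: g_def)
  have X3: "X3 = - (g\<^sup>2)"
    using L(1) a0 rx by (simp add: g_def X1_def X2_def field_simps power2_eq_square)
  have "((m * X3 + c) / g)\<^sup>2 = - (g ^ 4) - C"
    using L(2) g0 unfolding X3 by (simp add: field_simps power2_eq_square power3_eq_cube power4_eq_xxxx)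
  also have "\<dots> = of_int (- 1) * g ^ 4 + of_int (4 * p * q\<^sup>2) * 1 ^ 4"
    by (simp add: C_def h(2) power_mult_distrib)
  finally have "has_rat_pt (- 1) (4 * p * q\<^sup>2)" unfolding has_rat_pt_def using g0 by blast
  then have "- 1 \<in> W0" by (simp add: W0_def)
  then show False using m1 by blast
qed

text \<open>As (p - 1) / 4 is even, the fourth-power condition ignores signs. By assumption it fails
  for 2 or for q, so by multiplicativity it holds for at most one of 2, q and 2 q.\<close>

lemma W0_subset:
  assumes "\<not> (quartic_sym 2 p = 1 \<and> quartic_sym q p = 1)"
  obtains x where "x = 2 \<or> x = q \<or> x = 2 * q" "W0 \<subseteq> {1, x, - x}"
proof -
  define k where "k = nat ((p - 1) div 4)"
  have "even ((p - 1) div 4)" using p8 by presburger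
  then have k: "even k" using p_gt_2 by (simp add: k_def even_nat_iff)
  define P where "P = (\<lambda>b :: int. [b ^ k = 1] (mod p))"
  have pm: "P (- b) = P b" for b using k by (simp add: P_def)
  have W: "P b" if "b \<in> W0" for b using W0_imp_quartic[OF that] by (simp add: P_def k_def)
  have N: "b \<notin> W0 \<and> - b \<notin> W0" if "\<not> P b" for b using that W[of b] W[of "- b"] pm[of b] by blast
  have "W0 \<subseteq> {1, - 1, 2, - 2, q, - q, 2 * q, - (2 * q)}"
    unfolding divisors_2q[symmetric] W0_def by blast
  then have sub: "W0 \<subseteq> {1, 2, - 2, q, - q, 2 * q, - (2 * q)}"
    using minus_one_not_in_W0[OF assms] by blast
  have mult: "P (2 * q) = P q" if "P 2"
  proof -
    have "[(2 * q) ^ k = 1 * q ^ k] (mod p)"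
      unfolding power_mult_distrib using that by (intro cong_mult) (simp_all add: P_def)
    then show ?thesis by (simp add: P_def cong_def)
  qed
  have mult': "P (2 * q) = P 2" if "P q"
  proof -
    have "[(2 * q) ^ k = 2 ^ k * 1] (mod p)"
      unfolding power_mult_distrib using that by (intro cong_mult) (simp_all add: P_def)
    then show ?thesis by (simp add: P_def cong_def)
  qed
  have "\<not> (P 2 \<and> P q)" using assms by (simp add: quartic_sym_eq_1_iff P_def k_def)
  then consider "P 2" "\<not> P q" "\<not> P (2 * q)" | "P q" "\<not> P 2" "\<not> P (2 * q)" | "\<not> P 2" "\<not> P q"
    using mult mult' by auto
  then show ?thesis
  proof cases
    case 1
    then have "W0 \<subseteq> {1, 2, - 2}" using sub N[OF 1(2)] N[OF 1(3)] by blast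
    then show ?thesis using that[of 2] by blast
  next
    case 2
    then have "W0 \<subseteq> {1, q, - q}" using sub N[OF 2(2)] N[OF 2(3)] by blast
    then show ?thesis using that[of q] by blast
  next
    case 3
    then have "W0 \<subseteq> {1, 2 * q, - (2 * q)}" using sub N[OF 3(1)] N[OF 3(2)] by blast
    then show ?thesis using that[of "2 * q"] by blast
  qed
qed

text \<open>\<open>W0\<close> has 1 or 2 elements, so W has 2 or 4 among 16 classes; the
  divisibility says that 4 divides the order of the quotient.\<close>

lemma card_W_psi_dvd:
  assumes "\<not> (quartic_sym 2 p = 1 \<and> quartic_sym q p = 1)"
  shows "4 * card (W_psi p q) dvd card (Selmer_psi p q)"
proof -
  obtain x where x: "x = 2 \<or> x = q \<or> x = 2 * q" "W0 \<subseteq> {1, x, - x}"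
    using W0_subset[OF assms] by blast
  have "\<not> (x \<in> W0 \<and> - x \<in> W0)"
    using not_both_in_W0[OF minus_one_not_in_W0[OF assms] x(1)] .
  then have "W0 = {1} \<or> W0 = {1, x} \<or> W0 = {1, - x}" using x(2) one_in_W0 by blast
  moreover have "x \<noteq> 1" "- x \<noteq> 1" using x(1) q_gt_2 by auto
  ultimately have "card W0 = 1 \<or> card W0 = 2" by (elim disjE) simp_all
  then show ?thesis unfolding card_W_psi card_Selmer_psi by (elim disjE) simp_all
qed

end

theorem theorem6:
  fixes p q :: int
  assumes "prime p" and "prime q" and "[p = 1] (mod 8)" and "[q = 3] (mod 4)"
    and "Legendre p q = 1"
  shows "(has_rat_pt p (-(4 * q^2)) \<longrightarrow> quartic_sym 2 p = 1 \<and> quartic_sym q p = 1)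
    \<and> Selmer_phi p q = W_phi p q
    \<and> ((quartic_sym 2 p = -1 \<or> quartic_sym q p = -1) \<longrightarrow>
         4 * card (W_psi p q) dvd card (Selmer_psi p q))"
proof -
  interpret prime_pair p q
    using assms by unfold_locales (simp_all add: cong_def)
  show ?thesis
    using quartic_of_rational_point Selmer_phi_eq_W_phi card_W_psi_dvd by auto
qed

end
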